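(* Let $\tau>0$ and $\sigma\ge 1$. Let $v$ be a submultiplicative weight on $\mathbb{R}^d$, let $m$ be a $v$-moderate weight on $\mathbb{R}^d$, and let $g\in M^{1,1}_{v\otimes 1}(\mathbb{R}^d)\setminus\{0\}$ be such that for some $C_g>0$, $$\|\partial^{\alpha} g\|_{L^1_v(\mathbb{R}^d)}\lesssim C_g^{|\alpha|^{\sigma}}|\alpha|^{\tau|\alpha|^{\sigma}},\qquad \alpha\in\mathbb{N}^d.$$ Then for a smooth function $f$ on $\mathbb{R}^d$ the following conditions are equivalent: (i) There exists a constant $C_f>0$ such that $$|\partial^{\alpha} f(x)|\lesssim m(x)\, C_f^{|\alpha|^{\sigma}}|\alpha|^{\tau|\alpha|^{\sigma}},\qquad x\in\mathbb{R}^d,\ \alpha\in\mathbb{N}^d.$$ (ii) There exists a constant $C_{f,g}>0$ such that $$|\xi|^{|\alpha|}\,|V_g f(x,\xi)|\lesssim m(x)\, C_{f,g}^{|\alpha|^{\sigma}}|\alpha|^{\tau|\alpha|^{\sigma}},\qquad x,\xi\in\mathbb{R}^d,\ \alpha\in\mathbb{N}^d.$$ (iii) There exists a constant $C>0$ such that $$|V_g f(x,\xi)|\lesssim m(x)\, e^{-T_{\tau,\sigma,C}(|\xi|)},\qquad x,\xi\in\mathbb{R}^d.$$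
   Context: Notation: $\mathbb{N}=\{0,1,2,\dots\}$; $A\lesssim B$ means $A\le cB$ for some constant $c>0$ independent of the running variables $x,\xi,\alpha$. For $|\alpha|=0$ the expression $|\alpha|^{\tau|\alpha|^\sigma}$ is interpreted as $1$. Extended associated function: $M_p^{\tau,\sigma}=p^{\tau p^{\sigma}}$ for $p\ge1$, $M_0^{\tau,\sigma}=1$, and for $h,k>0$ $$T_{\tau,\sigma,h}(k)=\sup_{p\in\mathbb{N}}\ln_+\frac{h^{p^{\sigma}}k^{p}}{M_p^{\tau,\sigma}},\qquad \ln_+A=\max\{0,\ln A\},$$ with $T_{\tau,\sigma,h}(0)=0$. Weights: a submultiplicative weight $v$ is a continuous, positive, even function with $v(0)=1$ and $v(z_1+z_2)\le v(z_1)v(z_2)$ for all $z_1,z_2$. A weight $m$ is $v$-moderate, written $m\in\mathcal{M}_v$, if $m$ is positive, even and there is $C>0$ with $m(z_1+z_2)\le C v(z_1)m(z_2)$ for all $z_1,z_2$. Also $\|F\|_{L^1_v}=\int_{\mathbb{R}^d}|F(x)|v(x)\,dx$. Short-time Fourier transform (STFT) of $f$ with window $g$: $$V_gf(x,\xi)=\int_{\mathbb{R}^d} e^{-2\pi i t\cdot\xi}f(t)\overline{g(t-x)}\,dt,\qquad x,\xi\in\mathbb{R}^d,$$ extended by duality where appropriate. Modulation space: $\mathcal{S}^{(1)}(\mathbb{R}^d)$ is the space of functions $\varphi$ with $\sup_x|\varphi(x)|e^{h|x|}<\infty$ and $\sup_\omega|\hat\varphi(\omega)|e^{h|\omega|}<\infty$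 for every $h>0$ (where $\hat\varphi(\omega)=\int\varphi(t)e^{-2\pi i t\cdot\omega}dt$), and $\mathcal{S}^{(1)'}(\mathbb{R}^d)$ is its dual. With $(v\otimes1)(x,\omega)=v(x)$, the space $M^{1,1}_{v\otimes1}(\mathbb{R}^d)$ consists of all $g\in\mathcal{S}^{(1)'}(\mathbb{R}^d)$ such that $\int_{\mathbb{R}^d}\int_{\mathbb{R}^d}|V_\varphi g(x,\omega)|\,v(x)\,dx\,d\omega<\infty$ for a fixed nonzero $\varphi\in\mathcal{S}^{(1)}(\mathbb{R}^d)$ (the space does not depend on the choice of $\varphi$). *)

theory Defs
  imports "HOL-Analysis.Analysis"
begin

text \<open>The space $\mathbb{R}^d$ is \<open>real ^ 'n\<close> with $d$ the cardinality of \<open>'n\<close>, and a multi-index is an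
  element of \<open>nat ^ 'n\<close>.\<close>

definition mi_length :: "nat ^ 'n::finite \<Rightarrow> nat" where
  "mi_length \<alpha> = (\<Sum>i\<in>UNIV. \<alpha> $ i)"

definition partial_deriv :: "'n \<Rightarrow> (real ^ 'n::finite \<Rightarrow> complex) \<Rightarrow> real ^ 'n \<Rightarrow> complex" where
  "partial_deriv i f x = vector_derivative (\<lambda>t. f (x + t *\<^sub>R axis i 1)) (at 0)"

primrec iter_deriv :: "'n list \<Rightarrow> (real ^ 'n::finite \<Rightarrow> complex) \<Rightarrow> real ^ 'n \<Rightarrow> complex" where
  "iter_deriv [] f = f"
| "iter_deriv (i # is) f = partial_deriv i (iter_deriv is f)"

text \<open>The library has no multi-index derivative. Each index \<open>i\<close> is used \<open>\<alpha> $ i\<close> times, in some chosen order;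
  on smooth functions, the only ones it is applied to, the order is irrelevant.\<close>

definition mi_deriv :: "nat ^ 'n \<Rightarrow> (real ^ 'n::finite \<Rightarrow> complex) \<Rightarrow> real ^ 'n \<Rightarrow> complex" where
  "mi_deriv \<alpha> f = iter_deriv (SOME is. \<forall>i. count_list is i = \<alpha> $ i) f"

definition smooth :: "(real ^ 'n::finite \<Rightarrow> complex) \<Rightarrow> bool" where
  "smooth f \<longleftrightarrow> (\<forall>is x. iter_deriv is f differentiable (at x))"

text \<open>The case distinction is needed because \<open>0 powr 0 = 0\<close>.\<close>

definition M_seq :: "real \<Rightarrow> real \<Rightarrow> nat \<Rightarrow> real" where
  "M_seq \<tau> \<sigma> p = (if p = 0 then 1 else real p powr (\<tau> * real p powr \<sigma>))"

definition ln_plus :: "real \<Rightarrow> real" where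
  "ln_plus A = max 0 (ln A)"

text \<open>For \<open>\<tau> > 0\<close>, \<open>\<sigma> \<ge> 1\<close> and \<open>h, k > 0\<close> the supremum is over a bounded set, so the conditionally complete
  supremum on the reals is the intended one.\<close>

definition assoc_fun :: "real \<Rightarrow> real \<Rightarrow> real \<Rightarrow> real \<Rightarrow> real" where
  "assoc_fun \<tau> \<sigma> h k =
     (if k = 0 then 0
      else (SUP p::nat. ln_plus (h powr (real p powr \<sigma>) * k ^ p / M_seq \<tau> \<sigma> p)))"

definition submultiplicative_weight :: "(real ^ 'n::finite \<Rightarrow> real) \<Rightarrow> bool" where
  "submultiplicative_weight v \<longleftrightarrow>
     continuous_on UNIV v \<and> (\<forall>z. 0 < v z) \<and> (\<forall>z. v (- z) = v z) \<and> v 0 = 1 \<and>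
     (\<forall>z1 z2. v (z1 + z2) \<le> v z1 * v z2)"

definition moderate_weight :: "(real ^ 'n::finite \<Rightarrow> real) \<Rightarrow> (real ^ 'n \<Rightarrow> real) \<Rightarrow> bool" where
  "moderate_weight v m \<longleftrightarrow>
     (\<forall>z. 0 < m z) \<and> (\<forall>z. m (- z) = m z) \<and>
     (\<exists>C>0. \<forall>z1 z2. m (z1 + z2) \<le> C * v z1 * m z2)"

definition L1_norm :: "(real ^ 'n::finite \<Rightarrow> real) \<Rightarrow> (real ^ 'n \<Rightarrow> complex) \<Rightarrow> ennreal" where
  "L1_norm v F = (\<integral>\<^sup>+x. ennreal (norm (F x) * v x) \<partial>lborel)"

definition fourier :: "(real ^ 'n::finite \<Rightarrow> complex) \<Rightarrow> real ^ 'n \<Rightarrow> complex" where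
  "fourier \<phi> \<omega> = (LINT t|lborel. \<phi> t * cis (- 2 * pi * (t \<bullet> \<omega>)))"

text \<open>Continuity selects the representative in the almost-everywhere class: the two decay conditions, the
  second of which only sees the class, then make the function smooth by Fourier inversion.\<close>

definition S1 :: "(real ^ 'n::finite \<Rightarrow> complex) set" where
  "S1 = {\<phi>. continuous_on UNIV \<phi> \<and>
         (\<forall>h>0. bdd_above (range (\<lambda>x. norm (\<phi> x) * exp (h * norm x))) \<and>
                bdd_above (range (\<lambda>\<omega>. norm (fourier \<phi> \<omega>) * exp (h * norm \<omega>))))}"

definition S1_seminorm :: "real \<Rightarrow> (real ^ 'n::finite \<Rightarrow> complex) \<Rightarrow> real" where
  "S1_seminorm h \<phi> = (SUP x. norm (\<phi> x) * exp (h * norm x)) +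
                     (SUP \<omega>. norm (fourier \<phi> \<omega>) * exp (h * norm \<omega>))"

text \<open>Elements of the dual of \<open>S1\<close> are complex-linear functionals, continuous for the Frechet topology of the
  seminorms above (which increase with \<open>h\<close>, so that one seminorm suffices). Their values off \<open>S1\<close> carry no
  meaning.\<close>

definition S1_dual :: "((real ^ 'n::finite \<Rightarrow> complex) \<Rightarrow> complex) set" where
  "S1_dual = {u. (\<forall>\<phi>\<in>S1. \<forall>\<psi>\<in>S1. u (\<lambda>t. \<phi> t + \<psi> t) = u \<phi> + u \<psi>) \<and>
             (\<forall>c. \<forall>\<phi>\<in>S1. u (\<lambda>t. c * \<phi> t) = c * u \<phi>) \<and>
             (\<exists>h>0. \<exists>B. \<forall>\<phi>\<in>S1. norm (u \<phi>) \<le> B * S1_seminorm h \<phi>)}"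

definition represents ::
  "(real ^ 'n::finite \<Rightarrow> complex) \<Rightarrow> ((real ^ 'n \<Rightarrow> complex) \<Rightarrow> complex) \<Rightarrow> bool" where
  "represents G u \<longleftrightarrow> G \<in> borel_measurable lborel \<and>
     (\<forall>\<phi>\<in>S1. integrable lborel (\<lambda>t. G t * \<phi> t) \<and> u \<phi> = (LINT t|lborel. G t * \<phi> t))"

definition dual_deriv ::
  "nat ^ 'n \<Rightarrow> ((real ^ 'n::finite \<Rightarrow> complex) \<Rightarrow> complex) \<Rightarrow> (real ^ 'n \<Rightarrow> complex) \<Rightarrow> complex" where
  "dual_deriv \<alpha> u \<phi> = (- 1) ^ mi_length \<alpha> * u (mi_deriv \<alpha> \<phi>)"

definition stft_integrand ::
  "(real ^ 'n::finite \<Rightarrow> complex) \<Rightarrow> (real ^ 'n \<Rightarrow> complex) \<Rightarrow>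
   real ^ 'n \<Rightarrow> real ^ 'n \<Rightarrow> real ^ 'n \<Rightarrow> complex" where
  "stft_integrand g f x \<xi> t = cis (- 2 * pi * (t \<bullet> \<xi>)) * f t * cnj (g (t - x))"

definition stft ::
  "(real ^ 'n::finite \<Rightarrow> complex) \<Rightarrow> (real ^ 'n \<Rightarrow> complex) \<Rightarrow> real ^ 'n \<Rightarrow> real ^ 'n \<Rightarrow> complex" where
  "stft g f x \<xi> = (LINT t|lborel. stft_integrand g f x \<xi> t)"

text \<open>The integral of a non-integrable function is \<open>0\<close> in the library, so an estimate on \<open>stft g f\<close> is
  meaningful only together with the following predicate.\<close>

definition stft_exists ::
  "(real ^ 'n::finite \<Rightarrow> complex) \<Rightarrow> (real ^ 'n \<Rightarrow> complex) \<Rightarrow> bool" where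
  "stft_exists g f \<longleftrightarrow> (\<forall>x \<xi>. integrable lborel (stft_integrand g f x \<xi>))"

text \<open>Extension of \<open>stft \<phi>\<close> to the dual, for a window \<open>\<phi>\<close> in \<open>S1\<close>. The dual pairing is bilinear, hence the
  conjugate on the window.\<close>

definition dual_stft ::
  "(real ^ 'n::finite \<Rightarrow> complex) \<Rightarrow> ((real ^ 'n \<Rightarrow> complex) \<Rightarrow> complex) \<Rightarrow>
   real ^ 'n \<Rightarrow> real ^ 'n \<Rightarrow> complex" where
  "dual_stft \<phi> u x \<omega> = u (\<lambda>t. cis (- 2 * pi * (t \<bullet> \<omega>)) * cnj (\<phi> (t - x)))"

text \<open>The space with weight $v\otimes 1$. It does not depend on the nonzero window, so ``for a fixed window'' is
  rendered existentially.\<close>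

definition M11 :: "(real ^ 'n::finite \<Rightarrow> real) \<Rightarrow> ((real ^ 'n \<Rightarrow> complex) \<Rightarrow> complex) set" where
  "M11 v = {u \<in> S1_dual. \<exists>\<phi>\<in>S1. \<phi> \<noteq> (\<lambda>t. 0) \<and>
     (\<integral>\<^sup>+\<omega>. \<integral>\<^sup>+x. ennreal (norm (dual_stft \<phi> u x \<omega>) * v x) \<partial>lborel \<partial>lborel) < \<infinity>}"

end

theory Submission
  imports Defs "HOL-Probability.Characteristic_Functions" "HOL-Probability.Sinc_Integral"
begin

text \<open>The hypothesis on \<open>g\<close> says that all its weak derivatives lie in $L^1_v$. Testing the weak
  derivative identity on modulated Gaussians of growing width shows that the Fourier transforms of the
  weak derivatives are the expected monomial multiples of $\hat g$, which is therefore rapidly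
  decreasing; by Fourier inversion \<open>g\<close> agrees almost everywhere with a smooth window \<open>\<gamma>\<close> whose classical
  derivatives obey the given bounds.

  For (i) implies (ii), $(2\pi i\xi_j)^N V_\gamma f(x,\xi)$ is the Fourier transform of
  $\partial_j^N(f\,\overline{\gamma(\cdot-x)})$, estimated by the Leibniz rule. Conversely, decay of the STFT and
  Fourier inversion bound all derivatives of $P_x = f\,\overline{\gamma(\cdot-x)}$ by \<open>m(x)\<close>. Since
  $\int \partial_t^\alpha[f(t)|\gamma(t-x)|^2]\,dx = \partial^\alpha f(t)\,\|\gamma\|_2^2$ while the integrand is
  $\partial_t^\alpha[P_x(t)\gamma(t-x)]$, the Leibniz rule bounds $\partial^\alpha f$. The equivalence of (ii)
  and (iii) unfolds the supremum defining the associated function. The constants are absorbed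
  using that $p\mapsto C^{p^\sigma}p^{\tau p^\sigma}$ is supermultiplicative for $C\ge1$ and stable
  under shifts of $p$.\<close>

section \<open>Gaussians and their Fourier transforms\<close>

text \<open>The order of differentiation chosen by \<open>mi_deriv\<close> is unknown, so
  derivatives are indexed by lists of coordinates, and a Leibniz expansion runs over the 2^N ways of
  splitting a list, without binomial coefficients. Mixed derivatives have to be permuted only for
  Gaussians, where the product structure shows that this is harmless. For \<open>f\<close> it is
  avoided: |\<xi>|^N is controlled by the pure powers of the coordinates of \<xi>, and a list with
  one repeated letter has a single order.

  The weight \<open>m\<close> has to be moved between the points x and t. Each move costs a factor
  v(t - x), which is placed next to a derivative of \<gamma>(t - x) and paid by its weighted L^1
  norm. This is why the reconstruction of \<open>f\<close> uses |\<gamma>|^2: one copy of the window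
  is spent on P_x, the other pays for passing from m(x) to m(t) and makes the integral over x
  converge. Integrating over frequencies costs 2d additional powers of |\<xi>| in dimension d, hence
  the need for stability of the sequence under shifts.\<close>

lemma lborel_integral_affine:
  fixes f :: "'a::euclidean_space \<Rightarrow> 'b::{banach, second_countable_topology}" and t :: 'a
  assumes c: "c \<noteq> 0" and f: "integrable lborel f"
  shows "integrable lborel (\<lambda>x. f (t + c *\<^sub>R x))"
    and "(LINT x|lborel. f x) = \<bar>c\<bar> ^ DIM('a) *\<^sub>R (LINT x|lborel. f (t + c *\<^sub>R x))"
proof -
  have fm[measurable]: "f \<in> borel_measurable borel" using f by auto
  let ?D = "density (distr lborel borel (\<lambda>x. t + c *\<^sub>R x)) (\<lambda>_. ennreal (\<bar>c\<bar>^DIM('a)))"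
  have D: "lborel = ?D" using lborel_affine[OF c, of t] by (simp add: ennreal_power)
  have "integrable ?D f" using f D by metis
  hence "integrable lborel (\<lambda>x. \<bar>c\<bar>^DIM('a) *\<^sub>R f (t + c *\<^sub>R x))"
    by (subst (asm) integrable_density) (auto simp: integrable_distr_eq)
  from integrable_scaleR_right[OF this, of "inverse (\<bar>c\<bar>^DIM('a))"]
  show "integrable lborel (\<lambda>x. f (t + c *\<^sub>R x))" using c by simp
  have "(LINT x|lborel. f x) = integral\<^sup>L ?D f" using D by metis
  also have "\<dots> = (LINT x|lborel. \<bar>c\<bar>^DIM('a) *\<^sub>R f (t + c *\<^sub>R x))"
    by (subst integral_density) (auto simp: integral_distr)
  finally show "(LINT x|lborel. f x) = \<bar>c\<bar> ^ DIM('a) *\<^sub>R (LINT x|lborel. f (t + c *\<^sub>R x))" by simp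
qed

lemma lborel_shift:
  fixes f :: "'a::euclidean_space \<Rightarrow> 'b::{banach, second_countable_topology}" and t :: 'a
  assumes f: "integrable lborel f"
  shows "integrable lborel (\<lambda>x. f (x + t))" "(LINT x|lborel. f (x + t)) = (LINT x|lborel. f x)"
  using lborel_integral_affine[OF _ f, of 1 t] by (simp_all add: add.commute)

lemma lborel_reflect:
  fixes f :: "'a::euclidean_space \<Rightarrow> 'b::{banach, second_countable_topology}" and t :: 'a
  assumes f: "integrable lborel f"
  shows "integrable lborel (\<lambda>x. f (t - x))" "(LINT x|lborel. f (t - x)) = (LINT x|lborel. f x)"
  using lborel_integral_affine[OF _ f, of "-1" t] by simp_all

text \<open>Lebesgue measure is the image of a product measure indexed by the vectors of
  \<open>Basis\<close>, while the factors here are indexed by coordinates; \<open>ix\<close>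
  recovers the coordinate from the basis vector.\<close>

lemma lborel_prod_integral:
  fixes p :: "'n::finite \<Rightarrow> real \<Rightarrow> complex"
  assumes p: "\<And>i. integrable lborel (p i)"
  shows "integrable lborel (\<lambda>x::real^'n. \<Prod>i\<in>UNIV. p i (x $ i))"
    and "(LINT x|lborel. (\<Prod>i\<in>UNIV. p i ((x::real^'n) $ i))) = (\<Prod>i\<in>UNIV. LINT r|lborel. p i r)"
proof -
  define ix :: "real^'n \<Rightarrow> 'n" where "ix b = (SOME i. b = axis i 1)" for b
  have ix: "ix (axis i 1) = i" for i
    unfolding ix_def by (rule some_equality) (auto simp: axis_eq_axis)
  have B: "(Basis :: (real^'n) set) = (\<lambda>i. axis i 1) ` UNIV"
    by (auto simp: Basis_vec_def)
  have inj: "inj (\<lambda>i::'n. axis i (1::real))" by (auto simp: inj_on_def axis_eq_axis)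
  have re: "(\<Prod>b\<in>Basis. q (ix b) b) = (\<Prod>i\<in>UNIV. q i (axis i 1))" for q :: "'n \<Rightarrow> real^'n \<Rightarrow> complex"
    unfolding B by (subst prod.reindex[OF inj]) (simp add: ix)
  let ?T = "\<lambda>f. \<Sum>b\<in>(Basis :: (real^'n) set). f b *\<^sub>R b"
  let ?P = "Pi\<^sub>M (Basis :: (real^'n) set) (\<lambda>_. lborel :: real measure)"
  have nth: "?T f $ i = f (axis i 1)" for f i
    unfolding B by (subst sum.reindex[OF inj]) (simp add: axis_def if_distrib cong: if_cong)
  have m[measurable]: "p i \<in> borel_measurable borel" for i using p[of i] by auto
  have T: "?T \<in> ?P \<rightarrow>\<^sub>M borel" by measurable
  have pm: "(\<lambda>x::real^'n. \<Prod>i\<in>UNIV. p i (x $ i)) \<in> borel_measurable borel" by measurable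
  interpret product_sigma_finite "\<lambda>_::real^'n. lborel :: real measure" ..
  have eq: "(\<Prod>i\<in>UNIV. p i (?T f $ i)) = (\<Prod>b\<in>Basis. p (ix b) (f b))" for f
    unfolding nth by (rule re[symmetric])
  have "integrable ?P (\<lambda>f. \<Prod>b\<in>Basis. p (ix b) (f b))"
    by (rule product_integrable_prod) (auto simp: p)
  thus "integrable lborel (\<lambda>x::real^'n. \<Prod>i\<in>UNIV. p i (x $ i))"
    by (subst lborel_eq, subst integrable_distr_eq[OF T pm]) (simp only: eq)
  have "(LINT x|lborel. (\<Prod>i\<in>UNIV. p i ((x::real^'n) $ i))) = (LINT f|?P. (\<Prod>b\<in>Basis. p (ix b) (f b)))"
    by (subst lborel_eq, subst integral_distr[OF T pm]) (simp only: eq)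
  also have "\<dots> = (\<Prod>b\<in>Basis. integral\<^sup>L lborel (p (ix b)))"
    by (rule product_integral_prod) (auto simp: p)
  also have "\<dots> = (\<Prod>i\<in>UNIV. LINT r|lborel. p i r)" by (rule re)
  finally show "(LINT x|lborel. (\<Prod>i\<in>UNIV. p i ((x::real^'n) $ i))) = (\<Prod>i\<in>UNIV. LINT r|lborel. p i r)" .
qed

definition gauss1 :: "real \<Rightarrow> real \<Rightarrow> real \<Rightarrow> real \<Rightarrow> complex" where
  "gauss1 s y \<eta> r = of_real (exp (- pi * (r - y)\<^sup>2 / s\<^sup>2)) * cis (- 2 * pi * (r * \<eta>))"

text \<open>The modulation carries the sign of the Fourier kernel, so that a Fourier transform
  merely adds \<omega> to \<eta> and reduces to the plain integral of another
  \<open>gauss\<close>.\<close>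

definition gauss :: "real \<Rightarrow> real ^ 'n::finite \<Rightarrow> real ^ 'n \<Rightarrow> real ^ 'n \<Rightarrow> complex" where
  "gauss s y \<eta> t = of_real (exp (- pi * (norm (t - y))\<^sup>2 / s\<^sup>2)) * cis (- 2 * pi * (t \<bullet> \<eta>))"

lemma cis_sum: "finite A \<Longrightarrow> cis (\<Sum>i\<in>A. f i) = (\<Prod>i\<in>A. cis (f i))"
  by (induction A rule: finite_induct) (auto simp: cis_mult[symmetric])

lemma norm_power2_vec: "(norm (x::real^'n::finite))\<^sup>2 = (\<Sum>i\<in>UNIV. (x $ i)\<^sup>2)"
  unfolding norm_vec_def L2_set_def by (simp add: sum_nonneg)

lemma gauss_prod: "gauss s y \<eta> t = (\<Prod>i\<in>UNIV. gauss1 s (y $ i) (\<eta> $ i) (t $ i))"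
proof -
  have a: "- pi * (norm (t - y))\<^sup>2 / s\<^sup>2 = (\<Sum>i\<in>UNIV. - pi * (t $ i - y $ i)\<^sup>2 / s\<^sup>2)"
    unfolding norm_power2_vec by (simp add: sum_distrib_left sum_divide_distrib sum_negf)
  have b: "- 2 * pi * (t \<bullet> \<eta>) = (\<Sum>i\<in>UNIV. - 2 * pi * (t $ i * \<eta> $ i))"
    unfolding inner_vec_def by (simp add: sum_distrib_left sum_negf)
  show ?thesis unfolding gauss_def gauss1_def prod.distrib a b
    by (simp add: exp_sum cis_sum)
qed

text \<open>The substitution x = sqrt(2 pi) (r - y) / s turns the integral into the characteristic
  function of the standard normal distribution.\<close>

lemma gauss1_integral:
  assumes s: "s > 0"
  shows "integrable lborel (gauss1 s y \<eta>)"
    and "(LINT r|lborel. gauss1 s y \<eta> r)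
       = of_real s * of_real (exp (- pi * s\<^sup>2 * \<eta>\<^sup>2)) * cis (- 2 * pi * (y * \<eta>))"
proof -
  define N where "N = (\<lambda>x. complex_of_real (std_normal_density x))"
  \<comment> \<open>The point of evaluation of the characteristic function: with the substituted x,
    the product a x equals -2 pi \<eta> (r - y).\<close>
  define a where "a = - sqrt (2 * pi) * s * \<eta>"
  have N: "integrable lborel (\<lambda>x. iexp (a * x) * N x)"
    unfolding N_def
    by (rule Bochner_Integration.integrable_bound[where f="\<lambda>x. std_normal_density x"])
       (auto simp: norm_mult)
  have "char std_normal_distribution a = (LINT x|lborel. iexp (a * x) * N x)"
    unfolding char_def N_def
    by (subst integral_density) (auto simp: normal_density_nonneg scaleR_conv_of_real mult.commute)
  hence I: "(LINT x|lborel. iexp (a * x) * N x) = of_real (exp (- (a\<^sup>2) / 2))"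
    by (simp add: char_std_normal_distribution)
  let ?c = "sqrt (2 * pi) / s" and ?t = "- y * sqrt (2 * pi) / s"
  have c: "?c \<noteq> 0" using s by simp
  have key: "gauss1 s y \<eta> r = of_real (sqrt (2*pi)) * cis (- 2 * pi * (y * \<eta>)) * (iexp (a * (?t + ?c *\<^sub>R r)) * N (?t + ?c *\<^sub>R r))" for r
  proof -
    have 1: "?t + ?c *\<^sub>R r = sqrt (2 * pi) * (r - y) / s"
      by (simp add: diff_divide_distrib algebra_simps)
    have 2: "std_normal_density (sqrt (2 * pi) * (r - y) / s) = exp (- pi * (r - y)\<^sup>2 / s\<^sup>2) / sqrt (2*pi)"
    proof -
      have "- (sqrt (2 * pi) * (r - y) / s - 0)\<^sup>2 / (2 * 1\<^sup>2) = - pi * (r - y)\<^sup>2 / s\<^sup>2"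
        by (simp only: power_mult_distrib power_divide diff_0_right) simp
      thus ?thesis unfolding normal_density_def by simp
    qed
    have 3: "a * (sqrt (2 * pi) * (r - y) / s) = - 2 * pi * \<eta> * (r - y)"
      unfolding a_def using s by (simp add: field_simps flip: power2_eq_square)
    have 4: "cis (- 2 * pi * (y * \<eta>)) * iexp (- 2 * pi * \<eta> * (r - y)) = cis (- 2 * pi * (r * \<eta>))"
      unfolding cis_conv_exp[symmetric] cis_mult by (simp add: algebra_simps)
    have "of_real (sqrt (2*pi)) * cis (- 2 * pi * (y * \<eta>)) * (iexp (a * (?t + ?c *\<^sub>R r)) * N (?t + ?c *\<^sub>R r))
      = of_real (sqrt (2*pi) * (exp (- pi * (r - y)\<^sup>2 / s\<^sup>2) / sqrt (2*pi))) * (cis (- 2 * pi * (y * \<eta>)) * iexp (- 2 * pi * \<eta> * (r - y)))"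
      unfolding N_def 1 2 3 by simp
    thus ?thesis unfolding 4 gauss1_def by simp
  qed
  show "integrable lborel (gauss1 s y \<eta>)"
    unfolding key[abs_def] by (intro integrable_mult_right lborel_integral_affine(1)[OF c N])
  have "(LINT x|lborel. iexp (a * x) * N x) = \<bar>?c\<bar> *\<^sub>R (LINT r|lborel. iexp (a * (?t + ?c *\<^sub>R r)) * N (?t + ?c *\<^sub>R r))"
    using lborel_integral_affine(2)[OF c N, of ?t] by simp
  hence J: "(LINT r|lborel. iexp (a * (?t + ?c *\<^sub>R r)) * N (?t + ?c *\<^sub>R r)) = of_real (s / sqrt (2*pi) * exp (- (a\<^sup>2) / 2))"
    unfolding I using s by (simp add: scaleR_conv_of_real field_simps)
  have a2: "- (a\<^sup>2) / 2 = - pi * s\<^sup>2 * \<eta>\<^sup>2" unfolding a_def by (simp add: power_mult_distrib)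
  show "(LINT r|lborel. gauss1 s y \<eta> r)
       = of_real s * of_real (exp (- pi * s\<^sup>2 * \<eta>\<^sup>2)) * cis (- 2 * pi * (y * \<eta>))"
    unfolding key[abs_def] integral_mult_right_zero J a2 by simp
qed

lemma gauss_integral:
  fixes y \<eta> :: "real ^ 'n::finite"
  assumes s: "s > 0"
  shows "integrable lborel (gauss s y \<eta>)"
    and "(LINT t|lborel. gauss s y \<eta> t)
       = of_real (s ^ CARD('n)) * of_real (exp (- pi * s\<^sup>2 * (norm \<eta>)\<^sup>2)) * cis (- 2 * pi * (y \<bullet> \<eta>))"
proof -
  note P = lborel_prod_integral[where p="\<lambda>i. gauss1 s (y $ i) (\<eta> $ i)", OF gauss1_integral(1)[OF s]]
  show "integrable lborel (gauss s y \<eta>)" using P(1) by (simp add: gauss_prod[abs_def])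
  have a: "- pi * s\<^sup>2 * (norm \<eta>)\<^sup>2 = (\<Sum>i\<in>UNIV. - pi * s\<^sup>2 * (\<eta> $ i)\<^sup>2)"
    unfolding norm_power2_vec by (simp add: sum_distrib_left sum_negf)
  have b: "- 2 * pi * (y \<bullet> \<eta>) = (\<Sum>i\<in>UNIV. - 2 * pi * (y $ i * \<eta> $ i))"
    unfolding inner_vec_def by (simp add: sum_distrib_left sum_negf)
  show "(LINT t|lborel. gauss s y \<eta> t)
       = of_real (s ^ CARD('n)) * of_real (exp (- pi * s\<^sup>2 * (norm \<eta>)\<^sup>2)) * cis (- 2 * pi * (y \<bullet> \<eta>))"
    unfolding gauss_prod P(2) gauss1_integral(2)[OF s] a b
    by (simp add: exp_sum cis_sum prod.distrib)
qed

lemma gauss_mult_cis: "gauss s y \<eta> t * cis (- 2 * pi * (t \<bullet> \<omega>)) = gauss s y (\<eta> + \<omega>) t"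
  by (simp add: gauss_def inner_add_right distrib_left cis_mult mult.assoc)

lemma fourier_gauss:
  fixes y \<eta> \<omega> :: "real ^ 'n::finite"
  assumes s: "s > 0"
  shows "fourier (gauss s y \<eta>) \<omega> = of_real (s ^ CARD('n)) * of_real (exp (- pi * s\<^sup>2 * (norm (\<eta> + \<omega>))\<^sup>2)) * cis (- 2 * pi * (y \<bullet> (\<eta> + \<omega>)))"
  unfolding fourier_def gauss_mult_cis gauss_integral(2)[OF s] ..

lemma continuous_gauss [continuous_intros]: "continuous_on A (gauss s y \<eta>)"
  unfolding gauss_def[abs_def] divide_inverse by (intro continuous_intros)

lemma norm_gauss: "norm (gauss s y \<eta> t) = exp (- pi * (norm (t - y))\<^sup>2 / s\<^sup>2)"
  by (simp add: gauss_def norm_mult)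

section \<open>Iterated partial derivatives\<close>

text \<open>Unlike the total function \<open>partial_deriv\<close>, this asserts existence; since it
  quantifies over all base points, the derivative at parameter 0 suffices.\<close>

definition has_partial :: "'n \<Rightarrow> (real ^ 'n::finite \<Rightarrow> complex) \<Rightarrow> (real ^ 'n \<Rightarrow> complex) \<Rightarrow> bool" where
  "has_partial i F F' \<longleftrightarrow> (\<forall>x. ((\<lambda>t. F (x + t *\<^sub>R axis i 1)) has_vector_derivative F' x) (at 0))"

lemma has_partialD_at:
  assumes "has_partial i F F'"
  shows "((\<lambda>t. F (x + t *\<^sub>R axis i 1)) has_vector_derivative F' (x + r *\<^sub>R axis i 1)) (at r)"
proof -
  have "((\<lambda>t. F ((x + r *\<^sub>R axis i 1) + t *\<^sub>R axis i 1)) has_vector_derivative F' (x + r *\<^sub>R axis i 1)) (at (r - r))"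
    using assms by (simp add: has_partial_def)
  moreover have "((\<lambda>t. t - r) has_vector_derivative 1) (at r)"
    by (auto intro!: derivative_eq_intros)
  ultimately have "((\<lambda>t. F ((x + r *\<^sub>R axis i 1) + t *\<^sub>R axis i 1)) \<circ> (\<lambda>t. t - r) has_vector_derivative 1 *\<^sub>R F' (x + r *\<^sub>R axis i 1)) (at r)"
    by (intro vector_diff_chain_at)
  thus ?thesis by (simp add: o_def algebra_simps)
qed

lemma has_partial_partial_deriv: "has_partial i F F' \<Longrightarrow> partial_deriv i F = F'"
  unfolding has_partial_def partial_deriv_def by (auto intro!: ext vector_derivative_at)

lemma has_partial_mult:
  "has_partial i F F' \<Longrightarrow> has_partial i G G' \<Longrightarrow> has_partial i (\<lambda>t. F t * G t) (\<lambda>t. F t * G' t + F' t * G t)"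
  unfolding has_partial_def
proof
  fix x assume "\<forall>x. ((\<lambda>t. F (x + t *\<^sub>R axis i 1)) has_vector_derivative F' x) (at 0)"
    "\<forall>x. ((\<lambda>t. G (x + t *\<^sub>R axis i 1)) has_vector_derivative G' x) (at 0)"
  from has_vector_derivative_mult[OF this(1)[rule_format, of x] this(2)[rule_format, of x]]
  show "((\<lambda>t. F (x + t *\<^sub>R axis i 1) * G (x + t *\<^sub>R axis i 1)) has_vector_derivative F x * G' x + F' x * G x) (at 0)"
    by simp
qed

lemma has_partial_sum_list:
  "(\<And>p. p \<in> set ps \<Longrightarrow> has_partial i (F p) (F' p)) \<Longrightarrow>
   has_partial i (\<lambda>t. \<Sum>p\<leftarrow>ps. F p t) (\<lambda>t. \<Sum>p\<leftarrow>ps. F' p t)"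
  by (induction ps) (auto simp: has_partial_def intro!: has_vector_derivative_add has_vector_derivative_const)

lemma has_partial_cnj: "has_partial i F F' \<Longrightarrow> has_partial i (\<lambda>t. cnj (F t)) (\<lambda>t. cnj (F' t))"
  unfolding has_partial_def by (auto intro!: has_vector_derivative_cnj)

lemma has_partial_shift: "has_partial i F F' \<Longrightarrow> has_partial i (\<lambda>t. F (t - x)) (\<lambda>t. F' (t - x))"
  unfolding has_partial_def by (auto simp: algebra_simps dest: spec[of _ "_ - x"])

lemma has_partial_cis:
  "has_partial i (\<lambda>t. cis (c * (t \<bullet> \<omega>))) (\<lambda>t. \<i> * of_real (c * \<omega> $ i) * cis (c * (t \<bullet> \<omega>)))"
  unfolding has_partial_def
proof
  fix x
  have e: "(x + t *\<^sub>R axis i 1) \<bullet> \<omega> = x \<bullet> \<omega> + t * \<omega> $ i" for t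
    by (simp add: inner_add_left inner_axis' )
  have "((\<lambda>t. exp (\<i> * of_real (c * (x \<bullet> \<omega>)) + \<i> * of_real (c * \<omega> $ i) * t)) has_field_derivative
     \<i> * of_real (c * \<omega> $ i) * exp (\<i> * of_real (c * (x \<bullet> \<omega>)))) (at (of_real 0))"
    by (auto intro!: derivative_eq_intros)
  from has_vector_derivative_real_field[OF this]
  show "((\<lambda>t. cis (c * ((x + t *\<^sub>R axis i 1) \<bullet> \<omega>))) has_vector_derivative \<i> * of_real (c * \<omega> $ i) * cis (c * (x \<bullet> \<omega>))) (at 0)"
    unfolding e by (simp add: cis_conv_exp algebra_simps)
qed

text \<open>No decay at infinity is assumed, so there are no boundary terms to discuss: the integral
  of F(x + e) - F(x) vanishes by translation invariance, and by the fundamental theorem of calculus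
  and Fubini it equals the integral of \<open>F'\<close>.\<close>

lemma integral_partial_eq_0:
  fixes F F' :: "real ^ 'n::finite \<Rightarrow> complex"
  assumes d: "has_partial i F F'" and c: "continuous_on UNIV F'"
    and F: "integrable lborel F" and F': "integrable lborel F'"
  shows "(LINT x|lborel. F' x) = 0"
proof -
  let ?e = "axis i 1 :: real^'n"
  have [measurable]: "F' \<in> borel_measurable borel" using F' by auto
  define f where "f = (\<lambda>r x. indicator {0..1::real} r *\<^sub>R F' (x + r *\<^sub>R ?e))"
  have ftc: "has_bochner_integral lborel (\<lambda>r. f r x) (F (x + ?e) - F x)" for x
  proof -
    have "has_bochner_integral lborel (\<lambda>r. indicator {0..1::real} r *\<^sub>R F' (x + r *\<^sub>R ?e)) (F (x + 1 *\<^sub>R ?e) - F (x + 0 *\<^sub>R ?e))"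
      by (rule has_bochner_integral_FTC_Icc[where F="\<lambda>r. F (x + r *\<^sub>R ?e)"])
         (auto intro!: has_vector_derivative_at_within has_partialD_at[OF d] continuous_intros
            continuous_on_compose2[OF c])
    thus ?thesis by (simp add: f_def)
  qed
  have fm: "(\<lambda>(r, x). f r x) \<in> borel_measurable (lborel \<Otimes>\<^sub>M lborel)"
    unfolding f_def by measurable
  have I: "integrable (lborel \<Otimes>\<^sub>M lborel) (\<lambda>(r, x). f r x)"
  proof (rule lborel_pair.Fubini_integrable[OF fm])
    have "(LINT x|lborel. norm (f r x)) = indicator {0..1} r * (LINT x|lborel. norm (F' x))" for r
      unfolding f_def using lborel_shift(2)[OF integrable_norm[OF F'], of "r *\<^sub>R ?e"] by simp
    thus "integrable lborel (\<lambda>r. LINT x|lborel. norm (case (r, x) of (r, x) \<Rightarrow> f r x))" by simp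
    show "AE r in lborel. integrable lborel (\<lambda>x. case (r, x) of (r, x) \<Rightarrow> f r x)"
      unfolding f_def using lborel_shift(1)[OF F'] by auto
  qed
  have "0 = (LINT x|lborel. F (x + ?e) - F x)"
    using lborel_shift[OF F, of ?e] F by simp
  also have "\<dots> = (LINT x|lborel. LINT r|lborel. f r x)"
    using ftc by (simp add: has_bochner_integral_iff)
  also have "\<dots> = (LINT r|lborel. LINT x|lborel. f r x)"
    by (rule lborel_pair.Fubini_integral[OF I])
  also have "\<dots> = (LINT r|lborel. indicator {0..1::real} r *\<^sub>R (LINT x|lborel. F' x))"
    unfolding f_def using lborel_shift(2)[OF F'] by simp
  also have "\<dots> = (LINT x|lborel. F' x)" by simp
  finally show ?thesis by simp
qed

lemma integrable_mult_cis:
  fixes F :: "real ^ 'n::finite \<Rightarrow> complex"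
  assumes "integrable lborel F"
  shows "integrable lborel (\<lambda>t. F t * cis (c * (t \<bullet> \<omega>)))"
proof -
  have [measurable]: "F \<in> borel_measurable borel" using assms by auto
  have m: "(\<lambda>t. cis (c * (t \<bullet> \<omega>))) \<in> borel_measurable borel"
    by (intro borel_measurable_continuous_onI continuous_intros)
  show ?thesis
    by (rule Bochner_Integration.integrable_bound[OF assms]) (use m in \<open>auto simp: norm_mult\<close>)
qed

text \<open>Integration by parts: the derivative of \<open>F\<close> times the Fourier kernel is
  integrable and has integral zero.\<close>

lemma fourier_partial:
  fixes F F' :: "real ^ 'n::finite \<Rightarrow> complex"
  assumes d: "has_partial i F F'" and c: "continuous_on UNIV F" "continuous_on UNIV F'"
    and F: "integrable lborel F" and F': "integrable lborel F'"
  shows "fourier F' \<omega> = 2 * pi * \<i> * of_real (\<omega> $ i) * fourier F \<omega>"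
proof -
  let ?e = "\<lambda>t. cis (- 2 * pi * (t \<bullet> \<omega>))"
  let ?c = "\<i> * of_real (- 2 * pi * \<omega> $ i)"
  note I = integrable_mult_cis[OF F, of "- 2 * pi" \<omega>] integrable_mult_cis[OF F', of "- 2 * pi" \<omega>]
  have a: "(\<lambda>t. F t * (?c * ?e t) + F' t * ?e t) = (\<lambda>t. ?c * (F t * ?e t) + F' t * ?e t)"
    by (simp add: fun_eq_iff)
  have J: "integrable lborel (\<lambda>t. F t * (?c * ?e t) + F' t * ?e t)"
    unfolding a by (intro Bochner_Integration.integrable_add integrable_mult_right I)
  have "(LINT t|lborel. F t * (?c * ?e t) + F' t * ?e t) = 0"
    by (rule integral_partial_eq_0[OF has_partial_mult[OF d has_partial_cis] _ I(1) J])
       (intro continuous_intros c)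
  hence "?c * fourier F \<omega> + fourier F' \<omega> = 0"
    unfolding a fourier_def using I by simp
  thus ?thesis by (simp add: algebra_simps eq_neg_iff_add_eq_0)
qed

text \<open>Only continuity and derivatives along the axes are demanded, not Frechet
  differentiability; this is what products, shifts and inverse Fourier transforms deliver
  directly.\<close>

definition psmooth :: "(real ^ 'n::finite \<Rightarrow> complex) \<Rightarrow> bool" where
  "psmooth f \<longleftrightarrow> (\<forall>is. continuous_on UNIV (iter_deriv is f) \<and>
      (\<forall>i. has_partial i (iter_deriv is f) (iter_deriv (i # is) f)))"

lemma psmooth_continuous: "psmooth f \<Longrightarrow> continuous_on A (iter_deriv is f)"
  unfolding psmooth_def by (meson continuous_on_subset subset_UNIV)

lemma psmooth_has_partial: "psmooth f \<Longrightarrow> has_partial i (iter_deriv is f) (iter_deriv (i # is) f)"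
  unfolding psmooth_def by blast

text \<open>A guess \<open>H\<close> for all iterated derivatives at once is verified by one
  differentiation step; every closure property below supplies such a family.\<close>

lemma psmoothI:
  assumes H0: "H [] = f" and c: "\<And>is. continuous_on UNIV (H is)"
    and d: "\<And>i is. has_partial i (H is) (H (i # is))"
  shows "psmooth f" and "iter_deriv is f = H is"
proof -
  have *: "iter_deriv is f = H is" for "is"
    by (induction "is") (auto simp: H0 has_partial_partial_deriv[OF d])
  show "iter_deriv is f = H is" by (rule *)
  show "psmooth f" unfolding psmooth_def * using c d by blast
qed

lemma smooth_psmooth:
  assumes "smooth f" shows "psmooth f"
  unfolding psmooth_def has_partial_def
proof (intro allI conjI)
  fix "is" :: "'a list" and i x
  have d: "iter_deriv is f differentiable (at x)" for x using assms by (auto simp: smooth_def)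
  show "continuous_on UNIV (iter_deriv is f)"
    using d by (meson continuous_at_imp_continuous_on differentiable_imp_continuous_within)
  have "(\<lambda>t. iter_deriv is f (x + t *\<^sub>R axis i 1)) differentiable (at 0)"
  proof (rule differentiable_compose[where f="iter_deriv is f" and g="\<lambda>t. x + t *\<^sub>R axis i 1"])
    show "iter_deriv is f differentiable at (x + 0 *\<^sub>R axis i 1)" using d by blast
    show "(\<lambda>t::real. x + t *\<^sub>R axis i 1) differentiable at 0"
      unfolding differentiable_def by (auto intro!: derivative_eq_intros exI)
  qed
  from vector_derivative_works[THEN iffD1, OF this]
  show "((\<lambda>t. iter_deriv is f (x + t *\<^sub>R axis i 1)) has_vector_derivative iter_deriv (i # is) f x) (at 0)"
    by (simp add: partial_deriv_def)
qed

text \<open>The terms of the Leibniz rule for a list of derivatives, each letter going to one of two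
  factors with the order kept. Repetitions in the list replace binomial coefficients.\<close>

fun splits :: "'a list \<Rightarrow> ('a list \<times> 'a list) list" where
  "splits [] = [([], [])]"
| "splits (i # is) = map (\<lambda>(as, bs). (as, i # bs)) (splits is) @ map (\<lambda>(as, bs). (i # as, bs)) (splits is)"

lemma length_splits: "length (splits is) = 2 ^ length is"
  by (induction "is") auto

lemma splits_length_add: "(as, bs) \<in> set (splits is) \<Longrightarrow> length as + length bs = length is"
  by (induction "is" arbitrary: as bs) auto

lemma sum_list_splits_Cons:
  fixes q :: "'a list \<Rightarrow> 'a list \<Rightarrow> 'b::comm_monoid_add"
  shows
  "(\<Sum>(as, bs)\<leftarrow>splits (i # is). q as bs) = (\<Sum>(as, bs)\<leftarrow>splits is. q as (i # bs) + q (i # as) bs)"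
  by (simp add: comp_def case_prod_unfold sum_list_addf)

lemma continuous_on_sum_list:
  fixes F :: "'a \<Rightarrow> 'b::topological_space \<Rightarrow> 'c::topological_monoid_add"
  shows "(\<And>p. p \<in> set ps \<Longrightarrow> continuous_on A (F p)) \<Longrightarrow> continuous_on A (\<lambda>t. \<Sum>p\<leftarrow>ps. F p t)"
  by (induction ps) (auto intro!: continuous_intros)

lemma
  assumes f: "psmooth f" and g: "psmooth g"
  shows psmooth_mult: "psmooth (\<lambda>t. f t * g t)"
    and iter_deriv_mult: "iter_deriv is (\<lambda>t. f t * g t) =
          (\<lambda>t. \<Sum>(as, bs)\<leftarrow>splits is. iter_deriv as f t * iter_deriv bs g t)"
proof -
  let ?H = "\<lambda>is t. \<Sum>(as, bs)\<leftarrow>splits is. iter_deriv as f t * iter_deriv bs g t"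
  have 1: "?H [] = (\<lambda>t. f t * g t)" by simp
  have 2: "continuous_on UNIV (?H is)" for "is"
    by (rule continuous_on_sum_list) (auto intro!: continuous_intros psmooth_continuous f g)
  have 3: "has_partial i (?H is) (?H (i # is))" for i "is"
  proof -
    have "?H (i # is) = (\<lambda>t. \<Sum>(as, bs)\<leftarrow>splits is. iter_deriv as f t * iter_deriv (i # bs) g t + iter_deriv (i # as) f t * iter_deriv bs g t)"
      by (subst sum_list_splits_Cons) (rule refl)
    moreover have "has_partial i (?H is) \<dots>"
      by (rule has_partial_sum_list) (auto intro!: has_partial_mult psmooth_has_partial f g simp del: iter_deriv.simps)
    ultimately show ?thesis by (simp only:)
  qed
  note R = psmoothI[where H="?H", OF 1 2 3]
  show "psmooth (\<lambda>t. f t * g t)" by (rule R(1))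
  show "iter_deriv is (\<lambda>t. f t * g t) = ?H is" by (rule R(2))
qed

lemma
  assumes f: "psmooth f"
  shows psmooth_cnj: "psmooth (\<lambda>t. cnj (f t))"
    and iter_deriv_cnj: "iter_deriv is (\<lambda>t. cnj (f t)) = (\<lambda>t. cnj (iter_deriv is f t))"
proof -
  let ?H = "\<lambda>is t. cnj (iter_deriv is f t)"
  have 1: "?H [] = (\<lambda>t. cnj (f t))" by simp
  have 2: "continuous_on UNIV (?H is)" for "is"
    by (auto intro!: continuous_intros psmooth_continuous f)
  have 3: "has_partial i (?H is) (?H (i # is))" for i "is"
    by (intro has_partial_cnj psmooth_has_partial f)
  note R = psmoothI[where H="?H", OF 1 2 3]
  show "psmooth (\<lambda>t. cnj (f t))" by (rule R(1))
  show "iter_deriv is (\<lambda>t. cnj (f t)) = ?H is" by (rule R(2))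
qed

lemma
  assumes f: "psmooth f"
  shows psmooth_shift: "psmooth (\<lambda>t. f (t - x))"
    and iter_deriv_shift: "iter_deriv is (\<lambda>t. f (t - x)) = (\<lambda>t. iter_deriv is f (t - x))"
proof -
  let ?H = "\<lambda>is t. iter_deriv is f (t - x)"
  have 1: "?H [] = (\<lambda>t. f (t - x))" by simp
  have 2: "continuous_on UNIV (?H is)" for "is"
    by (rule continuous_on_compose2[OF psmooth_continuous[OF f, of UNIV]]) (auto intro!: continuous_intros)
  have 3: "has_partial i (?H is) (?H (i # is))" for i "is"
    by (intro has_partial_shift psmooth_has_partial f)
  note R = psmoothI[where H="?H", OF 1 2 3]
  show "psmooth (\<lambda>t. f (t - x))" by (rule R(1))
  show "iter_deriv is (\<lambda>t. f (t - x)) = ?H is" by (rule R(2))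
qed

text \<open>Separated variables: each letter differentiates its own factor, so the result depends on
  the counts alone. This is the source of order independence for Gaussians.\<close>

lemma iter_deriv_prod:
  fixes Q :: "'n::finite \<Rightarrow> nat \<Rightarrow> real \<Rightarrow> complex"
  assumes Q: "\<And>i k r. (Q i k has_vector_derivative Q i (Suc k) r) (at r)"
  shows "psmooth (\<lambda>t. \<Prod>i\<in>UNIV. Q i 0 (t $ i))"
    and "iter_deriv is (\<lambda>t. \<Prod>i\<in>UNIV. Q i 0 (t $ i)) = (\<lambda>t. \<Prod>i\<in>UNIV. Q i (count_list is i) (t $ i))"
proof -
  let ?H = "\<lambda>is t. \<Prod>i\<in>UNIV. Q i (count_list is i) (t $ i)"
  have 1: "?H [] = (\<lambda>t. \<Prod>i\<in>UNIV. Q i 0 (t $ i))" by simp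
  have cQ: "continuous_on UNIV (Q i k)" for i k
    using Q by (meson continuous_at_imp_continuous_on has_vector_derivative_continuous)
  have 2: "continuous_on UNIV (?H is)" for "is"
    by (intro continuous_on_prod continuous_on_compose2[OF cQ]) (auto intro!: continuous_intros)
  have 3: "has_partial j (?H is) (?H (j # is))" for j "is"
    unfolding has_partial_def
  proof
    fix x :: "real^'n"
    let ?R = "\<Prod>i\<in>UNIV - {j}. Q i (count_list is i) (x $ i)"
    have a: "?H is (x + t *\<^sub>R axis j 1) = Q j (count_list is j) (x $ j + t) * ?R" for t
      by (subst prod.remove[of _ j]) (auto simp: axis_def intro!: prod.cong)
    have b: "?H (j # is) x = Q j (Suc (count_list is j)) (x $ j) * ?R"
      by (subst prod.remove[of _ j]) (auto intro!: prod.cong)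
    have "((\<lambda>t. x $ j + t) has_vector_derivative 1) (at 0)" by (auto intro!: derivative_eq_intros)
    from vector_diff_chain_at[OF this, of "Q j (count_list is j)"] Q
    have "((\<lambda>t. Q j (count_list is j) (x $ j + t)) has_vector_derivative Q j (Suc (count_list is j)) (x $ j)) (at 0)"
      by (simp add: o_def)
    from has_vector_derivative_mult_left[OF this]
    show "((\<lambda>t. ?H is (x + t *\<^sub>R axis j 1)) has_vector_derivative ?H (j # is) x) (at 0)"
      unfolding a b .
  qed
  note R = psmoothI[where H="?H", OF 1 2 3]
  show "psmooth (\<lambda>t. \<Prod>i\<in>UNIV. Q i 0 (t $ i))" by (rule R(1))
  show "iter_deriv is (\<lambda>t. \<Prod>i\<in>UNIV. Q i 0 (t $ i)) = ?H is" by (rule R(2))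
qed

section \<open>Gaussians as test functions\<close>

definition dgauss :: "'n \<Rightarrow> real \<Rightarrow> real ^ 'n::finite \<Rightarrow> real ^ 'n \<Rightarrow> real ^ 'n \<Rightarrow> complex" where
  "dgauss i s y \<eta> t = (of_real (- 2 * pi * (t $ i - y $ i) / s\<^sup>2) - 2 * pi * \<i> * of_real (\<eta> $ i)) * gauss s y \<eta> t"

definition gauss_log_deriv :: "real \<Rightarrow> real \<Rightarrow> real \<Rightarrow> complex poly" where
  "gauss_log_deriv s y \<eta> = [:of_real (2 * pi * y / s\<^sup>2) - 2 * pi * \<i> * of_real \<eta>, of_real (- 2 * pi / s\<^sup>2):]"

text \<open>Hermite-type polynomials: the k-th derivative of \<open>gauss1\<close> is this
  polynomial times \<open>gauss1\<close>, since (q G)' = (q' + L q) G where L is the logarithmic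
  derivative of G.\<close>

definition gauss_poly :: "real \<Rightarrow> real \<Rightarrow> real \<Rightarrow> nat \<Rightarrow> complex poly" where
  "gauss_poly s y \<eta> k = ((\<lambda>q. pderiv q + gauss_log_deriv s y \<eta> * q) ^^ k) 1"

lemma gauss1_deriv:
  "((\<lambda>r. poly (gauss_poly s y \<eta> k) (of_real r) * gauss1 s y \<eta> r) has_vector_derivative
     poly (gauss_poly s y \<eta> (Suc k)) (of_real r) * gauss1 s y \<eta> r) (at r)"
proof -
  define a where "a = complex_of_real (pi / s\<^sup>2)"
  \<comment> \<open>The Gaussian is continued to an entire function, so that complex differentiation
    rules apply before restricting to the real line.\<close>
  define P where "P = (\<lambda>z::complex. exp (- a * (z - y)\<^sup>2 - 2 * pi * \<i> * \<eta> * z))"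
  have P: "P (of_real r) = gauss1 s y \<eta> r" for r
  proof -
    have "complex_of_real (exp (- pi * (r - y)\<^sup>2 / s\<^sup>2)) = exp (of_real (- pi * (r - y)\<^sup>2 / s\<^sup>2))"
      by (rule exp_of_real[symmetric])
    thus ?thesis unfolding P_def gauss1_def cis_conv_exp a_def
      by (simp only: mult_exp_exp) (rule arg_cong[where f=exp], simp add: algebra_simps)
  qed
  have "(P has_field_derivative poly (gauss_log_deriv s y \<eta>) z * P z) (at z)" for z
  proof -
    have L: "poly (gauss_log_deriv s y \<eta>) z = - 2 * a * (z - y) - 2 * pi * \<i> * \<eta>"
      unfolding gauss_log_deriv_def a_def by (simp add: algebra_simps add_divide_distrib diff_divide_distrib)
    show ?thesis unfolding L P_def by (auto intro!: derivative_eq_intros simp: algebra_simps)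
  qed
  hence "((\<lambda>z. poly (gauss_poly s y \<eta> k) z * P z) has_field_derivative poly (gauss_poly s y \<eta> (Suc k)) (of_real r) * P (of_real r)) (at (of_real r))"
    by (auto intro!: derivative_eq_intros simp: gauss_poly_def algebra_simps)
  from has_vector_derivative_real_field[OF this] show ?thesis by (simp add: P)
qed

lemma
  fixes y \<eta> :: "real ^ 'n::finite"
  shows psmooth_gauss: "psmooth (gauss s y \<eta>)"
    and iter_deriv_gauss: "iter_deriv is (gauss s y \<eta>) = (\<lambda>t. \<Prod>i\<in>UNIV.
      poly (gauss_poly s (y $ i) (\<eta> $ i) (count_list is i)) (of_real (t $ i)) * gauss1 s (y $ i) (\<eta> $ i) (t $ i))"
proof -
  note P = iter_deriv_prod[where Q="\<lambda>i k r. poly (gauss_poly s (y $ i) (\<eta> $ i) k) (of_real r) * gauss1 s (y $ i) (\<eta> $ i) r", OF gauss1_deriv]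
  have z: "gauss s y \<eta> = (\<lambda>t. \<Prod>i\<in>UNIV. poly (gauss_poly s (y $ i) (\<eta> $ i) 0) (of_real (t $ i)) * gauss1 s (y $ i) (\<eta> $ i) (t $ i))"
    by (auto simp: gauss_prod gauss_poly_def)
  show "psmooth (gauss s y \<eta>)" unfolding z by (rule P(1))
  show "iter_deriv is (gauss s y \<eta>) = (\<lambda>t. \<Prod>i\<in>UNIV.
      poly (gauss_poly s (y $ i) (\<eta> $ i) (count_list is i)) (of_real (t $ i)) * gauss1 s (y $ i) (\<eta> $ i) (t $ i))"
    unfolding z by (rule P(2))
qed

text \<open>Allows the unknown order inside \<open>mi_deriv\<close> to be replaced by a convenient
  one when a weak derivative is tested on a Gaussian.\<close>

lemma iter_deriv_gauss_cong:
  "(\<And>i. count_list is i = count_list js i) \<Longrightarrow> iter_deriv is (gauss s y \<eta>) = iter_deriv js (gauss s y \<eta>)"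
  unfolding iter_deriv_gauss by simp

lemma partial_deriv_gauss: "partial_deriv i (gauss s y \<eta>) = dgauss i s y \<eta>"
proof
  fix t
  have "partial_deriv i (gauss s y \<eta>) t = iter_deriv [i] (gauss s y \<eta>) t" by simp
  also have "\<dots> = (\<Prod>j\<in>UNIV. (if i = j then poly (gauss_log_deriv s (y $ i) (\<eta> $ i)) (of_real (t $ i)) else 1)
        * gauss1 s (y $ j) (\<eta> $ j) (t $ j))"
    unfolding iter_deriv_gauss by (intro prod.cong refl) (auto simp: gauss_poly_def)
  also have "\<dots> = poly (gauss_log_deriv s (y $ i) (\<eta> $ i)) (of_real (t $ i)) * gauss s y \<eta> t"
    by (simp add: prod.distrib gauss_prod)
  also have "\<dots> = dgauss i s y \<eta> t"
    by (simp add: dgauss_def gauss_log_deriv_def algebra_simps diff_divide_distrib)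
  finally show "partial_deriv i (gauss s y \<eta>) t = dgauss i s y \<eta> t" .
qed

lemma has_partial_gauss: "has_partial i (gauss s y \<eta>) (dgauss i s y \<eta>)"
  using psmooth_has_partial[OF psmooth_gauss[of s y \<eta>], of i "[]"] by (simp add: partial_deriv_gauss)

lemma continuous_dgauss: "continuous_on A (dgauss i s y \<eta>)"
  using psmooth_continuous[OF psmooth_gauss[of s y \<eta>], of A "[i]"] by (simp add: partial_deriv_gauss)

lemma le_exp: "x \<le> exp (x::real)"
  using exp_ge_add_one_self[of x] by linarith

text \<open>With u = |x - y|, completing the square bounds h u - a u^2 by its maximum h^2 / (4
  a).\<close>

lemma exp_linear_gauss_le:
  fixes x y :: "'a::real_normed_vector"
  assumes a: "a > 0" and h: "h \<ge> 0"
  shows "exp (h * norm x) * exp (- a * (norm (x - y))\<^sup>2) \<le> exp (h * norm y + h\<^sup>2 / (4 * a))"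
proof -
  let ?u = "norm (x - y)"
  have "norm x \<le> norm y + ?u" by (metis add.commute norm_triangle_sub)
  hence 1: "h * norm x \<le> h * norm y + h * ?u" using h by (metis mult_left_mono distrib_left)
  have "0 \<le> a * (?u - h / (2 * a))\<^sup>2" using a by simp
  also have "\<dots> = a * ?u\<^sup>2 - h * ?u + h\<^sup>2 / (4 * a)"
    using a by (simp add: power2_diff power_divide field_simps power2_eq_square)
  finally show ?thesis using 1 by (simp flip: exp_add)
qed

lemma integrable_exp_gauss_bound:
  fixes \<phi> :: "real ^ 'n::finite \<Rightarrow> complex"
  assumes m: "\<phi> \<in> borel_measurable lborel" and a: "a > 0"
    and b: "\<And>x. norm (\<phi> x) \<le> K * exp (norm x) * exp (- a * (norm (x - y))\<^sup>2)"
  shows "integrable lborel \<phi>"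
proof -
  \<comment> \<open>The exponent a is halved: one half absorbs exp |x|, the other is an integrable
    Gaussian, whose width \<open>s\<close> satisfies pi / s^2 = a / 2.\<close>
  define s where "s = sqrt (2 * pi / a)"
  have s: "s > 0" and s2: "pi / s\<^sup>2 = a / 2" using a by (auto simp: s_def)
  define C where "C = \<bar>K\<bar> * exp (1 * norm y + 1\<^sup>2 / (4 * (a / 2)))"
  show ?thesis
  proof (rule Bochner_Integration.integrable_bound[OF _ m AE_I2])
    show "integrable lborel (\<lambda>x. C * norm (gauss s y 0 x))"
      using gauss_integral(1)[OF s] by auto
    fix x
    have "norm (\<phi> x) \<le> \<bar>K\<bar> * exp (norm x) * exp (- a * (norm (x - y))\<^sup>2)"
      by (rule order_trans[OF b]) (intro mult_right_mono; simp)
    also have "\<dots> = \<bar>K\<bar> * (exp (1 * norm x) * exp (- (a / 2) * (norm (x - y))\<^sup>2)) * exp (- (a / 2) * (norm (x - y))\<^sup>2)"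
      by (simp flip: exp_add add: mult.assoc)
    also have "\<dots> \<le> C * exp (- (a / 2) * (norm (x - y))\<^sup>2)"
      unfolding C_def by (intro mult_right_mono mult_left_mono exp_linear_gauss_le) (use a in auto)
    also have "\<dots> = C * norm (gauss s y 0 x)"
      unfolding norm_gauss s2[symmetric] by simp
    finally show "norm (\<phi> x) \<le> norm (C * norm (gauss s y 0 x))" by (simp add: C_def)
  qed
qed

lemma bdd_above_exp_gauss:
  fixes \<phi> :: "real ^ 'n::finite \<Rightarrow> complex"
  assumes a: "a > 0" and h: "h > 0"
    and b: "\<And>x. norm (\<phi> x) \<le> K * exp (norm x) * exp (- a * (norm (x - y))\<^sup>2)"
  shows "bdd_above (range (\<lambda>x. norm (\<phi> x) * exp (h * norm x)))"
proof (rule bdd_aboveI2)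
  fix x
  have "norm (\<phi> x) * exp (h * norm x) \<le> K * exp (norm x) * exp (- a * (norm (x - y))\<^sup>2) * exp (h * norm x)"
    using b by (intro mult_right_mono) auto
  also have "\<dots> = K * (exp ((h + 1) * norm x) * exp (- a * (norm (x - y))\<^sup>2))"
    by (simp flip: exp_add add: algebra_simps)
  also have "\<dots> \<le> \<bar>K\<bar> * (exp ((h + 1) * norm x) * exp (- a * (norm (x - y))\<^sup>2))"
    by (intro mult_right_mono) auto
  also have "\<dots> \<le> \<bar>K\<bar> * exp ((h + 1) * norm y + (h + 1)\<^sup>2 / (4 * a))"
    by (intro mult_left_mono exp_linear_gauss_le) (use a h in auto)
  finally show "norm (\<phi> x) * exp (h * norm x) \<le> \<bar>K\<bar> * exp ((h + 1) * norm y + (h + 1)\<^sup>2 / (4 * a))" .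
qed

text \<open>The factors exp |x| leave room for the polynomial factors that differentiation produces
  in \<open>dgauss\<close> and in its Fourier transform.\<close>

lemma S1I:
  fixes \<phi> :: "real ^ 'n::finite \<Rightarrow> complex"
  assumes "continuous_on UNIV \<phi>" "a > 0" "b > 0"
    and "\<And>x. norm (\<phi> x) \<le> K * exp (norm x) * exp (- a * (norm (x - y))\<^sup>2)"
    and "\<And>x. norm (fourier \<phi> x) \<le> L * exp (norm x) * exp (- b * (norm (x - z))\<^sup>2)"
  shows "\<phi> \<in> S1"
  unfolding S1_def using assms(1) bdd_above_exp_gauss[OF assms(2) _ assms(4)] bdd_above_exp_gauss[OF assms(3) _ assms(5)]
  by simp

lemma norm_gauss': "norm (gauss s y \<eta> t) = exp (- (pi / s\<^sup>2) * (norm (t - y))\<^sup>2)"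
  by (simp add: norm_gauss)

lemma norm_dgauss_le:
  "norm (dgauss i s y \<eta> t) \<le> (2 * pi / s\<^sup>2 * (1 + norm y) + 2 * pi * norm \<eta>) * exp (norm t) * exp (- (pi / s\<^sup>2) * (norm (t - y))\<^sup>2)"
proof -
  have "norm (complex_of_real (- 2 * pi * (t $ i - y $ i) / s\<^sup>2) - 2 * pi * \<i> * of_real (\<eta> $ i)) \<le> 2 * pi / s\<^sup>2 * \<bar>t $ i - y $ i\<bar> + 2 * pi * \<bar>\<eta> $ i\<bar>"
    by (rule order_trans[OF norm_triangle_ineq4]) (simp add: norm_mult norm_divide norm_power abs_mult del: of_real_diff of_real_mult of_real_divide)
  also have "\<dots> \<le> 2 * pi / s\<^sup>2 * ((1 + norm y) * exp (norm t)) + 2 * pi * (norm \<eta> * exp (norm t))"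
  proof (intro add_mono mult_left_mono)
    have "\<bar>t $ i - y $ i\<bar> \<le> norm (t - y)" using component_le_norm_cart[of "t - y" i] by simp
    also have "\<dots> \<le> norm t + norm y * 1" using norm_triangle_ineq4[of t y] by simp
    also have "\<dots> \<le> exp (norm t) + norm y * exp (norm t)"
      by (intro add_mono mult_left_mono le_exp) auto
    finally show "\<bar>t $ i - y $ i\<bar> \<le> (1 + norm y) * exp (norm t)" by (simp add: algebra_simps)
    have "\<bar>\<eta> $ i\<bar> \<le> norm \<eta> * 1" using component_le_norm_cart[of \<eta> i] by simp
    also have "\<dots> \<le> norm \<eta> * exp (norm t)" by (intro mult_left_mono) auto
    finally show "\<bar>\<eta> $ i\<bar> \<le> norm \<eta> * exp (norm t)" .
  qed auto
  also have "\<dots> = (2 * pi / s\<^sup>2 * (1 + norm y) + 2 * pi * norm \<eta>) * exp (norm t)"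
    by (simp add: algebra_simps)
  finally show ?thesis unfolding dgauss_def norm_mult norm_gauss'
    by (intro mult_right_mono) auto
qed

lemma norm_fourier_gauss:
  fixes y \<eta> \<omega> :: "real ^ 'n::finite"
  assumes s: "s > 0"
  shows "norm (fourier (gauss s y \<eta>) \<omega>) = s ^ CARD('n) * exp (- (pi * s\<^sup>2) * (norm (\<omega> - (- \<eta>)))\<^sup>2)"
  unfolding fourier_gauss[OF s] using s by (simp add: norm_mult norm_power add.commute)

lemma gauss_S1:
  assumes s: "s > 0" shows "gauss s y \<eta> \<in> S1"
proof (rule S1I)
  show "continuous_on UNIV (gauss s y \<eta>)" by (rule continuous_gauss)
  show "pi / s\<^sup>2 > 0" "pi * s\<^sup>2 > 0" using s by auto
  fix x :: "real^'a"
  have 1: "1 * 1 \<le> 1 * exp (norm x)" by simp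
  show "norm (gauss s y \<eta> x) \<le> 1 * exp (norm x) * exp (- (pi / s\<^sup>2) * (norm (x - y))\<^sup>2)"
    unfolding norm_gauss' using mult_right_mono[OF 1, of "exp (- (pi / s\<^sup>2) * (norm (x - y))\<^sup>2)"] by simp
  show "norm (fourier (gauss s y \<eta>) x) \<le> s ^ CARD('a) * exp (norm x) * exp (- (pi * s\<^sup>2) * (norm (x - (- \<eta>)))\<^sup>2)"
    unfolding norm_fourier_gauss[OF s] using s by (intro mult_right_mono) auto
qed

lemma dgauss_integrable:
  assumes s: "s > 0" shows "integrable lborel (dgauss i s y \<eta>)"
  using s by (intro integrable_exp_gauss_bound[OF _ _ norm_dgauss_le[of i s y \<eta>]])
    (auto intro!: borel_measurable_continuous_onI continuous_dgauss)

text \<open>Weak derivatives are peeled off one letter at a time, so the derivative of a Gaussian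
  must itself be a test function. Its Fourier transform is a coordinate multiple of that of the
  Gaussian.\<close>

lemma dgauss_S1:
  fixes y \<eta> :: "real ^ 'n::finite"
  assumes s: "s > 0" shows "dgauss i s y \<eta> \<in> S1"
proof (rule S1I[OF continuous_dgauss _ _ norm_dgauss_le])
  show "pi / s\<^sup>2 > 0" "pi * s\<^sup>2 > 0" using s by auto
  fix x :: "real^'n"
  have "norm (fourier (dgauss i s y \<eta>) x) = 2 * pi * \<bar>x $ i\<bar> * (s ^ CARD('n) * exp (- (pi * s\<^sup>2) * (norm (x - (- \<eta>)))\<^sup>2))"
    unfolding fourier_partial[OF has_partial_gauss continuous_gauss continuous_dgauss gauss_integral(1)[OF s] dgauss_integrable[OF s]]
    by (simp only: norm_mult norm_fourier_gauss[OF s]) simp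
  also have "\<dots> \<le> 2 * pi * exp (norm x) * (s ^ CARD('n) * exp (- (pi * s\<^sup>2) * (norm (x - (- \<eta>)))\<^sup>2))"
    using s by (intro mult_right_mono mult_left_mono order_trans[OF component_le_norm_cart le_exp]) auto
  finally show "norm (fourier (dgauss i s y \<eta>) x) \<le> (2 * pi * s ^ CARD('n)) * exp (norm x) * exp (- (pi * s\<^sup>2) * (norm (x - (- \<eta>)))\<^sup>2)"
    by (simp add: mult_ac)
qed

section \<open>Fourier inversion\<close>

text \<open>Continuous tests approximate indicators of open sets; a Dynkin argument extends the
  vanishing of the integral to all Borel sets, and densities are unique.\<close>

lemma integral_test_continuous_eq_0:
  fixes H :: "'a::euclidean_space \<Rightarrow> real"
  assumes H: "integrable lborel H"
    and test: "\<And>h. continuous_on UNIV h \<Longrightarrow> (\<And>x. 0 \<le> h x \<and> h x \<le> 1) \<Longrightarrow> (LINT x|lborel. H x * h x) = 0"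
  shows "AE x in lborel. H x = 0"
proof (rule density_unique_real[OF H])
  show "integrable lborel (\<lambda>x. 0 :: real)" by simp
  have [measurable]: "H \<in> borel_measurable borel" using H by auto
  have SI: "set_integrable lborel A H" if "A \<in> sets lborel" for A
    using integrable_mult_indicator[OF that H] by (simp add: set_integrable_def)
  have tot: "(LINT x|lborel. H x) = 0" using test[of "\<lambda>_. 1"] by simp
  have opn: "(LINT x:U|lborel. H x) = 0" if U: "open U" for U
  proof (cases "U = UNIV")
    case True thus ?thesis using tot by (simp add: set_lebesgue_integral_def)
  next
    case False
    \<comment> \<open>A continuous approximation of the indicator of \<open>U\<close> from below.
      The case U = UNIV is separate because \<open>infdist\<close> to the empty set is 0, which
      would make every \<open>h k\<close> vanish.\<close>
    define h where "h k x = min 1 (real k * infdist x (- U))" for k x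
    have hc: "continuous_on UNIV (h k)" for k
      unfolding h_def by (intro continuous_intros continuous_on_min continuous_on_infdist)
    have hb: "0 \<le> h k x \<and> h k x \<le> 1" for k x
      unfolding h_def by (simp add: infdist_nonneg)
    have lim: "(\<lambda>k. H x * h k x) \<longlonglongrightarrow> indicator U x *\<^sub>R H x" for x
    proof (cases "x \<in> U")
      case False
      hence "h k x = 0" for k by (simp add: h_def infdist_zero)
      thus ?thesis using False by simp
    next
      case True
      have pos: "infdist x (- U) > 0"
        using infdist_pos_not_in_closed[of "- U" x] True \<open>U \<noteq> UNIV\<close> U by (auto simp: closed_Compl)
      obtain N where N: "1 / infdist x (- U) < real N" using reals_Archimedean2 by blast
      have "eventually (\<lambda>k. H x * h k x = H x) sequentially"
        using eventually_ge_at_top[of N]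
      proof eventually_elim
        case (elim k)
        have "1 / infdist x (- U) < real k" using N elim by linarith
        hence "1 < real k * infdist x (- U)" using pos by (simp add: field_simps)
        thus ?case by (simp add: h_def)
      qed
      thus ?thesis using True by (simp add: tendsto_eventually)
    qed
    have m: "(\<lambda>x. indicator U x *\<^sub>R H x) \<in> borel_measurable lborel"
      "(\<lambda>x. H x * h k x) \<in> borel_measurable lborel" for k
    proof -
      have "h k \<in> borel_measurable borel" for k by (rule borel_measurable_continuous_onI[OF hc])
      moreover have "U \<in> sets borel" using U by simp
      ultimately show "(\<lambda>x. indicator U x *\<^sub>R H x) \<in> borel_measurable lborel"
        "(\<lambda>x. H x * h k x) \<in> borel_measurable lborel" for k
        using H by simp_all
    qed
    have "(\<lambda>k. LINT x|lborel. H x * h k x) \<longlonglongrightarrow> (LINT x|lborel. indicator U x *\<^sub>R H x)"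
    proof (rule integral_dominated_convergence[where w="\<lambda>x. \<bar>H x\<bar>"])
      show "integrable lborel (\<lambda>x. \<bar>H x\<bar>)" using H by simp
      show "AE x in lborel. (\<lambda>k. H x * h k x) \<longlonglongrightarrow> indicator U x *\<^sub>R H x" using lim by blast
      show "AE x in lborel. norm (H x * h k x) \<le> \<bar>H x\<bar>" for k
        using hb by (auto simp: abs_mult mult_left_le)
    qed (use m in auto)
    moreover have "(LINT x|lborel. H x * h k x) = 0" for k by (rule test[OF hc hb])
    ultimately show ?thesis by (simp add: set_lebesgue_integral_def LIMSEQ_const_iff)
  qed
  \<comment> \<open>The open sets form an intersection-stable generator, so induction over
    complements and disjoint unions reaches every Borel set.\<close>
  fix A :: "'a set" assume "A \<in> sets lborel"
  hence "A \<in> sigma_sets UNIV {S. open S}" by (simp add: borel_def)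
  have ist: "Int_stable {S :: 'a set. open S}" by (auto simp: Int_stable_def)
  have B: "sigma_sets UNIV {S :: 'a set. open S} = sets borel" by (simp add: borel_def)
  have "{S :: 'a set. open S} \<subseteq> Pow UNIV" by simp
  from ist this \<open>A \<in> sigma_sets UNIV {S. open S}\<close> have "(LINT x:A|lborel. H x) = 0"
  proof (induction rule: sigma_sets_induct_disjoint)
    case (basic U) thus ?case using opn by simp
  next
    case (compl A)
    hence A: "A \<in> sets borel" using B by simp
    have "(LINT x:UNIV - A|lborel. H x) = (LINT x|lborel. H x - indicator A x *\<^sub>R H x)"
      unfolding set_lebesgue_integral_def
      by (intro Bochner_Integration.integral_cong) (auto simp: indicator_def)
    also have "\<dots> = 0"
      using compl.IH H SI[of A] A tot by (subst Bochner_Integration.integral_diff) (auto simp: set_lebesgue_integral_def set_integrable_def)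
    finally show ?case .
  next
    case (union A)
    hence A: "A i \<in> sets lborel" for i using B by auto
    have "(LINT x:(\<Union>i. A i)|lborel. H x) = (\<Sum>i. (LINT x:(A i)|lborel. H x))"
      by (rule lebesgue_integral_countable_add) (use A union SI in \<open>auto simp: disjoint_family_on_def\<close>)
    thus ?case using union by simp
  qed (auto simp: set_lebesgue_integral_def)
  thus "(LINT x:A|lborel. H x) = (LINT x:A|lborel. 0)" by simp
qed

lemma integrable_pair_bound:
  fixes F :: "'a::euclidean_space \<times> 'b::euclidean_space \<Rightarrow> complex"
  assumes F: "F \<in> borel_measurable (lborel \<Otimes>\<^sub>M lborel)"
    and a: "integrable lborel a" and b: "integrable lborel b"
    and bd: "\<And>x y. norm (F (x, y)) \<le> norm (a x :: complex) * norm (b y :: complex)"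
  shows "integrable (lborel \<Otimes>\<^sub>M lborel) F"
proof (rule Bochner_Integration.integrable_bound[OF _ F AE_I2])
  have [measurable]: "a \<in> borel_measurable borel" "b \<in> borel_measurable borel" using a b by auto
  show "integrable (lborel \<Otimes>\<^sub>M lborel) (\<lambda>(x, y). a x * b y)"
  proof (rule lborel_pair.Fubini_integrable)
    show "integrable lborel (\<lambda>x. LINT y|lborel. norm (case (x, y) of (x, y) \<Rightarrow> a x * b y))"
      using a by (simp add: norm_mult)
    show "AE x in lborel. integrable lborel (\<lambda>y. case (x, y) of (x, y) \<Rightarrow> a x * b y)"
      using b by simp
  qed measurable
qed (use bd in \<open>auto simp: norm_mult\<close>)

lemma gauss_commute: "gauss s y 0 t = gauss s t 0 y"
  by (simp add: gauss_def norm_minus_commute)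

lemma gauss_scale:
  "s > 0 \<Longrightarrow> gauss s t 0 (t + (- s) *\<^sub>R z) = gauss 1 0 0 z"
  by (simp add: gauss_def power_mult_distrib)

lemma measurable_gauss_pair [measurable]:
  "(\<lambda>p. gauss s (f p) (h p) (g p)) \<in> borel_measurable M"
  if "f \<in> borel_measurable M" "g \<in> borel_measurable M" "h \<in> borel_measurable M"
proof -
  have [measurable]: "(\<lambda>x. cis (u x)) \<in> borel_measurable M" if "u \<in> borel_measurable M" for u
    using that by (auto simp: cis_conv_exp intro!: borel_measurable_continuous_on[where f=exp] continuous_intros)
  show ?thesis using that unfolding gauss_def by measurable
qed

text \<open>Gaussians of shrinking width form an approximate identity: averages of \<open>h\<close>
  against them are superpositions of the allowed tests and converge pointwise to
  \<open>h\<close>.\<close>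

lemma test_gauss_imp_test_continuous:
  fixes H :: "real ^ 'n::finite \<Rightarrow> complex"
  assumes H: "integrable lborel H"
    and test: "\<And>s y. s > 0 \<Longrightarrow> (LINT t|lborel. H t * gauss s y 0 t) = 0"
    and h: "continuous_on UNIV h" and hb: "\<And>x. norm (h x :: complex) \<le> 1"
  shows "(LINT t|lborel. H t * h t) = 0"
proof -
  have [measurable]: "H \<in> borel_measurable borel" "h \<in> borel_measurable borel"
    using H h by (auto intro!: borel_measurable_continuous_onI)
  let ?g = "gauss 1 (0 :: real^'n) 0"
  have gi: "integrable lborel ?g" by (rule gauss_integral(1)) simp
  have [measurable]: "?g \<in> borel_measurable borel" using gi by auto
  \<comment> \<open>Written in the rescaled variable z = (t - y) / s, the integrand has the majorant
    |H(t)| |g(z)| with g the unit Gaussian, which does not depend on \<open>s\<close>.\<close>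
  let ?J = "\<lambda>s p. H (fst p) * h (fst p + (- s) *\<^sub>R snd p) * ?g (snd p)"
  have Jm: "?J s \<in> borel_measurable (lborel \<Otimes>\<^sub>M lborel)" for s by measurable
  have J: "integrable (lborel \<Otimes>\<^sub>M lborel) (?J s)" for s
    by (rule integrable_pair_bound[OF Jm H gi])
       (auto simp: norm_mult intro!: mult_right_mono mult_left_le hb)
  have J0: "integral\<^sup>L (lborel \<Otimes>\<^sub>M lborel) (?J s) = 0" if s: "s > 0" for s
  proof -
    \<comment> \<open>The same integrand in the original variable y. Exchanging the integrations
      makes the inner integral over t an instance of \<open>test\<close>.\<close>
    define F where "F t y = H t * h y * gauss s y 0 t" for t y
    have hg: "integrable lborel (\<lambda>y. h y * gauss s t 0 y)" for t
      by (rule Bochner_Integration.integrable_bound[OF gauss_integral(1)[OF s, of t 0]])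
         (auto simp: norm_mult intro!: mult_left_le_one_le hb)
    have "integral\<^sup>L (lborel \<Otimes>\<^sub>M lborel) (?J s) = (LINT t|lborel. LINT z|lborel. ?J s (t, z))"
      by (rule lborel_pair.integral_fst'[OF J, symmetric])
    also have "\<dots> = (LINT t|lborel. LINT y|lborel. F t y / of_real (s ^ CARD('n)))"
    proof (rule Bochner_Integration.integral_cong[OF refl])
      fix t
      have "(LINT y|lborel. h y * gauss s t 0 y) = of_real (s ^ CARD('n)) * (LINT z|lborel. h (t + (- s) *\<^sub>R z) * ?g z)"
        using lborel_integral_affine(2)[OF _ hg, of "- s" t t] s gauss_scale[OF s, of t]
        by (simp add: scaleR_conv_of_real)
      hence "(LINT z|lborel. h (t + (- s) *\<^sub>R z) * ?g z) = (LINT y|lborel. h y * gauss s t 0 y) / of_real (s ^ CARD('n))"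
        using s by (simp add: field_simps)
      thus "(LINT z|lborel. ?J s (t, z)) = (LINT y|lborel. F t y / of_real (s ^ CARD('n)))"
        by (simp add: F_def mult.assoc gauss_commute[of s _ t])
    qed
    also have "\<dots> = (LINT t|lborel. LINT y|lborel. F t y) / of_real (s ^ CARD('n))" by simp
    also have "(LINT t|lborel. LINT y|lborel. F t y) = (LINT y|lborel. LINT t|lborel. F t y)"
    proof (rule lborel_pair.Fubini_integral[symmetric], rule lborel_pair.Fubini_integrable)
      show Fm: "case_prod F \<in> borel_measurable (lborel \<Otimes>\<^sub>M lborel)" unfolding F_def by measurable
      have b: "norm (h y * gauss s t 0 y) \<le> norm (gauss s t 0 y)" for t y
        using hb[of y] by (simp add: norm_mult mult_left_le_one_le)
      have Fi: "integrable lborel (F t)" for t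
        unfolding F_def mult.assoc gauss_commute[of s _ t] by (intro integrable_mult_right hg)
      thus "AE t in lborel. integrable lborel (\<lambda>y. case_prod F (t, y))" by simp
      have gt: "(LINT y|lborel. norm (gauss s t 0 y)) = (LINT y|lborel. norm (gauss s 0 0 (y::real^'n)))" for t :: "real^'n"
      proof -
        have "integrable lborel (\<lambda>y. norm (gauss s 0 0 (y::real^'n)))"
          by (intro integrable_norm gauss_integral(1) s)
        from lborel_shift(2)[OF this, of "- t"] show ?thesis by (simp add: norm_gauss)
      qed
      show "integrable lborel (\<lambda>t. LINT y|lborel. norm (case_prod F (t, y)))"
      proof (rule Bochner_Integration.integrable_bound[OF _ _ AE_I2])
        show "integrable lborel (\<lambda>t. norm (H t) * (LINT y|lborel. norm (gauss s 0 0 (y::real^'n))))"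
          using H by simp
        show "(\<lambda>t. LINT y|lborel. norm (case_prod F (t, y))) \<in> borel_measurable lborel"
          by (rule lborel.borel_measurable_lebesgue_integral) (use measurable_compose[OF Fm borel_measurable_norm] in \<open>simp add: case_prod_unfold\<close>)
        fix t
        have Fn: "norm (F t y) = norm (H t) * norm (h y * gauss s t 0 y)" for y
          unfolding F_def gauss_commute[of s y t] norm_mult by (rule mult.assoc)
        have "(LINT y|lborel. norm (F t y)) = norm (H t) * (LINT y|lborel. norm (h y * gauss s t 0 y))"
          by (simp only: Fn integral_mult_right_zero)
        also have "\<dots> \<le> norm (H t) * (LINT y|lborel. norm (gauss s t 0 y))"
          by (intro mult_left_mono[OF Bochner_Integration.integral_mono[OF integrable_norm[OF hg]
                integrable_norm[OF gauss_integral(1)[OF s]] b]] norm_ge_zero)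
        finally have "(LINT y|lborel. norm (F t y)) \<le> norm (H t) * (LINT y|lborel. norm (gauss s 0 0 (y::real^'n)))"
          unfolding gt[of t] .
        moreover have "0 \<le> (LINT y|lborel. norm (F t y))" by (rule Bochner_Integration.integral_nonneg) simp
        ultimately show "norm (LINT y|lborel. norm (case_prod F (t, y))) \<le> norm (norm (H t) * (LINT y|lborel. norm (gauss s 0 0 (y::real^'n))))"
          by simp
      qed
    qed
    also have "\<dots> = 0"
    proof -
      have "(LINT t|lborel. F t y) = h y * (LINT t|lborel. H t * gauss s y 0 t)" for y
        unfolding F_def by (subst integral_mult_right_zero[symmetric]) (simp add: mult_ac)
      thus ?thesis using test[OF s] by simp
    qed
    finally show ?thesis by simp
  qed
  have "(\<lambda>n. integral\<^sup>L (lborel \<Otimes>\<^sub>M lborel) (?J (inverse (real (Suc n))))) \<longlonglongrightarrow> integral\<^sup>L (lborel \<Otimes>\<^sub>M lborel) (?J 0)"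
  proof (rule integral_dominated_convergence[where w="\<lambda>p. norm (H (fst p)) * norm (?g (snd p))"])
    have "integrable (lborel \<Otimes>\<^sub>M lborel) (\<lambda>p. H (fst p) * ?g (snd p))"
      by (rule integrable_pair_bound[OF _ H gi]) (auto simp: norm_mult)
    from integrable_norm[OF this] show "integrable (lborel \<Otimes>\<^sub>M lborel) (\<lambda>p. norm (H (fst p)) * norm (?g (snd p)))"
      by (simp add: norm_mult)
    show "AE p in lborel \<Otimes>\<^sub>M lborel. norm (?J (inverse (real (Suc n))) p) \<le> norm (H (fst p)) * norm (?g (snd p))" for n
      by (auto simp: norm_mult intro!: mult_right_mono mult_left_le hb)
    show "AE p in lborel \<Otimes>\<^sub>M lborel. (\<lambda>n. ?J (inverse (real (Suc n))) p) \<longlonglongrightarrow> ?J 0 p"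
    proof (rule AE_I2)
      fix p :: "(real^'n) \<times> (real^'n)"
      have "(\<lambda>n. fst p + (- inverse (real (Suc n))) *\<^sub>R snd p) \<longlonglongrightarrow> fst p + (- 0) *\<^sub>R snd p"
        by (intro tendsto_intros LIMSEQ_inverse_real_of_nat)
      moreover have "isCont h (fst p + (- 0) *\<^sub>R snd p)" using h by (simp add: continuous_on_eq_continuous_at)
      ultimately have "(\<lambda>n. h (fst p + (- inverse (real (Suc n))) *\<^sub>R snd p)) \<longlonglongrightarrow> h (fst p + (- 0) *\<^sub>R snd p)"
        by (rule isCont_tendsto_compose[rotated])
      thus "(\<lambda>n. ?J (inverse (real (Suc n))) p) \<longlonglongrightarrow> ?J 0 p"
        by (rule tendsto_mult[OF tendsto_mult[OF tendsto_const] tendsto_const])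
    qed
  qed (use Jm in auto)
  hence "integral\<^sup>L (lborel \<Otimes>\<^sub>M lborel) (?J 0) = 0"
    using J0 by (simp add: LIMSEQ_const_iff)
  moreover have "integral\<^sup>L (lborel \<Otimes>\<^sub>M lborel) (?J 0) = (LINT t|lborel. LINT z|lborel. ?J 0 (t, z))"
    by (rule lborel_pair.integral_fst'[OF J, symmetric])
  moreover have "\<dots> = (LINT t|lborel. H t * h t) * integral\<^sup>L lborel ?g" by simp
  moreover have "integral\<^sup>L lborel ?g = 1" by (subst gauss_integral(2)) auto
  ultimately show ?thesis by simp
qed

text \<open>\<open>D\<close> is integrable only against Gaussians, so it is first multiplied by a
  fixed one. The product of two Gaussians is a multiple of a third, hence the product with
  \<open>D\<close> passes the same tests.\<close>

lemma test_gauss_eq_0: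
  fixes D :: "real ^ 'n::finite \<Rightarrow> complex"
  assumes int: "\<And>s y. s > 0 \<Longrightarrow> integrable lborel (\<lambda>t. D t * gauss s y 0 t)"
    and test: "\<And>s y. s > 0 \<Longrightarrow> (LINT t|lborel. D t * gauss s y 0 t) = 0"
  shows "AE t in lborel. D t = 0"
proof -
  define H where "H t = D t * gauss 1 0 0 t" for t
  have H: "integrable lborel H" unfolding H_def[abs_def] by (rule int) simp
  have testH: "(LINT t|lborel. H t * gauss s y 0 t) = 0" if s: "s > 0" for s y
  proof -
    \<comment> \<open>Completing the square in |t|^2 + |t - y|^2 / s^2 gives b |t - y'|^2 + c, a
      Gaussian of width 1 / sqrt b centred at \<open>y'\<close>.\<close>
    define b where "b = 1 + 1 / s\<^sup>2"
    have b: "b > 1" using s by (simp add: b_def)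
    define y' where "y' = (1 / (s\<^sup>2 * b)) *\<^sub>R y"
    define c where "c = (norm y)\<^sup>2 / s\<^sup>2 - b * (norm y')\<^sup>2"
    have "(norm t)\<^sup>2 + (norm (t - y))\<^sup>2 / s\<^sup>2 = b * (norm (t - y'))\<^sup>2 + c" for t
    proof -
      have i: "b * (t \<bullet> y') = (t \<bullet> y) / s\<^sup>2" using b by (simp add: y'_def)
      have "b * (norm (t - y'))\<^sup>2 + c = b * (t \<bullet> t) - 2 * (b * (t \<bullet> y')) + (norm y)\<^sup>2 / s\<^sup>2"
        unfolding c_def by (simp add: power2_norm_eq_inner inner_diff_left inner_diff_right inner_commute algebra_simps)
      also have "\<dots> = (norm t)\<^sup>2 + (norm (t - y))\<^sup>2 / s\<^sup>2"
        unfolding i unfolding b_def by (simp add: power2_norm_eq_inner inner_diff_left inner_diff_right inner_commute add_divide_distrib diff_divide_distrib algebra_simps)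
      finally show ?thesis by simp
    qed
    hence e: "- pi * (norm (t - 0))\<^sup>2 / 1\<^sup>2 + - pi * (norm (t - y))\<^sup>2 / s\<^sup>2 = - pi * c + - pi * (norm (t - y'))\<^sup>2 / (1 / sqrt b)\<^sup>2" for t
    proof -
      have "- pi * ((norm t)\<^sup>2 + (norm (t - y))\<^sup>2 / s\<^sup>2) = - pi * (b * (norm (t - y'))\<^sup>2 + c)"
        using \<open>\<And>t. (norm t)\<^sup>2 + (norm (t - y))\<^sup>2 / s\<^sup>2 = b * (norm (t - y'))\<^sup>2 + c\<close> by simp
      thus ?thesis using b by (simp add: power_divide algebra_simps)
    qed
    have "gauss 1 0 0 t * gauss s y 0 t = of_real (exp (- pi * c)) * gauss (1 / sqrt b) y' 0 t" for t
    proof -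
      have "exp (- pi * (norm (t - 0))\<^sup>2 / 1\<^sup>2) * exp (- pi * (norm (t - y))\<^sup>2 / s\<^sup>2) = exp (- pi * c) * exp (- pi * (norm (t - y'))\<^sup>2 / (1 / sqrt b)\<^sup>2)"
        unfolding mult_exp_exp e ..
      from arg_cong[OF this, of complex_of_real] show ?thesis unfolding gauss_def by simp
    qed
    hence "(LINT t|lborel. H t * gauss s y 0 t) = (LINT t|lborel. of_real (exp (- pi * c)) * (D t * gauss (1 / sqrt b) y' 0 t))"
      unfolding H_def by (intro Bochner_Integration.integral_cong refl) (simp add: mult_ac)
    thus ?thesis using b test[of "1 / sqrt b" y'] by simp
  qed
  have t: "(LINT t|lborel. H t * of_real (h t)) = 0"
    if "continuous_on UNIV h" "\<And>x. 0 \<le> h x \<and> h x \<le> 1" for h :: "real^'n \<Rightarrow> real"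
    using that by (intro test_gauss_imp_test_continuous[OF H testH]) (auto intro!: continuous_intros)
  have ti: "integrable lborel (\<lambda>t. H t * of_real (h t))"
    if "continuous_on UNIV h" "\<And>x. 0 \<le> h x \<and> h x \<le> 1" for h :: "real^'n \<Rightarrow> real"
  proof -
    have "(\<lambda>t. complex_of_real (h t)) \<in> borel_measurable borel"
      by (intro borel_measurable_continuous_onI continuous_intros that(1))
    thus ?thesis using that(2) H
      by (intro Bochner_Integration.integrable_bound[OF H]) (auto simp: norm_mult intro!: mult_left_le)
  qed
  have "AE t in lborel. Re (H t) = 0"
  proof (rule integral_test_continuous_eq_0)
    fix h :: "real^'n \<Rightarrow> real" assume h: "continuous_on UNIV h" "\<And>x. 0 \<le> h x \<and> h x \<le> 1"
    show "(LINT x|lborel. Re (H x) * h x) = 0"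
      using integral_Re[OF ti[OF h]] t[OF h] by simp
  qed (use H in auto)
  moreover have "AE t in lborel. Im (H t) = 0"
  proof (rule integral_test_continuous_eq_0)
    fix h :: "real^'n \<Rightarrow> real" assume h: "continuous_on UNIV h" "\<And>x. 0 \<le> h x \<and> h x \<le> 1"
    show "(LINT x|lborel. Im (H x) * h x) = 0"
      using integral_Im[OF ti[OF h]] t[OF h] by simp
  qed (use H in auto)
  ultimately show ?thesis
  proof eventually_elim
    case (elim t)
    hence "H t = 0" by (simp add: complex_eq_iff)
    moreover have "gauss 1 0 0 t \<noteq> 0" by (simp add: gauss_def)
    ultimately show ?case by (simp add: H_def)
  qed
qed

definition ifourier :: "(real ^ 'n::finite \<Rightarrow> complex) \<Rightarrow> real ^ 'n \<Rightarrow> complex" where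
  "ifourier K t = (LINT \<omega>|lborel. K \<omega> * cis (2 * pi * (t \<bullet> \<omega>)))"

lemma norm_ifourier_le: "norm (ifourier K t) \<le> (LINT \<omega>|lborel. norm (K \<omega>))"
  unfolding ifourier_def by (rule order_trans[OF integral_norm_bound]) (simp add: norm_mult)

lemma continuous_ifourier:
  assumes K: "integrable lborel K"
  shows "continuous_on A (ifourier K)"
proof -
  have [measurable]: "K \<in> borel_measurable borel" using K by auto
  have "isCont (ifourier K) t" for t
    unfolding continuous_at_sequentially comp_def ifourier_def
  proof (intro allI impI)
    fix x assume x: "x \<longlonglongrightarrow> t"
    show "(\<lambda>n. LINT \<omega>|lborel. K \<omega> * cis (2 * pi * (x n \<bullet> \<omega>))) \<longlonglongrightarrow> (LINT \<omega>|lborel. K \<omega> * cis (2 * pi * (t \<bullet> \<omega>)))"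
    proof (rule integral_dominated_convergence[where w="\<lambda>\<omega>. norm (K \<omega>)"])
      have "isCont cis u" for u
        using continuous_on_cis[of UNIV "\<lambda>x. x"] by (simp add: continuous_on_eq_continuous_at)
      thus "AE \<omega> in lborel. (\<lambda>n. K \<omega> * cis (2 * pi * (x n \<bullet> \<omega>))) \<longlonglongrightarrow> K \<omega> * cis (2 * pi * (t \<bullet> \<omega>))"
        by (intro AE_I2 tendsto_intros isCont_tendsto_compose[of _ cis] x)
      have m: "(\<lambda>\<omega>. cis (2 * pi * (y \<bullet> \<omega>))) \<in> borel_measurable borel" for y :: "real^'a"
        by (intro borel_measurable_continuous_onI continuous_intros)
      show "(\<lambda>\<omega>. K \<omega> * cis (2 * pi * (t \<bullet> \<omega>))) \<in> borel_measurable lborel"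
        "(\<lambda>\<omega>. K \<omega> * cis (2 * pi * (x n \<bullet> \<omega>))) \<in> borel_measurable lborel" for n
        using m by auto
    qed (use K in \<open>auto simp: norm_mult\<close>)
  qed
  thus ?thesis by (simp add: continuous_at_imp_continuous_on)
qed

text \<open>Both sides are tested on Gaussians. A Gaussian is the Fourier transform of some \<psi>,
  and Fubini, applied once in each direction, turns both test integrals into the integral of \<psi>
  times the Fourier transform of \<open>F\<close>.\<close>

theorem fourier_inversion:
  fixes F :: "real ^ 'n::finite \<Rightarrow> complex"
  assumes F: "integrable lborel F" and K: "integrable lborel (fourier F)"
  shows "AE t in lborel. F t = ifourier (fourier F) t"
proof -
  let ?K = "fourier F"
  let ?B = "LINT \<omega>|lborel. norm (?K \<omega>)"
  have [measurable]: "F \<in> borel_measurable borel" "?K \<in> borel_measurable borel" using F K by auto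
  have mI[measurable]: "ifourier ?K \<in> borel_measurable borel"
    by (intro borel_measurable_continuous_onI continuous_ifourier K)
  have mc[measurable]: "(\<lambda>(x, y). cis (c * (x \<bullet> y))) \<in> borel_measurable (lborel \<Otimes>\<^sub>M (lborel :: (real^'n) measure))" for c
    unfolding borel_prod[symmetric] lborel_prod by (simp add: case_prod_unfold, intro borel_measurable_continuous_onI continuous_intros)
  have I1: "integrable lborel (\<lambda>t. F t * gauss s y 0 t)" if "s > 0" for s y
    using that by (intro Bochner_Integration.integrable_bound[OF F])
       (auto simp: norm_mult norm_gauss intro!: mult_left_le)
  have I2: "integrable lborel (\<lambda>t. ifourier ?K t * gauss s y 0 t)" if "s > 0" for s y
  proof (rule Bochner_Integration.integrable_bound[OF integrable_mult_right[OF gauss_integral(1)[OF that, of y 0], of "of_real ?B"] _ AE_I2])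
    fix t
    show "norm (ifourier ?K t * gauss s y 0 t) \<le> norm (of_real ?B * gauss s y 0 t)"
      using norm_ifourier_le[of ?K t] unfolding norm_mult by (intro mult_right_mono) auto
  qed measurable
  have "AE t in lborel. F t - ifourier ?K t = 0"
  proof (rule test_gauss_eq_0)
    fix s :: real and y :: "real^'n" assume s: "s > 0"
    show "integrable lborel (\<lambda>t. (F t - ifourier ?K t) * gauss s y 0 t)"
      using I1[OF s] I2[OF s] by (simp add: left_diff_distrib)
    \<comment> \<open>The inverse Fourier transform of \<open>gauss s y 0\<close>, again a Gaussian:
      the width is inverted and the centre becomes a modulation.\<close>
    define \<psi> where "\<psi> \<omega> = of_real (s ^ CARD('n)) * gauss (1 / s) 0 (- y) \<omega>" for \<omega>
    have s': "1 / s > 0" using s by simp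
    have \<psi>: "integrable lborel \<psi>" unfolding \<psi>_def by (intro integrable_mult_right gauss_integral(1) s')
    have [measurable]: "\<psi> \<in> borel_measurable borel" using \<psi> by auto
    have \<psi>1: "(LINT \<omega>|lborel. \<psi> \<omega> * cis (- 2 * pi * (t \<bullet> \<omega>))) = gauss s y 0 t" for t
    proof -
      have "(LINT \<omega>|lborel. \<psi> \<omega> * cis (- 2 * pi * (t \<bullet> \<omega>))) = of_real (s ^ CARD('n)) * fourier (gauss (1 / s) 0 (- y)) t"
        unfolding \<psi>_def fourier_def by (simp add: mult.assoc inner_commute)
      also have "\<dots> = gauss s y 0 t"
        unfolding fourier_gauss[OF s'] gauss_def using s by (simp add: power_divide)
      finally show ?thesis .
    qed
    have \<psi>2: "(LINT t|lborel. gauss s y 0 t * cis (2 * pi * (t \<bullet> \<omega>))) = \<psi> \<omega>" for \<omega>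
    proof -
      have "(LINT t|lborel. gauss s y 0 t * cis (2 * pi * (t \<bullet> \<omega>))) = fourier (gauss s y 0) (- \<omega>)"
        unfolding fourier_def by simp
      also have "\<dots> = \<psi> \<omega>"
        unfolding fourier_gauss[OF s] \<psi>_def gauss_def using s by (simp add: power_divide inner_commute mult_ac)
      finally show ?thesis .
    qed
    have "(LINT t|lborel. F t * gauss s y 0 t) = (LINT t|lborel. LINT \<omega>|lborel. F t * (\<psi> \<omega> * cis (- 2 * pi * (t \<bullet> \<omega>))))"
      by (simp only: \<psi>1 integral_mult_right_zero)
    also have "\<dots> = (LINT \<omega>|lborel. LINT t|lborel. F t * (\<psi> \<omega> * cis (- 2 * pi * (t \<bullet> \<omega>))))"
      by (rule lborel_pair.Fubini_integral[symmetric], rule integrable_pair_bound[OF _ F \<psi>])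
         (measurable, auto simp: norm_mult)
    also have "\<dots> = (LINT \<omega>|lborel. \<psi> \<omega> * ?K \<omega>)"
      unfolding fourier_def by (subst integral_mult_right_zero[symmetric]) (simp add: mult_ac)
    also have "\<dots> = (LINT \<omega>|lborel. LINT t|lborel. ?K \<omega> * (gauss s y 0 t * cis (2 * pi * (t \<bullet> \<omega>))))"
      by (simp only: \<psi>2 integral_mult_right_zero) (simp only: mult.commute)
    also have "\<dots> = (LINT t|lborel. LINT \<omega>|lborel. ?K \<omega> * (gauss s y 0 t * cis (2 * pi * (t \<bullet> \<omega>))))"
      by (rule lborel_pair.Fubini_integral, rule integrable_pair_bound[OF _ gauss_integral(1)[OF s, of y 0] K])
         (measurable, auto simp: norm_mult)
    also have "\<dots> = (LINT t|lborel. ifourier ?K t * gauss s y 0 t)"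
      unfolding ifourier_def by (subst integral_mult_left_zero[symmetric]) (simp add: mult_ac)
    finally show "(LINT t|lborel. (F t - ifourier ?K t) * gauss s y 0 t) = 0"
      using I1[OF s] I2[OF s] by (simp add: left_diff_distrib)
  qed
  thus ?thesis by simp
qed

section \<open>Inverse Fourier transforms of rapidly decreasing functions\<close>

text \<open>A product of integrable functions of one variable, so integrability comes from the
  product formula. Its reciprocal is a polynomial of degree 2d in dimension d, the origin of every
  \<open>2 * CARD('n)\<close> below.\<close>

definition tensor_weight :: "real ^ 'n::finite \<Rightarrow> real" where
  "tensor_weight \<omega> = (\<Prod>i\<in>UNIV. inverse (1 + (\<omega> $ i)\<^sup>2))"

lemma tensor_weight_pos: "tensor_weight \<omega> > 0"
  unfolding tensor_weight_def by (intro prod_pos) (auto intro: add_pos_nonneg)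

lemma integrable_tensor_weight: "integrable lborel (tensor_weight :: real ^ 'n::finite \<Rightarrow> real)"
proof -
  have 1: "integrable lborel (\<lambda>r::real. inverse (1 + r\<^sup>2))"
    using integrable_inverse_1_plus_square by (simp add: set_integrable_def einterval_def)
  have "integrable lborel (\<lambda>x::real^'n. \<Prod>i\<in>UNIV. complex_of_real (inverse (1 + (x $ i)\<^sup>2)))"
    by (rule lborel_prod_integral(1)[where p="\<lambda>_ r. complex_of_real (inverse (1 + r\<^sup>2))"]) (use 1 in \<open>simp only: complex_of_real_integrable_eq\<close>)
  hence "integrable lborel (\<lambda>x::real^'n. complex_of_real (tensor_weight x))"
    by (simp only: tensor_weight_def of_real_prod)
  thus ?thesis by (simp only: complex_of_real_integrable_eq)
qed

lemma component_square_le: "(x $ i)\<^sup>2 \<le> (norm (x :: real ^ 'n::finite))\<^sup>2"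
  by (rule abs_le_square_iff[THEN iffD1]) (simp add: component_le_norm_cart)

lemma inverse_tensor_weight_le:
  fixes \<omega> :: "real ^ 'n::finite"
  shows "1 \<le> 2 ^ CARD('n) * (1 + norm \<omega> ^ (2 * CARD('n))) * tensor_weight \<omega>"
proof -
  let ?s = "norm \<omega>" and ?d = "CARD('n)"
  have "inverse (tensor_weight \<omega>) = (\<Prod>i\<in>UNIV. 1 + (\<omega> $ i)\<^sup>2)"
    unfolding tensor_weight_def using prod_inversef[of "\<lambda>i. 1 + (\<omega> $ i)\<^sup>2" UNIV] by (simp add: o_def)
  also have "\<dots> \<le> (\<Prod>i\<in>(UNIV::'n set). 1 + ?s\<^sup>2)"
    by (intro prod_mono conjI add_left_mono component_square_le) simp
  also have "\<dots> = (1 + ?s\<^sup>2) ^ ?d" by simp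
  also have "\<dots> \<le> (2 * max 1 (?s\<^sup>2)) ^ ?d" by (intro power_mono) auto
  also have "\<dots> \<le> 2 ^ ?d * (1 + ?s ^ (2 * ?d))"
    by (auto simp: power_mult_distrib max_def power_mult)
  finally show ?thesis using tensor_weight_pos[of \<omega>] by (simp add: field_simps)
qed

text \<open>Multiplying and dividing by \<open>tensor_weight\<close> trades the integral for two
  suprema, one of them with 2d additional powers of |\<omega>|.\<close>

lemma moment_bound:
  fixes K :: "real ^ 'n::finite \<Rightarrow> complex"
  assumes m: "K \<in> borel_measurable borel"
    and b1: "\<And>\<omega>. norm \<omega> ^ N * norm (K \<omega>) \<le> B1"
    and b2: "\<And>\<omega>. norm \<omega> ^ (N + 2 * CARD('n)) * norm (K \<omega>) \<le> B2"
  shows "integrable lborel (\<lambda>\<omega>. norm \<omega> ^ N * norm (K \<omega>))"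
    and "(LINT \<omega>|lborel. norm \<omega> ^ N * norm (K \<omega>)) \<le> 2 ^ CARD('n) * (B1 + B2) * (LINT \<omega>|lborel. tensor_weight (\<omega> :: real^'n))"
proof -
  let ?d = "CARD('n)"
  have le: "norm \<omega> ^ N * norm (K \<omega>) \<le> 2 ^ ?d * (B1 + B2) * tensor_weight \<omega>" for \<omega>
  proof -
    have "norm \<omega> ^ N * norm (K \<omega>) * 1 \<le> norm \<omega> ^ N * norm (K \<omega>) * (2 ^ ?d * (1 + norm \<omega> ^ (2 * ?d)) * tensor_weight \<omega>)"
      by (intro mult_left_mono inverse_tensor_weight_le) auto
    also have "\<dots> = 2 ^ ?d * (norm \<omega> ^ N * norm (K \<omega>) + norm \<omega> ^ (N + 2 * ?d) * norm (K \<omega>)) * tensor_weight \<omega>"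
      by (simp add: algebra_simps power_add)
    also have "\<dots> \<le> 2 ^ ?d * (B1 + B2) * tensor_weight \<omega>"
      using tensor_weight_pos[of \<omega>] by (intro mult_right_mono mult_left_mono add_mono b1 b2) auto
    finally show ?thesis by simp
  qed
  have i: "integrable lborel (\<lambda>\<omega>::real^'n. 2 ^ ?d * (B1 + B2) * tensor_weight \<omega>)"
    by (intro integrable_mult_right integrable_tensor_weight)
  show 1: "integrable lborel (\<lambda>\<omega>. norm \<omega> ^ N * norm (K \<omega>))"
  proof (rule Bochner_Integration.integrable_bound[OF i _ AE_I2])
    show "(\<lambda>\<omega>. norm \<omega> ^ N * norm (K \<omega>)) \<in> borel_measurable lborel" using m by simp
    show "norm (norm \<omega> ^ N * norm (K \<omega>)) \<le> norm (2 ^ ?d * (B1 + B2) * tensor_weight \<omega>)" for \<omega>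
      using order_trans[OF le[of \<omega>] abs_ge_self] by simp
  qed
  have "(LINT \<omega>|lborel. norm \<omega> ^ N * norm (K \<omega>)) \<le> (LINT \<omega>|lborel. 2 ^ ?d * (B1 + B2) * tensor_weight (\<omega>::real^'n))"
    by (rule Bochner_Integration.integral_mono[OF 1 i le])
  thus "(LINT \<omega>|lborel. norm \<omega> ^ N * norm (K \<omega>)) \<le> 2 ^ ?d * (B1 + B2) * (LINT \<omega>|lborel. tensor_weight (\<omega> :: real^'n))"
    by simp
qed

text \<open>No condition on derivatives of \<open>K\<close>: only the smoothness of its inverse
  Fourier transform is wanted, and that needs moments alone.\<close>

definition rapid :: "(real ^ 'n::finite \<Rightarrow> complex) \<Rightarrow> bool" where
  "rapid K \<longleftrightarrow> K \<in> borel_measurable borel \<and> (\<forall>N. \<exists>B. \<forall>\<omega>. norm \<omega> ^ N * norm (K \<omega>) \<le> B)"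

lemma rapid_moment_integrable:
  fixes K :: "real ^ 'n::finite \<Rightarrow> complex"
  assumes "rapid K" shows "integrable lborel (\<lambda>\<omega>. norm \<omega> ^ N * norm (K \<omega>))"
proof -
  obtain B1 B2 where "\<And>\<omega>. norm \<omega> ^ N * norm (K \<omega>) \<le> B1" "\<And>\<omega>. norm \<omega> ^ (N + 2 * CARD('n)) * norm (K \<omega>) \<le> B2"
    using assms unfolding rapid_def by metis
  thus ?thesis using assms by (intro moment_bound(1)) (auto simp: rapid_def)
qed

lemma rapid_integrable: "rapid K \<Longrightarrow> integrable lborel K"
  using rapid_moment_integrable[of K 0] integrable_norm_iff[of K lborel] by (auto simp: rapid_def)

definition deriv_symbol :: "'n list \<Rightarrow> real ^ 'n::finite \<Rightarrow> complex" where
  "deriv_symbol is \<omega> = prod_list (map (\<lambda>i. 2 * pi * \<i> * of_real (\<omega> $ i)) is)"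

lemma deriv_symbol_simps [simp]:
  "deriv_symbol [] \<omega> = 1" "deriv_symbol (i # is) \<omega> = 2 * pi * \<i> * of_real (\<omega> $ i) * deriv_symbol is \<omega>"
  by (simp_all add: deriv_symbol_def)

lemma norm_deriv_symbol_le: "norm (deriv_symbol is \<omega>) \<le> (2 * pi * norm \<omega>) ^ length is"
proof (induction "is")
  case (Cons i "is")
  have "norm (deriv_symbol (i # is) \<omega>) = 2 * pi * \<bar>\<omega> $ i\<bar> * norm (deriv_symbol is \<omega>)" by (simp add: norm_mult)
  also have "\<dots> \<le> 2 * pi * norm \<omega> * (2 * pi * norm \<omega>) ^ length is"
    by (intro mult_mono Cons component_le_norm_cart) auto
  finally show ?case by simp
qed simp

lemma measurable_deriv_symbol [measurable]: "deriv_symbol is \<in> borel_measurable borel"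
proof (induction "is")
  case Nil
  have "deriv_symbol [] = (\<lambda>\<omega>::real^'a. 1)" by auto
  thus ?case by simp
next
  case (Cons i "is")
  have "deriv_symbol (i # is) = (\<lambda>\<omega>. 2 * pi * \<i> * of_real (\<omega> $ i) * deriv_symbol is \<omega>)" by auto
  thus ?case using Cons by simp
qed

lemma rapid_deriv_symbol:
  assumes K: "rapid K" shows "rapid (\<lambda>\<omega>. deriv_symbol is \<omega> * K \<omega>)"
  unfolding rapid_def
proof (intro conjI allI)
  have [measurable]: "K \<in> borel_measurable borel" using K by (simp add: rapid_def)
  show "(\<lambda>\<omega>. deriv_symbol is \<omega> * K \<omega>) \<in> borel_measurable borel" by measurable
  fix N
  obtain B where B: "\<And>\<omega>. norm \<omega> ^ (N + length is) * norm (K \<omega>) \<le> B" using K by (auto simp: rapid_def)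
  show "\<exists>B. \<forall>\<omega>. norm \<omega> ^ N * norm (deriv_symbol is \<omega> * K \<omega>) \<le> B"
  proof (intro exI allI)
    fix \<omega> :: "real^'a"
    have "norm \<omega> ^ N * norm (deriv_symbol is \<omega> * K \<omega>) \<le> norm \<omega> ^ N * ((2 * pi * norm \<omega>) ^ length is * norm (K \<omega>))"
      unfolding norm_mult by (intro mult_left_mono mult_right_mono norm_deriv_symbol_le) auto
    also have "\<dots> = (2 * pi) ^ length is * (norm \<omega> ^ (N + length is) * norm (K \<omega>))"
      by (simp add: power_mult_distrib power_add)
    also have "\<dots> \<le> (2 * pi) ^ length is * B" by (intro mult_left_mono B) auto
    finally show "norm \<omega> ^ N * norm (deriv_symbol is \<omega> * K \<omega>) \<le> (2 * pi) ^ length is * B" .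
  qed
qed

text \<open>The Taylor estimate |exp(iu) - 1 - iu| <= u^2 / 2 under the integral bounds the
  linearization error at step h by h^2 times a second moment of \<open>K\<close>.\<close>

lemma has_partial_ifourier:
  fixes K :: "real ^ 'n::finite \<Rightarrow> complex"
  assumes K: "rapid K"
  shows "has_partial i (ifourier K) (ifourier (\<lambda>\<omega>. 2 * pi * \<i> * of_real (\<omega> $ i) * K \<omega>))"
  unfolding has_partial_def
proof
  fix x :: "real^'n"
  let ?e = "axis i 1 :: real^'n"
  let ?c = "\<lambda>\<omega>. cis (2 * pi * (x \<bullet> \<omega>))"
  let ?K1 = "\<lambda>\<omega>. 2 * pi * \<i> * of_real (\<omega> $ i) * K \<omega>"
  \<comment> \<open>The factor 2 pi^2 is what remains of u^2 / 2 for u = 2 pi h \<omega>_i after h^2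
    \<omega>_i^2 is taken out.\<close>
  define C where "C = (LINT \<omega>|lborel. 2 * pi\<^sup>2 * (norm (\<omega>::real^'n) ^ 2 * norm (K \<omega>)))"
  have K1: "rapid ?K1" using rapid_deriv_symbol[OF K, of "[i]"] by simp
  have I: "integrable lborel (\<lambda>\<omega>. K \<omega> * cis (2 * pi * (t \<bullet> \<omega>)))" "integrable lborel (\<lambda>\<omega>. ?K1 \<omega> * cis (2 * pi * (t \<bullet> \<omega>)))" for t
    using integrable_mult_cis[OF rapid_integrable[OF K], of "2 * pi" t] integrable_mult_cis[OF rapid_integrable[OF K1], of "2 * pi" t]
    by (simp_all add: inner_commute)
  have lin: "integral\<^sup>L lborel A - integral\<^sup>L lborel B - h *\<^sub>R integral\<^sup>L lborel D = (LINT \<omega>|lborel. A \<omega> - B \<omega> - h *\<^sub>R D \<omega>)"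
    if "integrable lborel A" "integrable lborel B" "integrable lborel D" for A B D :: "real^'n \<Rightarrow> complex" and h
    using that by simp
  have key: "norm (ifourier K (x + h *\<^sub>R ?e) - ifourier K x - h *\<^sub>R ifourier ?K1 x) \<le> h\<^sup>2 * C" for h
  proof -
    have e1: "ifourier K (x + h *\<^sub>R ?e) - ifourier K x - h *\<^sub>R ifourier ?K1 x
      = (LINT \<omega>|lborel. K \<omega> * cis (2 * pi * ((x + h *\<^sub>R ?e) \<bullet> \<omega>)) - K \<omega> * ?c \<omega> - h *\<^sub>R (?K1 \<omega> * ?c \<omega>))"
      unfolding ifourier_def by (rule lin[OF I(1) I(1) I(2)])
    have "norm (ifourier K (x + h *\<^sub>R ?e) - ifourier K x - h *\<^sub>R ifourier ?K1 x) \<le> (LINT \<omega>|lborel. norm (K \<omega> * cis (2 * pi * ((x + h *\<^sub>R ?e) \<bullet> \<omega>)) - K \<omega> * ?c \<omega> - h *\<^sub>R (?K1 \<omega> * ?c \<omega>)))"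
      unfolding e1 by (rule integral_norm_bound)
    also have "\<dots> \<le> (LINT \<omega>|lborel. h\<^sup>2 * (2 * pi\<^sup>2 * (norm \<omega> ^ 2 * norm (K \<omega>))))"
    proof (rule Bochner_Integration.integral_mono)
      show "integrable lborel (\<lambda>\<omega>. norm (K \<omega> * cis (2 * pi * ((x + h *\<^sub>R ?e) \<bullet> \<omega>)) - K \<omega> * ?c \<omega> - h *\<^sub>R (?K1 \<omega> * ?c \<omega>)))"
        by (intro integrable_norm Bochner_Integration.integrable_diff integrable_scaleR_right I)
      show "integrable lborel (\<lambda>\<omega>. h\<^sup>2 * (2 * pi\<^sup>2 * (norm \<omega> ^ 2 * norm (K \<omega>))))"
        by (intro integrable_mult_right rapid_moment_integrable[OF K])
      fix \<omega> :: "real^'n"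
      let ?u = "2 * pi * h * \<omega> $ i"
      have e2: "K \<omega> * cis (2 * pi * ((x + h *\<^sub>R ?e) \<bullet> \<omega>)) - K \<omega> * ?c \<omega> - h *\<^sub>R (?K1 \<omega> * ?c \<omega>)
        = K \<omega> * ?c \<omega> * (iexp ?u - (1 + \<i> * ?u))"
      proof -
        have "2 * pi * ((x + h *\<^sub>R ?e) \<bullet> \<omega>) = 2 * pi * (x \<bullet> \<omega>) + ?u"
          by (simp add: inner_add_left inner_axis' distrib_left)
        hence c: "cis (2 * pi * ((x + h *\<^sub>R ?e) \<bullet> \<omega>)) = ?c \<omega> * iexp ?u"
          by (simp only: cis_mult[symmetric] cis_conv_exp[of ?u])
        show ?thesis unfolding c by (simp add: scaleR_conv_of_real ring_distribs)
      qed
      have "norm (K \<omega> * cis (2 * pi * ((x + h *\<^sub>R ?e) \<bullet> \<omega>)) - K \<omega> * ?c \<omega> - h *\<^sub>R (?K1 \<omega> * ?c \<omega>))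
        = norm (K \<omega>) * norm (iexp ?u - (1 + \<i> * ?u))"
        unfolding e2 by (simp add: norm_mult del: of_real_mult)
      also have "\<dots> \<le> norm (K \<omega>) * (?u\<^sup>2 / 2)"
        using iexp_approx1[of ?u 1] by (intro mult_left_mono) (auto simp: numeral_2_eq_2 simp del: of_real_mult)
      also have "\<dots> = h\<^sup>2 * (2 * pi\<^sup>2 * ((\<omega> $ i)\<^sup>2 * norm (K \<omega>)))"
        by (simp add: power_mult_distrib)
      also have "\<dots> \<le> h\<^sup>2 * (2 * pi\<^sup>2 * (norm \<omega> ^ 2 * norm (K \<omega>)))"
        by (intro mult_left_mono mult_right_mono component_square_le) auto
      finally show "norm (K \<omega> * cis (2 * pi * ((x + h *\<^sub>R ?e) \<bullet> \<omega>)) - K \<omega> * ?c \<omega> - h *\<^sub>R (?K1 \<omega> * ?c \<omega>))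
          \<le> h\<^sup>2 * (2 * pi\<^sup>2 * (norm \<omega> ^ 2 * norm (K \<omega>)))" .
    qed
    finally show ?thesis by (simp add: C_def)
  qed
  show "((\<lambda>t. ifourier K (x + t *\<^sub>R ?e)) has_vector_derivative ifourier ?K1 x) (at 0)"
    unfolding has_vector_derivative_def has_derivative_at
  proof
    show "bounded_linear (\<lambda>h. h *\<^sub>R ifourier ?K1 x)" by (rule bounded_linear_scaleR_left)
    have "(\<lambda>h::real. \<bar>h\<bar> * C) \<midarrow>0\<rightarrow> 0" by (auto intro!: tendsto_eq_intros)
    thus "(\<lambda>h. norm (ifourier K (x + (0 + h) *\<^sub>R ?e) - ifourier K (x + 0 *\<^sub>R ?e) - h *\<^sub>R ifourier ?K1 x) / norm h) \<midarrow>0\<rightarrow> 0"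
    proof (rule Lim_null_comparison[rotated], intro always_eventually allI)
      fix h :: real
      show "norm (norm (ifourier K (x + (0 + h) *\<^sub>R ?e) - ifourier K (x + 0 *\<^sub>R ?e) - h *\<^sub>R ifourier ?K1 x) / norm h) \<le> \<bar>h\<bar> * C"
        using key[of h] by (cases "h = 0") (simp_all add: field_simps power2_eq_square)
    qed
  qed
qed

lemma
  assumes K: "rapid K"
  shows psmooth_ifourier: "psmooth (ifourier K)"
    and iter_deriv_ifourier: "iter_deriv is (ifourier K) = ifourier (\<lambda>\<omega>. deriv_symbol is \<omega> * K \<omega>)"
proof -
  let ?H = "\<lambda>is. ifourier (\<lambda>\<omega>. deriv_symbol is \<omega> * K \<omega>)"
  have 1: "?H [] = ifourier K" by simp
  have 2: "continuous_on UNIV (?H is)" for "is"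
    by (intro continuous_ifourier rapid_integrable rapid_deriv_symbol K)
  have 3: "has_partial i (?H is) (?H (i # is))" for i "is"
    using has_partial_ifourier[OF rapid_deriv_symbol[OF K, of "is"]] by (simp add: mult.assoc)
  note R = psmoothI[where H="?H", OF 1 2 3]
  show "psmooth (ifourier K)" by (rule R(1))
  show "iter_deriv is (ifourier K) = ?H is" by (rule R(2))
qed

lemma norm_iter_deriv_ifourier_le:
  assumes K: "rapid K"
  shows "norm (iter_deriv is (ifourier K) t) \<le> (2 * pi) ^ length is * (LINT \<omega>|lborel. norm \<omega> ^ length is * norm (K \<omega>))"
proof -
  have "norm (iter_deriv is (ifourier K) t) \<le> (LINT \<omega>|lborel. norm (deriv_symbol is \<omega> * K \<omega>))"
    unfolding iter_deriv_ifourier[OF K] by (rule norm_ifourier_le)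
  also have "\<dots> \<le> (LINT \<omega>|lborel. (2 * pi) ^ length is * (norm \<omega> ^ length is * norm (K \<omega>)))"
  proof (rule Bochner_Integration.integral_mono)
    show "integrable lborel (\<lambda>\<omega>. norm (deriv_symbol is \<omega> * K \<omega>))" by (intro integrable_norm rapid_integrable rapid_deriv_symbol K)
    show "integrable lborel (\<lambda>\<omega>. (2 * pi) ^ length is * (norm \<omega> ^ length is * norm (K \<omega>)))"
      by (intro integrable_mult_right rapid_moment_integrable K)
    show "norm (deriv_symbol is \<omega> * K \<omega>) \<le> (2 * pi) ^ length is * (norm \<omega> ^ length is * norm (K \<omega>))" for \<omega>
      using mult_right_mono[OF norm_deriv_symbol_le[of "is" \<omega>], of "norm (K \<omega>)"] by (simp add: norm_mult power_mult_distrib)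
  qed
  finally show ?thesis by simp
qed

lemma fourier_eq_ifourier: "fourier F \<omega> = ifourier F (- \<omega>)"
  unfolding fourier_def ifourier_def by (simp add: inner_commute)

lemma continuous_fourier:
  assumes F: "integrable lborel F" shows "continuous_on A (fourier F)"
  unfolding fourier_eq_ifourier[abs_def]
  by (rule continuous_on_compose2[OF continuous_ifourier[OF F, of UNIV]]) (auto intro!: continuous_intros)

lemma norm_fourier_le: "norm (fourier F \<omega>) \<le> (LINT t|lborel. norm (F t))"
  unfolding fourier_eq_ifourier by (rule norm_ifourier_le)

section \<open>Gevrey-type weight sequences\<close>

definition gevrey :: "real \<Rightarrow> real \<Rightarrow> real \<Rightarrow> nat \<Rightarrow> real" where
  "gevrey \<tau> \<sigma> C N = C powr (real N powr \<sigma>) * M_seq \<tau> \<sigma> N"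

lemma M_seq_pos: "M_seq \<tau> \<sigma> N > 0"
  by (simp add: M_seq_def)

lemma gevrey_0: "C > 0 \<Longrightarrow> gevrey \<tau> \<sigma> C 0 = 1"
  by (simp add: gevrey_def M_seq_def)

lemma gevrey_pos: "C > 0 \<Longrightarrow> gevrey \<tau> \<sigma> C N > 0"
  unfolding gevrey_def using M_seq_pos by simp

lemma gevrey_mono: "0 < C \<Longrightarrow> C \<le> D \<Longrightarrow> gevrey \<tau> \<sigma> C N \<le> gevrey \<tau> \<sigma> D N"
  unfolding gevrey_def by (intro mult_right_mono powr_mono2 less_imp_le[OF M_seq_pos]) auto

lemma powr_superadd:
  assumes "\<sigma> \<ge> 1"
  shows "real a powr \<sigma> + real b powr \<sigma> \<le> real (a + b) powr \<sigma>"
proof (cases "a + b = 0")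
  case False
  have e: "real k powr \<sigma> = real k * real k powr (\<sigma> - 1)" for k
    by (cases "k = 0") (auto simp: powr_diff)
  have "real a powr \<sigma> + real b powr \<sigma> \<le> real a * real (a + b) powr (\<sigma> - 1) + real b * real (a + b) powr (\<sigma> - 1)"
    unfolding e using assms by (intro add_mono mult_left_mono powr_mono2) auto
  also have "\<dots> = real (a + b) powr \<sigma>" unfolding e[of "a + b"] by (simp add: distrib_right)
  finally show ?thesis .
qed auto

text \<open>Both bases are raised to a + b, after which superadditivity of p^\<sigma> compares the
  exponents. Index 0 is apart, its value being 1 by convention.\<close>

lemma M_seq_mult:
  assumes "\<tau> > 0" "\<sigma> \<ge> 1"
  shows "M_seq \<tau> \<sigma> a * M_seq \<tau> \<sigma> b \<le> M_seq \<tau> \<sigma> (a + b)"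
proof (cases "a = 0 \<or> b = 0")
  case False
  have "M_seq \<tau> \<sigma> a * M_seq \<tau> \<sigma> b \<le> real (a + b) powr (\<tau> * real a powr \<sigma>) * real (a + b) powr (\<tau> * real b powr \<sigma>)"
    using False assms unfolding M_seq_def by (auto intro!: mult_mono powr_mono2)
  also have "\<dots> = real (a + b) powr (\<tau> * (real a powr \<sigma> + real b powr \<sigma>))"
    by (simp add: powr_add distrib_left)
  also have "\<dots> \<le> real (a + b) powr (\<tau> * real (a + b) powr \<sigma>)"
    using False assms powr_superadd[of \<sigma> a b] by (intro powr_mono) auto
  finally show ?thesis using False by (simp add: M_seq_def)
qed (auto simp: M_seq_def)

text \<open>Superadditivity enlarges the exponent of \<open>C\<close>, which increases the value
  only for C >= 1; later constants are therefore raised to at least 1.\<close>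

lemma gevrey_mult:
  assumes "\<tau> > 0" "\<sigma> \<ge> 1" "C \<ge> 1"
  shows "gevrey \<tau> \<sigma> C a * gevrey \<tau> \<sigma> C b \<le> gevrey \<tau> \<sigma> C (a + b)"
proof -
  have "gevrey \<tau> \<sigma> C a * gevrey \<tau> \<sigma> C b = C powr (real a powr \<sigma> + real b powr \<sigma>) * (M_seq \<tau> \<sigma> a * M_seq \<tau> \<sigma> b)"
    by (simp add: gevrey_def powr_add)
  also have "\<dots> \<le> C powr (real (a + b) powr \<sigma>) * M_seq \<tau> \<sigma> (a + b)"
    using assms by (intro mult_mono powr_mono powr_superadd M_seq_mult) (auto intro!: mult_nonneg_nonneg less_imp_le[OF M_seq_pos])
  finally show ?thesis by (simp add: gevrey_def)
qed

lemma power_le_powr_powr: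
  assumes "A \<ge> 1" "\<sigma> \<ge> 1"
  shows "A ^ N \<le> A powr (real N powr \<sigma>)"
proof (cases "N = 0")
  case False
  have "real N powr 1 \<le> real N powr \<sigma>" using False assms by (intro powr_mono) auto
  hence "A powr real N \<le> A powr (real N powr \<sigma>)" using assms False by (intro powr_mono) auto
  thus ?thesis using assms by (simp add: powr_realpow)
qed (use assms in auto)

text \<open>Geometric factors, such as 2^N from the Leibniz rule and (2 pi)^N from the Fourier
  symbol, disappear into the constant because N <= N^\<sigma>.\<close>

lemma gevrey_power:
  assumes "A \<ge> 1" "\<sigma> \<ge> 1" "C > 0"
  shows "A ^ N * gevrey \<tau> \<sigma> C N \<le> gevrey \<tau> \<sigma> (A * C) N"
proof -
  have "A ^ N * gevrey \<tau> \<sigma> C N \<le> A powr (real N powr \<sigma>) * gevrey \<tau> \<sigma> C N"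
    by (intro mult_right_mono power_le_powr_powr assms less_imp_le[OF gevrey_pos])
  also have "\<dots> = gevrey \<tau> \<sigma> (A * C) N" using assms by (simp add: gevrey_def powr_mult)
  finally show ?thesis .
qed

text \<open>For n >= 1 the expression (n + q)^\<sigma> ln (n + q) exceeds n^\<sigma> ln n by at most
  a multiple of n^\<sigma>, so the shift only changes the base of the power with exponent
  n^\<sigma>. The index 0 is covered by the factor \<open>c\<close>.\<close>

lemma gevrey_shift:
  assumes \<tau>: "\<tau> > 0" and \<sigma>: "\<sigma> \<ge> 1" and C: "C > 0"
  obtains D c where "D > 0" "c > 0" "\<And>N. gevrey \<tau> \<sigma> C (N + q) \<le> c * gevrey \<tau> \<sigma> D N"
proof -
  \<comment> \<open>Chosen so that (n + q)^\<sigma> <= n^\<sigma> (1 + A / n): with z = \<sigma> q /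
    n <= \<sigma> q one has exp z <= 1 + z exp z <= 1 + A / n.\<close>
  define A where "A = \<sigma> * exp (\<sigma> * q) * q"
  define B where "B = q + A + A * q"
  have A: "A \<ge> 0" using \<sigma> by (simp add: A_def)
  define C1 where "C1 = max 1 C"
  define D where "D = C1 powr (1 + A) * exp (\<tau> * B)"
  define c where "c = max 1 (gevrey \<tau> \<sigma> C q)"
  have D: "D > 0" by (simp add: D_def C1_def)
  have "gevrey \<tau> \<sigma> C (N + q) \<le> c * gevrey \<tau> \<sigma> D N" for N
  proof (cases "N = 0")
    case True thus ?thesis using D by (simp add: gevrey_0 c_def)
  next
    case False
    define n where "n = real N"
    define S where "S = n powr \<sigma>"
    have n: "n \<ge> 1" using False by (simp add: n_def)
    have S: "S \<ge> 0" by (simp add: S_def)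
    let ?z = "\<sigma> * (q / n)"
    have qn: "real q / n \<le> q" using n by (simp add: divide_le_eq mult_le_cancel_left1)
    have z: "0 \<le> ?z" "?z \<le> \<sigma> * q" using n \<sigma> mult_left_mono[OF qn, of \<sigma>] by auto
    have "1 - ?z \<le> exp (- ?z)" using exp_ge_add_one_self[of "- ?z"] by simp
    hence "(1 - ?z) * exp ?z \<le> exp (- ?z) * exp ?z" by (intro mult_right_mono) auto
    moreover have "exp (- ?z) * exp ?z = 1" unfolding mult_exp_exp by simp
    ultimately have "exp ?z \<le> 1 + ?z * exp ?z" unfolding left_diff_distrib by linarith
    also have "\<dots> \<le> 1 + ?z * exp (\<sigma> * q)" using z by (intro add_left_mono mult_left_mono) auto
    finally have ez: "exp ?z \<le> 1 + A / n" by (simp add: A_def mult_ac)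
    have lnq: "ln (1 + q / n) \<le> q / n" by (rule ln_add_one_self_le_self) (use n in simp)
    have nq: "n + q = n * (1 + q / n)" using n by (simp add: field_simps)
    have "(n + q) powr \<sigma> = S * (1 + q / n) powr \<sigma>"
      unfolding nq S_def by (rule powr_mult)
    also have "(1 + q / n) powr \<sigma> = exp (\<sigma> * ln (1 + q / n))"
    proof -
      have "1 + q / n \<noteq> 0" using n by (simp add: add_nonneg_eq_0_iff)
      thus ?thesis by (simp add: powr_def)
    qed
    also have "\<dots> \<le> exp ?z" using mult_left_mono[OF lnq, of \<sigma>] \<sigma> by simp
    also have "\<dots> \<le> 1 + A / n" by (rule ez)
    finally have p: "(n + q) powr \<sigma> \<le> S * (1 + A / n)" using S by (simp add: mult_left_mono)
    have An: "A / n \<le> A" using n A by (simp add: divide_le_eq mult_le_cancel_left1)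
    have p2: "(n + q) powr \<sigma> \<le> (1 + A) * S"
      using order_trans[OF p mult_left_mono[OF add_left_mono[OF An, of 1] S]] by (simp add: mult.commute)
    have L0: "0 \<le> ln n" using n by simp
    have Ln: "ln n \<le> n" using n ln_bound[of n] by simp
    have "ln (n + q) = ln n + ln (1 + q / n)"
      unfolding nq using n by (intro ln_mult_pos) (auto intro: add_pos_nonneg)
    hence l: "ln (n + q) \<le> ln n + q / n" using lnq by simp
    have l0: "0 \<le> ln (n + q)" using n by simp
    \<comment> \<open>The dangerous cross term A ln n / n stays bounded since ln n <= n. The excess
      is thus B n^\<sigma> with no logarithm left.\<close>
    have "(n + q) powr \<sigma> * ln (n + q) \<le> (S * (1 + A / n)) * (ln n + q / n)"
      using A n S by (intro mult_mono p l l0) auto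
    also have "\<dots> = S * (ln n + (q / n + A * (ln n / n) + A * (q / n) * (1 / n)))"
      using n by (simp add: field_simps)
    also have "\<dots> \<le> S * (ln n + (q + A * 1 + A * q * 1))"
    proof (intro mult_left_mono[OF _ S] add_mono order_refl qn mult_left_mono[OF _ A] mult_mono)
      show "ln n / n \<le> 1" "1 / n \<le> 1" using n Ln by auto
    qed (use n A qn in auto)
    finally have key: "(n + q) powr \<sigma> * ln (n + q) \<le> S * ln n + B * S" by (simp add: B_def algebra_simps)
    have M: "M_seq \<tau> \<sigma> (N + q) \<le> exp (\<tau> * B) powr S * M_seq \<tau> \<sigma> N"
    proof -
      have "M_seq \<tau> \<sigma> (N + q) = exp (\<tau> * ((n + q) powr \<sigma> * ln (n + q)))"
        using False n by (simp add: M_seq_def powr_def[of "real N + real q"] n_def mult_ac)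
      also have "\<dots> \<le> exp (\<tau> * (S * ln n + B * S))" using key \<tau> by simp
      also have "\<dots> = exp (\<tau> * B) powr S * M_seq \<tau> \<sigma> N"
      proof -
        have "M_seq \<tau> \<sigma> N = n powr (\<tau> * S)" using False by (simp add: M_seq_def n_def S_def)
        also have "\<dots> = exp (\<tau> * S * ln n)" using n by (simp add: powr_def)
        finally show ?thesis by (simp add: powr_def mult_exp_exp algebra_simps)
      qed
      finally show ?thesis .
    qed
    have "C powr ((n + q) powr \<sigma>) \<le> C1 powr ((n + q) powr \<sigma>)"
      using C by (intro powr_mono2) (auto simp: C1_def)
    also have "\<dots> \<le> C1 powr ((1 + A) * S)" using p2 by (intro powr_mono) (auto simp: C1_def)
    also have "\<dots> = (C1 powr (1 + A)) powr S" by (simp add: powr_powr)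
    finally have "gevrey \<tau> \<sigma> C (N + q) \<le> (C1 powr (1 + A)) powr S * (exp (\<tau> * B) powr S * M_seq \<tau> \<sigma> N)"
      unfolding gevrey_def using M by (intro mult_mono) (auto simp: n_def less_imp_le[OF M_seq_pos])
    also have "\<dots> = gevrey \<tau> \<sigma> D N"
      by (simp add: gevrey_def D_def powr_mult S_def n_def)
    also have "\<dots> \<le> c * gevrey \<tau> \<sigma> D N"
      using gevrey_pos[OF D, of \<tau> \<sigma> N] by (simp add: c_def mult_le_cancel_right1)
    finally show ?thesis .
  qed
  moreover have "c > 0" by (simp add: c_def)
  ultimately show thesis using D that by blast
qed

section \<open>A smooth representative of the window\<close>

lemma ex_count_list: "\<exists>is. \<forall>i. count_list is i = (\<alpha> :: nat ^ 'n::finite) $ i"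
proof -
  have "\<exists>is. \<forall>i. count_list is i = (if i \<in> A then \<alpha> $ i else 0)" if "finite A" for A
    using that
  proof (induction A rule: finite_induct)
    case empty
    show ?case by (rule exI[of _ "[]"]) simp
  next
    case (insert a A)
    then obtain "is" where "\<forall>i. count_list is i = (if i \<in> A then \<alpha> $ i else 0)" by blast
    moreover have "count_list (replicate k a) i = (if i = a then k else 0)" for k i
      by (induction k) auto
    ultimately have "\<forall>i. count_list (replicate (\<alpha> $ a) a @ is) i = (if i \<in> insert a A then \<alpha> $ i else 0)"
      using insert.hyps by (auto simp: count_list_append)
    thus ?case by blast
  qed
  from this[OF finite_class.finite_UNIV] show ?thesis by simp
qed

text \<open>Names the choice made inside \<open>mi_deriv\<close>. Only the counts of this list are
  known, not its order.\<close>

definition mi_list :: "nat ^ 'n::finite \<Rightarrow> 'n list" where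
  "mi_list \<alpha> = (SOME is. \<forall>i. count_list is i = \<alpha> $ i)"

lemma count_mi_list: "count_list (mi_list \<alpha>) i = \<alpha> $ i"
  unfolding mi_list_def using someI_ex[OF ex_count_list[of \<alpha>]] by blast

lemma length_mi_list: "length (mi_list \<alpha>) = mi_length \<alpha>"
  using sum_count_set[of "mi_list \<alpha>" UNIV] by (simp add: mi_length_def count_mi_list)

lemma mi_deriv_eq: "mi_deriv \<alpha> f = iter_deriv (mi_list \<alpha>) f"
  by (simp add: mi_deriv_def mi_list_def)

definition list_mi :: "'n::finite list \<Rightarrow> nat ^ 'n" where
  "list_mi is = (\<chi> i. count_list is i)"

lemma count_mi_list_list_mi: "count_list (mi_list (list_mi is)) i = count_list is i"
  by (simp add: count_mi_list list_mi_def)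

lemma mi_length_list_mi: "mi_length (list_mi is) = length is"
  using sum_count_set[of "is" UNIV] by (simp add: mi_length_def list_mi_def)

lemma mi_list_list_mi_Nil: "mi_list (list_mi []) = []"
  using length_mi_list[of "list_mi []"] by (simp add: mi_length_list_mi)

text \<open>A list whose letters are all equal has only one order. For pure derivatives the
  hypothesis on \<open>mi_deriv\<close> therefore applies without any symmetry of mixed
  derivatives.\<close>

lemma mi_list_list_mi_replicate: "mi_list (list_mi (replicate N i)) = replicate N i"
proof (rule replicate_eqI)
  let ?is = "mi_list (list_mi (replicate N i))"
  show "length ?is = N" by (simp add: length_mi_list mi_length_list_mi)
  fix j assume "j \<in> set ?is"
  hence "count_list ?is j \<noteq> 0" by (simp add: count_list_0_iff)
  hence "j \<in> set (replicate N i)" unfolding count_mi_list_list_mi by (simp only: count_list_0_iff not_not simp_thms)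
  thus "j = i" by simp
qed

lemma iter_deriv_append: "iter_deriv (as @ bs) f = iter_deriv as (iter_deriv bs f)"
  by (induction as) auto

lemma ex_norm_le_component: "\<exists>i. norm (\<omega> :: real ^ 'n::finite) \<le> CARD('n) * \<bar>\<omega> $ i\<bar>"
proof (rule ccontr)
  assume "\<not> ?thesis"
  hence "\<And>i. CARD('n) * \<bar>\<omega> $ i\<bar> < norm \<omega>" by (auto simp: not_le)
  hence "(\<Sum>i\<in>(UNIV::'n set). CARD('n) * \<bar>\<omega> $ i\<bar>) < (\<Sum>i\<in>(UNIV::'n set). norm \<omega>)"
    by (intro sum_strict_mono) auto
  hence "(\<Sum>i\<in>UNIV. \<bar>\<omega> $ i\<bar>) < norm \<omega>" by (simp flip: sum_distrib_left)
  thus False using norm_le_l1_cart[of \<omega>] by simp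
qed

text \<open>Some coordinate satisfies |\<omega>| <= d |\<omega>_i|. Which one depends on \<omega>,
  so the sum over all coordinates gives a uniform statement.\<close>

lemma norm_power_le_sum_deriv_symbol:
  fixes \<omega> :: "real ^ 'n::finite" and N :: nat
  assumes a: "a \<ge> 0"
  shows "norm \<omega> ^ N * a \<le> real CARD('n) ^ N * (\<Sum>i\<in>UNIV. norm (deriv_symbol (replicate N i) \<omega>) * a)"
proof -
  obtain i where i: "norm \<omega> \<le> CARD('n) * \<bar>\<omega> $ i\<bar>" using ex_norm_le_component[of \<omega>] by blast
  have s: "norm (deriv_symbol (replicate N i) \<omega>) = (2 * pi * \<bar>\<omega> $ i\<bar>) ^ N"
    by (induction N) (auto simp: norm_mult)
  have "1 * \<bar>\<omega> $ i\<bar> \<le> 2 * pi * \<bar>\<omega> $ i\<bar>" using pi_gt3 by (intro mult_right_mono) auto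
  hence "\<bar>\<omega> $ i\<bar> ^ N \<le> norm (deriv_symbol (replicate N i) \<omega>)" unfolding s by (intro power_mono) auto
  moreover have "norm \<omega> ^ N \<le> (CARD('n) * \<bar>\<omega> $ i\<bar>) ^ N" using i by (intro power_mono) auto
  ultimately have "norm \<omega> ^ N \<le> real CARD('n) ^ N * norm (deriv_symbol (replicate N i) \<omega>)"
    by (smt (verit, best) mult_left_mono of_nat_0_le_iff power_mult_distrib zero_le_power)
  hence "norm \<omega> ^ N * a \<le> real CARD('n) ^ N * (norm (deriv_symbol (replicate N i) \<omega>) * a)"
    using mult_right_mono[OF _ a] by (simp flip: mult.assoc)
  also have "\<dots> \<le> real CARD('n) ^ N * (\<Sum>i\<in>UNIV. norm (deriv_symbol (replicate N i) \<omega>) * a)"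
    using a by (intro mult_left_mono member_le_sum) auto
  finally show ?thesis .
qed

text \<open>By evenness 1 = v(0) <= v(z)^2. Consequently the weighted L^1 bounds on the window also
  give plain integrability.\<close>

lemma submultiplicative_ge_1:
  assumes "submultiplicative_weight v" shows "v z \<ge> 1"
proof -
  have v: "0 < v z" "v (- z) = v z" "v 0 = 1"
    using assms by (auto simp: submultiplicative_weight_def)
  have "v (z + - z) \<le> v z * v (- z)"
    using assms unfolding submultiplicative_weight_def by blast
  hence "1 \<le> v z * v z" using v by simp
  moreover have "v z * v z < 1 * 1" if "v z < 1" using that v(1) by (intro mult_strict_mono) auto
  ultimately show ?thesis by force
qed

text \<open>The Fourier kernel is not a test function; it is the limit of Gaussians whose width
  tends to infinity, and dominated convergence carries the weak identity over to it.\<close>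

lemma fourier_weak_partial:
  fixes G G' :: "real ^ 'n::finite \<Rightarrow> complex"
  assumes G: "integrable lborel G" and G': "integrable lborel G'"
    and weak: "\<And>s \<eta>. s > 0 \<Longrightarrow> (LINT t|lborel. G' t * gauss s 0 \<eta> t) = - (LINT t|lborel. G t * dgauss i s 0 \<eta> t)"
  shows "fourier G' \<omega> = 2 * pi * \<i> * of_real (\<omega> $ i) * fourier G \<omega>"
proof -
  have [measurable]: "G \<in> borel_measurable borel" "G' \<in> borel_measurable borel" using G G' by auto
  define s where "s n = real (Suc n)" for n
  have s: "s n \<ge> 1" "s n > 0" for n by (auto simp: s_def)
  have [measurable]: "gauss (s n) 0 \<omega> \<in> borel_measurable borel" "dgauss i (s n) 0 \<omega> \<in> borel_measurable borel" for n
    by (intro borel_measurable_continuous_onI continuous_gauss continuous_dgauss)+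
  have mc[measurable]: "(\<lambda>t. cis (- 2 * pi * (t \<bullet> \<omega>))) \<in> borel_measurable borel"
    "(\<lambda>t. cis (- (2 * pi * (t \<bullet> \<omega>)))) \<in> borel_measurable borel"
    by (intro borel_measurable_continuous_onI continuous_intros)+
  have l0: "(\<lambda>n. a / (s n)\<^sup>2) \<longlonglongrightarrow> 0" for a
  proof -
    have "(\<lambda>n. a * (inverse (s n) * inverse (s n))) \<longlonglongrightarrow> a * (0 * 0)"
      unfolding s_def by (intro tendsto_intros LIMSEQ_inverse_real_of_nat)
    thus ?thesis by (simp add: divide_inverse power2_eq_square)
  qed
  have lg: "(\<lambda>n. gauss (s n) 0 \<omega> t) \<longlonglongrightarrow> cis (- 2 * pi * (t \<bullet> \<omega>))" for t
  proof -
    have "(\<lambda>n. of_real (exp ((- pi * (norm (t - 0))\<^sup>2) / (s n)\<^sup>2)) * cis (- 2 * pi * (t \<bullet> \<omega>))) \<longlonglongrightarrow> of_real (exp 0) * cis (- 2 * pi * (t \<bullet> \<omega>))"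
      by (intro tendsto_mult tendsto_of_real tendsto_exp l0 tendsto_const)
    thus ?thesis by (simp add: gauss_def)
  qed
  have ld: "(\<lambda>n. dgauss i (s n) 0 \<omega> t) \<longlonglongrightarrow> (of_real 0 - 2 * pi * \<i> * of_real (\<omega> $ i)) * cis (- 2 * pi * (t \<bullet> \<omega>))" for t
    unfolding dgauss_def by (intro tendsto_mult[OF tendsto_diff lg] tendsto_of_real l0 tendsto_const)
  have bg: "norm (gauss (s n) 0 \<omega> t) \<le> 1" for n t by (simp add: norm_gauss)
  \<comment> \<open>A bound uniform in n: for r = |t| / s and s >= 1, the factor |t_i| / s^2 is at
    most r <= 1 + pi r^2 <= exp (pi r^2), which cancels the Gaussian.\<close>
  have bd: "norm (dgauss i (s n) 0 \<omega> t) \<le> 2 * pi + 2 * pi * \<bar>\<omega> $ i\<bar>" for n t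
  proof -
    let ?r = "norm t / s n"
    have "\<bar>t $ i\<bar> / (s n)\<^sup>2 \<le> norm t / (s n * 1)"
      using component_le_norm_cart[of t i] s[of n] unfolding power2_eq_square
      by (intro frac_le mult_left_mono) auto
    also have "\<dots> \<le> exp (pi * ?r\<^sup>2)"
    proof -
      have "0 \<le> (?r - 1)\<^sup>2" by simp
      hence "2 * ?r \<le> 1 + ?r\<^sup>2" by (simp add: power2_diff)
      moreover have "?r \<ge> 0" using s[of n] by simp
      moreover have "1 * ?r\<^sup>2 \<le> pi * ?r\<^sup>2" using pi_gt3 by (intro mult_right_mono) auto
      ultimately have "?r \<le> 1 + pi * ?r\<^sup>2" by linarith
      also have "\<dots> \<le> exp (pi * ?r\<^sup>2)" by (rule exp_ge_add_one_self)
      finally show ?thesis by simp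
    qed
    finally have r: "\<bar>t $ i\<bar> / (s n)\<^sup>2 \<le> exp (pi * ?r\<^sup>2)" .
    have ng: "norm (gauss (s n) 0 \<omega> t) = exp (- (pi * ?r\<^sup>2))" by (simp add: norm_gauss power_divide)
    have "\<bar>t $ i\<bar> / (s n)\<^sup>2 * norm (gauss (s n) 0 \<omega> t) \<le> exp (pi * ?r\<^sup>2) * exp (- (pi * ?r\<^sup>2))"
      unfolding ng by (intro mult_right_mono r) auto
    hence r1: "\<bar>t $ i\<bar> / (s n)\<^sup>2 * norm (gauss (s n) 0 \<omega> t) \<le> 1" by (simp add: mult_exp_exp)
    have "norm (complex_of_real (- 2 * pi * (t $ i - 0 $ i) / (s n)\<^sup>2) - 2 * pi * \<i> * of_real (\<omega> $ i)) \<le> 2 * pi * (\<bar>t $ i\<bar> / (s n)\<^sup>2) + 2 * pi * \<bar>\<omega> $ i\<bar>"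
      by (rule order_trans[OF norm_triangle_ineq4]) (simp add: norm_mult norm_divide norm_power abs_mult del: of_real_diff of_real_mult of_real_divide)
    hence "norm (dgauss i (s n) 0 \<omega> t) \<le> (2 * pi * (\<bar>t $ i\<bar> / (s n)\<^sup>2) + 2 * pi * \<bar>\<omega> $ i\<bar>) * norm (gauss (s n) 0 \<omega> t)"
      unfolding dgauss_def norm_mult by (intro mult_right_mono) auto
    also have "\<dots> = 2 * pi * (\<bar>t $ i\<bar> / (s n)\<^sup>2 * norm (gauss (s n) 0 \<omega> t)) + 2 * pi * \<bar>\<omega> $ i\<bar> * norm (gauss (s n) 0 \<omega> t)"
      by (simp add: algebra_simps)
    also have "\<dots> \<le> 2 * pi * 1 + 2 * pi * \<bar>\<omega> $ i\<bar> * 1"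
      by (intro add_mono mult_left_mono r1 bg) auto
    finally show ?thesis by simp
  qed
  have L1: "(\<lambda>n. LINT t|lborel. G' t * gauss (s n) 0 \<omega> t) \<longlonglongrightarrow> (LINT t|lborel. G' t * cis (- 2 * pi * (t \<bullet> \<omega>)))"
  proof (rule integral_dominated_convergence[where w="\<lambda>t. norm (G' t)"])
    show "AE t in lborel. (\<lambda>n. G' t * gauss (s n) 0 \<omega> t) \<longlonglongrightarrow> G' t * cis (- 2 * pi * (t \<bullet> \<omega>))"
      by (intro AE_I2 tendsto_mult tendsto_const lg)
    show "AE t in lborel. norm (G' t * gauss (s n) 0 \<omega> t) \<le> norm (G' t)" for n
      by (intro AE_I2) (simp add: norm_mult mult_left_le bg)
  qed (use G' in auto)
  have L2: "(\<lambda>n. LINT t|lborel. G t * dgauss i (s n) 0 \<omega> t) \<longlonglongrightarrow> (LINT t|lborel. G t * ((of_real 0 - 2 * pi * \<i> * of_real (\<omega> $ i)) * cis (- 2 * pi * (t \<bullet> \<omega>))))"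
  proof (rule integral_dominated_convergence[where w="\<lambda>t. norm (G t) * (2 * pi + 2 * pi * \<bar>\<omega> $ i\<bar>)"])
    show "AE t in lborel. (\<lambda>n. G t * dgauss i (s n) 0 \<omega> t) \<longlonglongrightarrow> G t * ((of_real 0 - 2 * pi * \<i> * of_real (\<omega> $ i)) * cis (- 2 * pi * (t \<bullet> \<omega>)))"
      by (intro AE_I2 tendsto_mult tendsto_const ld)
    show "AE t in lborel. norm (G t * dgauss i (s n) 0 \<omega> t) \<le> norm (G t) * (2 * pi + 2 * pi * \<bar>\<omega> $ i\<bar>)" for n
      unfolding norm_mult by (intro AE_I2 mult_left_mono bd) auto
  qed (use G in auto)
  have "fourier G' \<omega> = - (LINT t|lborel. G t * ((of_real 0 - 2 * pi * \<i> * of_real (\<omega> $ i)) * cis (- 2 * pi * (t \<bullet> \<omega>))))"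
    unfolding fourier_def using LIMSEQ_unique[OF L1 tendsto_minus[OF L2, folded weak[OF s(2)]]] by simp
  also have "\<dots> = - (LINT t|lborel. - (2 * pi * \<i> * of_real (\<omega> $ i)) * (G t * cis (- 2 * pi * (t \<bullet> \<omega>))))"
    by (simp add: mult_ac)
  also have "\<dots> = 2 * pi * \<i> * of_real (\<omega> $ i) * fourier G \<omega>"
    unfolding integral_mult_right_zero fourier_def by simp
  finally show ?thesis .
qed

text \<open>Gaussians lie in \<open>S1\<close>, and tests against them determine a function almost
  everywhere.\<close>

lemma represents_unique:
  assumes "represents F u" "represents G w" and uw: "\<And>\<phi>. \<phi> \<in> S1 \<Longrightarrow> u \<phi> = w \<phi>"
  shows "AE t in lborel. F t = G t"
proof -
  have "AE t in lborel. F t - G t = 0"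
  proof (rule test_gauss_eq_0)
    fix s :: real and y :: "real^'a" assume s: "s > 0"
    have F: "integrable lborel (\<lambda>t. F t * gauss s y 0 t)" "u (gauss s y 0) = (LINT t|lborel. F t * gauss s y 0 t)"
      and G: "integrable lborel (\<lambda>t. G t * gauss s y 0 t)" "w (gauss s y 0) = (LINT t|lborel. G t * gauss s y 0 t)"
      using assms(1,2) gauss_S1[OF s, of y 0] by (auto simp: represents_def)
    show "integrable lborel (\<lambda>t. (F t - G t) * gauss s y 0 t)" using F G by (simp add: left_diff_distrib)
    show "(LINT t|lborel. (F t - G t) * gauss s y 0 t) = 0"
      using F G uw[OF gauss_S1[OF s, of y 0]] by (simp add: left_diff_distrib)
  qed
  thus ?thesis by simp
qed

lemma L1_norm_leD:
  fixes v :: "real ^ 'n::finite \<Rightarrow> real"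
  assumes m: "G \<in> borel_measurable lborel" "v \<in> borel_measurable borel" and v: "\<And>z. v z \<ge> 1"
    and b: "L1_norm v G \<le> ennreal B" and B: "B \<ge> 0"
  shows "integrable lborel (\<lambda>x. norm (G x) * v x)" "(LINT x|lborel. norm (G x) * v x) \<le> B"
    and "integrable lborel G"
proof -
  have v0: "0 \<le> v z" for z using v[of z] by simp
  have "L1_norm v G < \<infinity>" using b by (simp add: order_le_less_trans)
  thus 1: "integrable lborel (\<lambda>x. norm (G x) * v x)"
    unfolding L1_norm_def using m v0 by (intro integrableI_nonneg) auto
  have "ennreal (LINT x|lborel. norm (G x) * v x) = L1_norm v G"
    unfolding L1_norm_def using nn_integral_eq_integral[OF 1] v0 by simp
  thus "(LINT x|lborel. norm (G x) * v x) \<le> B" using b B by (metis ennreal_le_iff)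
  show "integrable lborel G"
    by (rule Bochner_Integration.integrable_bound[OF 1 m(1)])
      (use v in \<open>auto simp: v0 mult_le_cancel_left1 intro!: AE_I2\<close>)
qed

text \<open>All that the estimates use of the window, detached from \<open>g\<close> and the
  functional \<open>u\<close>. Boundedness of the derivatives is listed besides the weighted L^1
  bounds because products of two derivatives of \<gamma> must be integrable.\<close>

locale stft_window =
  fixes \<tau> \<sigma> Cv cv Cm :: real and v m :: "real ^ 'n::finite \<Rightarrow> real" and \<gamma> :: "real ^ 'n \<Rightarrow> complex"
  assumes \<tau>: "\<tau> > 0" and \<sigma>: "\<sigma> \<ge> 1"
    and v_ge_1: "\<And>z. v z \<ge> 1" and v_even: "\<And>z. v (- z) = v z" and v_cont: "continuous_on UNIV v"
    and m_pos: "\<And>z. m z > 0" and Cm: "Cm > 0" and moderate: "\<And>z1 z2. m (z1 + z2) \<le> Cm * v z1 * m z2"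
    and \<gamma>: "psmooth \<gamma>" and Cv: "Cv > 0" and cv: "cv > 0"
    and \<gamma>_bounded: "\<And>is. \<exists>B. \<forall>x. norm (iter_deriv is \<gamma> x) \<le> B"
    and \<gamma>_integrable: "\<And>is. integrable lborel (\<lambda>x. norm (iter_deriv is \<gamma> x) * v x)"
    and \<gamma>_L1: "\<And>is. (LINT x|lborel. norm (iter_deriv is \<gamma> x) * v x) \<le> cv * gevrey \<tau> \<sigma> Cv (length is)"
    and \<gamma>_nonzero: "\<exists>z. \<gamma> z \<noteq> 0"

lemma smooth_window:
  fixes v m :: "real ^ 'n::finite \<Rightarrow> real" and g :: "real ^ 'n \<Rightarrow> complex"
  assumes \<tau>: "\<tau> > 0" and \<sigma>: "\<sigma> \<ge> 1"
    and v: "submultiplicative_weight v" and m: "moderate_weight v m"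
    and u0: "\<exists>\<phi>\<in>S1. u \<phi> \<noteq> 0" and g: "represents g u"
    and hyp: "\<exists>C>0. \<exists>c>0. \<forall>\<alpha>. \<exists>G. represents G (dual_deriv \<alpha> u) \<and>
           L1_norm v G \<le> ennreal (c * (C powr (real (mi_length \<alpha>) powr \<sigma>) * M_seq \<tau> \<sigma> (mi_length \<alpha>)))"
  obtains \<gamma> Cv cv Cm where "stft_window \<tau> \<sigma> Cv cv Cm v m \<gamma>" "AE t in lborel. g t = \<gamma> t"
proof -
  obtain Cm where Cm: "Cm > 0" "\<And>z1 z2. m (z1 + z2) \<le> Cm * v z1 * m z2"
    using m by (auto simp: moderate_weight_def)
  obtain C c where C: "C > 0" "c > 0" and hyp': "\<forall>\<alpha>. \<exists>G. represents G (dual_deriv \<alpha> u) \<and>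
           L1_norm v G \<le> ennreal (c * gevrey \<tau> \<sigma> C (mi_length \<alpha>))"
    using hyp unfolding gevrey_def by blast
  from choice[OF hyp'] obtain G where G: "\<And>\<alpha>. represents (G \<alpha>) (dual_deriv \<alpha> u)"
    "\<And>\<alpha>. L1_norm v (G \<alpha>) \<le> ennreal (c * gevrey \<tau> \<sigma> C (mi_length \<alpha>))" by blast
  have v1: "v z \<ge> 1" for z by (rule submultiplicative_ge_1[OF v])
  have vc: "continuous_on UNIV v" and ve: "v (- z) = v z" for z using v by (auto simp: submultiplicative_weight_def)
  have [measurable]: "v \<in> borel_measurable borel" by (rule borel_measurable_continuous_onI[OF vc])
  \<comment> \<open>Representatives of the weak derivatives, reindexed by lists so that one more
    derivative is one more letter.\<close>
  define H where "H is = G (list_mi is)" for "is"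
  have Hm: "H is \<in> borel_measurable lborel" for "is" using G(1) by (auto simp: H_def represents_def)
  have "0 \<le> c * gevrey \<tau> \<sigma> C (length is)" for "is" :: "'n list"
    using C gevrey_pos[OF C(1), of \<tau> \<sigma> "length is"] by simp
  note H = L1_norm_leD[OF Hm _ v1 G(2)[of "list_mi is" for "is", folded H_def, unfolded mi_length_list_mi] this]
  have H1: "integrable lborel (\<lambda>x. norm (H is x) * v x)" "(LINT x|lborel. norm (H is x) * v x) \<le> c * gevrey \<tau> \<sigma> C (length is)"
    "integrable lborel (H is)" for "is" using H by measurable
  have weak: "(LINT t|lborel. H (i # is) t * gauss s y \<eta> t) = - (LINT t|lborel. H is t * dgauss i s y \<eta> t)"
    if s: "s > 0" for i "is" s y \<eta>
  proof -
    \<comment> \<open>The order chosen for the longer multi-index need not extend the shorter one.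
      On a Gaussian the new letter may be moved to the end of the list, where it acts first and
      turns the Gaussian into \<open>dgauss\<close>.\<close>
    have "iter_deriv (mi_list (list_mi (i # is))) (gauss s y \<eta>) = iter_deriv (mi_list (list_mi is) @ [i]) (gauss s y \<eta>)"
      by (rule iter_deriv_gauss_cong) (simp add: count_mi_list_list_mi count_list_append)
    hence e: "mi_deriv (list_mi (i # is)) (gauss s y \<eta>) = mi_deriv (list_mi is) (dgauss i s y \<eta>)"
      by (simp add: mi_deriv_eq iter_deriv_append partial_deriv_gauss)
    have "(LINT t|lborel. H (i # is) t * gauss s y \<eta> t) = dual_deriv (list_mi (i # is)) u (gauss s y \<eta>)"
      using G(1)[of "list_mi (i # is)"] gauss_S1[OF s, of y \<eta>] by (auto simp: represents_def H_def)
    also have "\<dots> = - dual_deriv (list_mi is) u (dgauss i s y \<eta>)"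
      by (simp add: dual_deriv_def e mi_length_list_mi)
    also have "dual_deriv (list_mi is) u (dgauss i s y \<eta>) = (LINT t|lborel. H is t * dgauss i s y \<eta> t)"
      using G(1)[of "list_mi is"] dgauss_S1[OF s, of i y \<eta>] by (auto simp: represents_def H_def)
    finally show ?thesis .
  qed
  define K where "K = fourier (H [])"
  have FH: "fourier (H is) \<omega> = deriv_symbol is \<omega> * K \<omega>" for "is" \<omega>
  proof (induction "is")
    case (Cons i "is")
    have "fourier (H (i # is)) \<omega> = 2 * pi * \<i> * of_real (\<omega> $ i) * fourier (H is) \<omega>"
      by (rule fourier_weak_partial[OF H1(3) H1(3) weak])
    thus ?case by (simp add: Cons)
  qed (simp add: K_def)
  have K: "rapid K"
    unfolding rapid_def
  proof (intro conjI allI exI)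
    show "K \<in> borel_measurable borel"
      unfolding K_def by (intro borel_measurable_continuous_onI continuous_fourier H1)
    fix N \<omega>
    have "norm \<omega> ^ N * norm (K \<omega>) \<le> real CARD('n) ^ N * (\<Sum>i\<in>UNIV. norm (deriv_symbol (replicate N i) \<omega>) * norm (K \<omega>))"
      by (rule norm_power_le_sum_deriv_symbol) simp
    also have "\<dots> \<le> real CARD('n) ^ N * (\<Sum>i\<in>UNIV. LINT t|lborel. norm (H (replicate N i) t))"
      by (intro mult_left_mono sum_mono) (auto simp: norm_mult[symmetric] FH[symmetric] norm_fourier_le)
    finally show "norm \<omega> ^ N * norm (K \<omega>) \<le> real CARD('n) ^ N * (\<Sum>i\<in>UNIV. LINT t|lborel. norm (H (replicate N i) t))" .
  qed
  define \<gamma> where "\<gamma> = ifourier K"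
  have ps: "psmooth \<gamma>" unfolding \<gamma>_def by (rule psmooth_ifourier[OF K])
  \<comment> \<open>Inversion applied to every weak derivative separately identifies it with the
    classical derivative of \<gamma>, so the weighted L^1 bounds carry over.\<close>
  have ae: "AE t in lborel. H is t = iter_deriv is \<gamma> t" for "is"
  proof -
    have "fourier (H is) = (\<lambda>\<omega>. deriv_symbol is \<omega> * K \<omega>)" by (intro ext FH)
    moreover have "integrable lborel (fourier (H is))"
      unfolding calculation by (intro rapid_integrable rapid_deriv_symbol K)
    ultimately show ?thesis using fourier_inversion[OF H1(3)[of "is"]]
      by (simp add: \<gamma>_def iter_deriv_ifourier[OF K])
  qed
  have "AE t in lborel. g t = H [] t"
    unfolding H_def by (rule represents_unique[OF g G(1)[of "list_mi []"]])
      (simp add: dual_deriv_def mi_deriv_eq mi_list_list_mi_Nil mi_length_list_mi)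
  with ae[of "[]"] have g\<gamma>: "AE t in lborel. g t = \<gamma> t" by eventually_elim simp
  have dm: "iter_deriv is \<gamma> \<in> borel_measurable borel" for "is"
    by (intro borel_measurable_continuous_onI psmooth_continuous ps)
  have ae': "AE x in lborel. norm (H is x) * v x = norm (iter_deriv is \<gamma> x) * v x" for "is"
    using ae[of "is"] by eventually_elim simp
  have "stft_window \<tau> \<sigma> C c Cm v m \<gamma>"
  proof
    fix "is" :: "'n list"
    show "integrable lborel (\<lambda>x. norm (iter_deriv is \<gamma> x) * v x)"
      by (rule integrable_cong_AE_imp[OF H1(1)[of "is"]]) (use dm ae'[of "is"] in auto)
    have "(LINT x|lborel. norm (iter_deriv is \<gamma> x) * v x) = (LINT x|lborel. norm (H is x) * v x)"
      by (rule integral_cong_AE) (use dm Hm ae'[of "is"] in auto)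
    thus "(LINT x|lborel. norm (iter_deriv is \<gamma> x) * v x) \<le> c * gevrey \<tau> \<sigma> C (length is)" using H1(2) by simp
    show "\<exists>B. \<forall>x. norm (iter_deriv is \<gamma> x) \<le> B"
      unfolding \<gamma>_def using norm_iter_deriv_ifourier_le[OF K] by blast
  next
    \<comment> \<open>If \<gamma> vanished, \<open>g\<close> would vanish almost everywhere and the
      functional \<open>u\<close> on all of \<open>S1\<close>.\<close>
    show "\<exists>z. \<gamma> z \<noteq> 0"
    proof (rule ccontr)
      assume "\<not> ?thesis"
      hence g0: "AE t in lborel. g t = 0" using g\<gamma> by simp
      obtain \<phi> where \<phi>: "\<phi> \<in> S1" "u \<phi> \<noteq> 0" using u0 by blast
      have "u \<phi> = (LINT t|lborel. g t * \<phi> t)" using g \<phi> by (auto simp: represents_def)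
      also have "\<dots> = 0" by (rule integral_eq_zero_AE) (use g0 in auto)
      finally show False using \<phi> by simp
    qed
  qed (use \<tau> \<sigma> v1 ve vc Cm C ps m in \<open>auto simp: moderate_weight_def\<close>)
  thus thesis using g\<gamma> that by blast
qed

section \<open>Short-time Fourier transform estimates\<close>

lemma integral_sum_list:
  fixes F :: "'p \<Rightarrow> 'a \<Rightarrow> 'b::{banach, second_countable_topology}"
  assumes "\<And>p. p \<in> set ps \<Longrightarrow> integrable M (F p)"
  shows "integrable M (\<lambda>x. \<Sum>p\<leftarrow>ps. F p x)" and "(LINT x|M. (\<Sum>p\<leftarrow>ps. F p x)) = (\<Sum>p\<leftarrow>ps. LINT x|M. F p x)"
proof -
  have "integrable M (\<lambda>x. \<Sum>p\<leftarrow>ps. F p x) \<and> (LINT x|M. (\<Sum>p\<leftarrow>ps. F p x)) = (\<Sum>p\<leftarrow>ps. LINT x|M. F p x)"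
    using assms by (induction ps) auto
  thus "integrable M (\<lambda>x. \<Sum>p\<leftarrow>ps. F p x)" "(LINT x|M. (\<Sum>p\<leftarrow>ps. F p x)) = (\<Sum>p\<leftarrow>ps. LINT x|M. F p x)"
    by auto
qed

lemma norm_sum_list_le:
  fixes F :: "'p \<Rightarrow> 'b::real_normed_vector"
  assumes "\<And>p. p \<in> set ps \<Longrightarrow> norm (F p) \<le> B p"
  shows "norm (\<Sum>p\<leftarrow>ps. F p) \<le> (\<Sum>p\<leftarrow>ps. B p)"
  using assms by (induction ps) (auto intro: norm_triangle_mono)

lemma sum_list_le_length:
  fixes F :: "'p \<Rightarrow> real"
  assumes "\<And>p. p \<in> set ps \<Longrightarrow> F p \<le> b"
  shows "(\<Sum>p\<leftarrow>ps. F p) \<le> real (length ps) * b"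
  using assms by (induction ps) (auto simp: algebra_simps intro: add_mono)

lemma splits_subset: "(as, bs) \<in> set (splits is) \<Longrightarrow> set as \<subseteq> set is \<and> set bs \<subseteq> set is"
  by (induction "is" arbitrary: as bs) (auto, blast+)

text \<open>Exactly one split sends every letter to the left. This selects the surviving Leibniz
  term once the derivatives of |\<gamma>|^2 have integrated to zero.\<close>

lemma sum_splits_right_Nil:
  fixes A :: "'a list \<Rightarrow> 'b::comm_monoid_add"
  shows "(\<Sum>(as, bs)\<leftarrow>splits is. if bs = [] then A as else 0) = A is"
proof (induction "is" arbitrary: A)
  case (Cons i "is")
  have "(\<Sum>(as, bs)\<leftarrow>splits (i # is). if bs = [] then A as else 0) = (\<Sum>(as, bs)\<leftarrow>splits is. if bs = [] then A (i # as) else 0)"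
    by (subst sum_list_splits_Cons) simp
  thus ?case using Cons[of "\<lambda>as. A (i # as)"] by simp
qed simp

text \<open>The coincidence set is closed and has full measure, hence is the whole space.\<close>

lemma AE_eq_continuous:
  fixes F G :: "'a::euclidean_space \<Rightarrow> 'b::real_normed_vector"
  assumes "continuous_on UNIV F" "continuous_on UNIV G" "AE x in lborel. F x = G x"
  shows "F = G"
proof
  fix x
  have "closed {x. F x = G x}" using assms(1,2) by (rule closed_Collect_eq)
  moreover have "AE x in lebesgue. x \<in> {x. F x = G x}" using AE_completion[OF assms(3)] by simp
  ultimately have "x \<in> {x. F x = G x}" by (rule mem_closed_if_AE_lebesgue)
  thus "F x = G x" by simp
qed

lemma AE_lborel_shift:
  fixes x :: "'a::euclidean_space"
  assumes "AE t in lborel. Q t" and "Measurable.pred borel Q"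
  shows "AE t in lborel. Q (t - x)"
proof -
  have "AE t in distr lborel borel ((+) (- x)). Q t" using assms(1) by (simp only: lborel_distr_plus)
  thus ?thesis using assms(2) by (subst (asm) AE_distr_iff) auto
qed

lemma stft_eq_fourier: "stft g f x \<xi> = fourier (\<lambda>t. f t * cnj (g (t - x))) \<xi>"
  unfolding stft_def stft_integrand_def fourier_def by (simp add: mult_ac)

text \<open>The kernel has modulus one, so integrability does not depend on \<xi>.\<close>

lemma stft_exists_iff: "stft_exists g f \<longleftrightarrow> (\<forall>x. integrable lborel (\<lambda>t. f t * cnj (g (t - x))))"
proof -
  have "integrable lborel (stft_integrand g f x \<xi>) \<longleftrightarrow> integrable lborel (\<lambda>t. f t * cnj (g (t - x)))" for x \<xi>
  proof
    assume "integrable lborel (stft_integrand g f x \<xi>)"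
    from integrable_mult_cis[OF this, of "2 * pi" \<xi>]
    moreover have "stft_integrand g f x \<xi> t * cis (2 * pi * (t \<bullet> \<xi>)) = f t * cnj (g (t - x))" for t
    proof -
      have "stft_integrand g f x \<xi> t * cis (2 * pi * (t \<bullet> \<xi>))
        = f t * cnj (g (t - x)) * (cis (- 2 * pi * (t \<bullet> \<xi>)) * cis (2 * pi * (t \<bullet> \<xi>)))"
        unfolding stft_integrand_def by (simp only: mult_ac)
      thus ?thesis unfolding cis_mult by simp
    qed
    ultimately show "integrable lborel (\<lambda>t. f t * cnj (g (t - x)))" by simp
  next
    assume "integrable lborel (\<lambda>t. f t * cnj (g (t - x)))"
    from integrable_mult_cis[OF this, of "- 2 * pi" \<xi>]
    show "integrable lborel (stft_integrand g f x \<xi>)"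
      by (simp add: stft_integrand_def[abs_def] mult_ac)
  qed
  thus ?thesis by (simp add: stft_exists_def)
qed

text \<open>Without boundedness the real supremum would say nothing about its terms. For p >= 1 the
  logarithm of a term is at most p^\<sigma> (L - \<tau> ln p), which is nonpositive as soon as p
  exceeds R = exp (L / \<tau>).\<close>

lemma assoc_fun_bdd:
  assumes "\<tau> > 0" "\<sigma> \<ge> 1" "h > 0" "k > 0"
  shows "bdd_above (range (\<lambda>p::nat. ln_plus (h powr (real p powr \<sigma>) * k ^ p / M_seq \<tau> \<sigma> p)))"
proof -
  define L where "L = \<bar>ln h\<bar> + \<bar>ln k\<bar>"
  define R where "R = exp (L / \<tau>)"
  have "ln_plus (h powr (real p powr \<sigma>) * k ^ p / M_seq \<tau> \<sigma> p) \<le> L * R powr \<sigma>" for p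
  proof (cases "p = 0")
    case True thus ?thesis by (simp add: ln_plus_def M_seq_def L_def)
  next
    case False
    define S where "S = real p powr \<sigma>"
    have pS: "real p \<le> S" using False assms powr_mono[of 1 \<sigma> "real p"] by (simp add: S_def)
    have S0: "S \<ge> 0" by (simp add: S_def)
    have "ln (h powr S * k ^ p / M_seq \<tau> \<sigma> p) = S * ln h + p * ln k - \<tau> * S * ln p"
      using False assms by (simp add: ln_div ln_mult ln_powr ln_realpow M_seq_def S_def)
    also have "\<dots> \<le> S * \<bar>ln h\<bar> + S * \<bar>ln k\<bar> - \<tau> * S * ln p"
      by (intro diff_right_mono add_mono mult_left_mono[OF abs_ge_self S0]
          order_trans[OF mult_left_mono[OF abs_ge_self] mult_right_mono[OF pS]]) auto
    also have "\<dots> = S * (L - \<tau> * ln p)" by (simp add: L_def algebra_simps)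
    also have "\<dots> \<le> L * R powr \<sigma>"
    proof (cases "real p \<le> R")
      case True
      have "S * (L - \<tau> * ln p) \<le> S * L" using S0 False assms by (intro mult_left_mono) auto
      also have "\<dots> \<le> R powr \<sigma> * L"
        unfolding S_def using True assms by (intro mult_right_mono powr_mono2) (auto simp: L_def)
      finally show ?thesis by (simp add: mult.commute)
    next
      case False
      hence "R < real p" by simp
      moreover have "0 < R" by (simp add: R_def)
      ultimately have "ln R < ln p" by (subst ln_less_cancel_iff) linarith+
      hence "L \<le> \<tau> * ln p" using assms by (simp add: R_def field_simps)
      hence "S * (L - \<tau> * ln p) \<le> 0" using S0 by (intro mult_nonneg_nonpos) auto
      also have "0 \<le> L * R powr \<sigma>" by (simp add: L_def)
      finally show ?thesis .
    qed
    finally show ?thesis by (simp add: ln_plus_def S_def L_def)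
  qed
  thus ?thesis by (rule bdd_aboveI2)
qed

text \<open>After taking logarithms, the hypothesis for all p bounds every term of the supremum by
  ln (B / V). The positive part in \<open>ln_plus\<close> is covered by p = 0, which gives V <= B;
  the values V = 0 and k = 0 are kept away from the logarithm.\<close>

lemma le_exp_assoc_fun:
  assumes C: "C > 0" and V: "V \<ge> 0" and k: "k \<ge> 0"
    and b: "\<And>p. k ^ p * V \<le> B * gevrey \<tau> \<sigma> C p"
  shows "V \<le> B * exp (- assoc_fun \<tau> \<sigma> (1 / C) k)"
proof (cases "V = 0 \<or> k = 0")
  case True
  have "V \<le> B" using b[of 0] C by (simp add: gevrey_0)
  thus ?thesis using True V by (auto simp: assoc_fun_def)
next
  case False
  hence V: "V > 0" and k: "k > 0" using assms by auto
  have VB: "V \<le> B" using b[of 0] C by (simp add: gevrey_0)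
  have B: "B > 0" using V VB by simp
  have "assoc_fun \<tau> \<sigma> (1 / C) k \<le> ln (B / V)"
    unfolding assoc_fun_def using k
  proof (simp, intro cSUP_least)
    fix p :: nat
    have g: "gevrey \<tau> \<sigma> C p > 0" by (rule gevrey_pos[OF C])
    have e: "(1 / C) powr (real p powr \<sigma>) * k ^ p / M_seq \<tau> \<sigma> p = k ^ p / gevrey \<tau> \<sigma> C p"
      using C by (simp add: gevrey_def powr_divide)
    have "k ^ p / gevrey \<tau> \<sigma> C p \<le> B / V" using b[of p] V g by (simp add: field_simps)
    hence "ln (k ^ p / gevrey \<tau> \<sigma> C p) \<le> ln (B / V)" using k g V B by (subst ln_le_cancel_iff) auto
    moreover have "0 \<le> ln (B / V)" using VB V by simp
    ultimately show "ln_plus ((1 / C) powr (real p powr \<sigma>) * k ^ p / M_seq \<tau> \<sigma> p) \<le> ln (B / V)"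
      unfolding e ln_plus_def by simp
  qed simp
  hence "exp (assoc_fun \<tau> \<sigma> (1 / C) k) \<le> exp (ln (B / V))" by simp
  also have "\<dots> = B / V" using B V by simp
  finally show ?thesis using V by (simp add: exp_minus field_simps)
qed

text \<open>A single term of the supremum is at most the supremum, and exponentiating recovers the
  bound for that p.\<close>

lemma exp_assoc_fun_le:
  assumes \<tau>: "\<tau> > 0" "\<sigma> \<ge> 1" and h: "h > 0" and k: "k \<ge> 0" and B: "B \<ge> 0"
    and b: "V \<le> B * exp (- assoc_fun \<tau> \<sigma> h k)"
  shows "k ^ p * V \<le> B * gevrey \<tau> \<sigma> (1 / h) p"
proof (cases "k = 0")
  case True
  show ?thesis
  \<comment> \<open>Since 0^0 = 1, the exponent p = 0 still claims V <= B, which holds because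
    \<open>assoc_fun\<close> is 0 at k = 0. For p > 0 the left side vanishes.\<close>
  proof (cases "p = 0")
    case True thus ?thesis using b \<open>k = 0\<close> h by (simp add: assoc_fun_def gevrey_0)
  next
    case False thus ?thesis using \<open>k = 0\<close> B h gevrey_pos[of "1 / h" \<tau> \<sigma> p] by (simp add: zero_power less_imp_le)
  qed
next
  case False
  hence k: "k > 0" using k by simp
  have g: "gevrey \<tau> \<sigma> (1 / h) p > 0" by (rule gevrey_pos) (use h in simp)
  have e: "h powr (real p powr \<sigma>) * k ^ p / M_seq \<tau> \<sigma> p = k ^ p / gevrey \<tau> \<sigma> (1 / h) p"
    using h by (simp add: gevrey_def powr_divide)
  have "ln (k ^ p / gevrey \<tau> \<sigma> (1 / h) p) \<le> ln_plus (h powr (real p powr \<sigma>) * k ^ p / M_seq \<tau> \<sigma> p)"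
    unfolding e ln_plus_def by simp
  also have "\<dots> \<le> assoc_fun \<tau> \<sigma> h k"
    unfolding assoc_fun_def using k cSUP_upper[OF _ assoc_fun_bdd[OF \<tau> h k], of p] by simp
  finally have "exp (ln (k ^ p / gevrey \<tau> \<sigma> (1 / h) p)) \<le> exp (assoc_fun \<tau> \<sigma> h k)" by simp
  hence le: "k ^ p \<le> gevrey \<tau> \<sigma> (1 / h) p * exp (assoc_fun \<tau> \<sigma> h k)" using k g by (simp add: field_simps)
  have "k ^ p * V \<le> k ^ p * (B * exp (- assoc_fun \<tau> \<sigma> h k))" using k by (intro mult_left_mono b) auto
  also have "\<dots> \<le> (gevrey \<tau> \<sigma> (1 / h) p * exp (assoc_fun \<tau> \<sigma> h k)) * (B * exp (- assoc_fun \<tau> \<sigma> h k))"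
    using B by (intro mult_right_mono le) auto
  also have "\<dots> = B * gevrey \<tau> \<sigma> (1 / h) p" by (simp add: exp_minus)
  finally show ?thesis .
qed

section \<open>Growth of f against decay of the transform for a smooth window\<close>

context stft_window
begin

abbreviation E :: "real \<Rightarrow> nat \<Rightarrow> real" where "E \<equiv> gevrey \<tau> \<sigma>"

definition prod_window :: "(real ^ 'n \<Rightarrow> complex) \<Rightarrow> real ^ 'n \<Rightarrow> real ^ 'n \<Rightarrow> complex" where
  "prod_window f x t = f t * cnj (\<gamma> (t - x))"

lemma v_pos: "v z > 0"
  using v_ge_1[of z] by simp

lemma m_le: "m x \<le> Cm * v (t - x) * m t"
  using moderate[of "x - t" t] v_even[of "t - x"] by simp

lemma \<gamma>_norm_integrable: "integrable lborel (\<lambda>x. norm (iter_deriv is \<gamma> x))"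
  by (rule Bochner_Integration.integrable_bound[OF \<gamma>_integrable[of "is"]])
    (use v_ge_1 in \<open>auto simp: mult_le_cancel_left1 v_pos less_imp_le intro!: AE_I2 borel_measurable_continuous_onI continuous_intros psmooth_continuous \<gamma>\<close>)

text \<open>Recombines a Leibniz term: the derivatives are divided between a factor with constant
  \<open>C\<close> and the window with constant \<open>Cv\<close>, and supermultiplicativity needs a
  common constant that is at least 1.\<close>

lemma E_split:
  assumes "C > 0" "a + b = N"
  shows "E C a * E Cv b \<le> E (max 1 (max C Cv)) N"
proof -
  have "E C a * E Cv b \<le> E (max 1 (max C Cv)) a * E (max 1 (max C Cv)) b"
    using assms Cv by (intro mult_mono gevrey_mono less_imp_le[OF gevrey_pos]) auto
  also have "\<dots> \<le> E (max 1 (max C Cv)) N"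
    unfolding assms(2)[symmetric] using \<tau> \<sigma> by (intro gevrey_mult) auto
  finally show ?thesis .
qed

lemma psmooth_prod_window: "psmooth f \<Longrightarrow> psmooth (prod_window f x)"
  unfolding prod_window_def[abs_def] by (intro psmooth_mult psmooth_cnj psmooth_shift \<gamma>)

lemma iter_deriv_prod_window:
  assumes "psmooth f"
  shows "iter_deriv is (prod_window f x) = (\<lambda>t. \<Sum>(as, bs)\<leftarrow>splits is. iter_deriv as f t * cnj (iter_deriv bs \<gamma> (t - x)))"
  unfolding prod_window_def[abs_def]
    iter_deriv_mult[OF assms psmooth_cnj[OF psmooth_shift[OF \<gamma>]]] iter_deriv_cnj[OF psmooth_shift[OF \<gamma>]] iter_deriv_shift[OF \<gamma>] ..

text \<open>Pure derivatives of the windowed function suffice: their L^1 norms bound their Fourier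
  transforms, and pure powers of the coordinates control |\<xi>|^N.\<close>

lemma stft_decay_of_growth:
  assumes f: "psmooth f" and C: "C > 0" and c: "c > 0"
    and b: "\<And>x \<alpha>. norm (mi_deriv \<alpha> f x) \<le> c * (m x * E C (mi_length \<alpha>))"
  shows "stft_exists \<gamma> f" and "\<exists>D>0. \<exists>B>0. \<forall>x \<xi> N. norm \<xi> ^ N * norm (stft \<gamma> f x \<xi>) \<le> B * (m x * E D N)"
proof -
  define D where "D = max 1 (max C Cv)"
  define B where "B = c * Cm * cv"
  have D: "D \<ge> 1" "D > 0" by (auto simp: D_def)
  have B: "B > 0" using c Cm cv by (simp add: B_def)
  have pure: "integrable lborel (iter_deriv (replicate N i) (prod_window f x))"
    "(LINT t|lborel. norm (iter_deriv (replicate N i) (prod_window f x) t)) \<le> 2 ^ N * (B * (m x * E D N))" for N i x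
  proof -
    let ?T = "\<lambda>(as, bs) t. iter_deriv as f t * cnj (iter_deriv bs \<gamma> (t - x))"
    have e: "iter_deriv (replicate N i) (prod_window f x) = (\<lambda>t. \<Sum>p\<leftarrow>splits (replicate N i). ?T p t)"
      unfolding iter_deriv_prod_window[OF f] by (simp add: case_prod_unfold)
    have T: "integrable lborel (?T p) \<and> (LINT t|lborel. norm (?T p t)) \<le> B * (m x * E D N)"
      if p: "p \<in> set (splits (replicate N i))" for p
    proof -
      obtain as bs where ab: "p = (as, bs)" by force
      have l: "length as + length bs = N" using splits_length_add[of as bs] p ab by simp
      \<comment> \<open>Both halves of a split of a constant list are constant, so the hypothesis on
        \<open>mi_deriv\<close> applies to \<open>as\<close> whatever order was chosen
        there.\<close>
      have "as = replicate (length as) i" using splits_subset[of as bs "replicate N i"] p ab by (intro replicate_eqI) auto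
      hence as: "iter_deriv as f = mi_deriv (list_mi as) f"
        by (metis mi_deriv_eq mi_list_list_mi_replicate)
      let ?w = "\<lambda>t. norm (iter_deriv bs \<gamma> t) * v t"
      let ?K = "c * E C (length as) * (Cm * m x)"
      have K0: "?K \<ge> 0" using c Cm gevrey_pos[OF C, of \<tau> \<sigma> "length as"] m_pos[of x] by simp
      have w: "integrable lborel (\<lambda>t. ?w (t - x))" "(LINT t|lborel. ?w (t - x)) = (LINT t|lborel. ?w t)"
        using lborel_shift[OF \<gamma>_integrable[of bs], of "- x"] by simp_all
      have le: "norm (?T p t) \<le> ?K * ?w (t - x)" for t
      proof -
        have "norm (iter_deriv as f t) \<le> c * (m t * E C (length as))"
          unfolding as using b[of "list_mi as" t] by (simp add: mi_length_list_mi)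
        \<comment> \<open>Moderateness moves \<open>m\<close> from t to x. The price v(x - t) joins
          the derivative of \<gamma>(t - x), whose weighted L^1 norm is finite.\<close>
        also have "\<dots> \<le> c * ((Cm * v (x - t) * m x) * E C (length as))"
          using c gevrey_pos[OF C, of \<tau> \<sigma> "length as"] by (intro mult_left_mono mult_right_mono m_le) auto
        finally have "norm (iter_deriv as f t) \<le> ?K * v (t - x)"
          using v_even[of "t - x"] by (simp add: mult_ac)
        hence "norm (?T p t) \<le> ?K * v (t - x) * norm (iter_deriv bs \<gamma> (t - x))"
          unfolding ab by (simp add: norm_mult mult_right_mono)
        thus ?thesis by (simp add: mult_ac)
      qed
      have Tm: "?T p \<in> borel_measurable lborel"
        unfolding ab using psmooth_continuous[OF f, of UNIV as] psmooth_continuous[OF psmooth_cnj[OF psmooth_shift[OF \<gamma>, of x]], of UNIV bs]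
        by (simp only: prod.case, intro borel_measurable_times)
           (auto intro!: borel_measurable_continuous_onI simp: iter_deriv_cnj[OF psmooth_shift[OF \<gamma>]] iter_deriv_shift[OF \<gamma>])
      have i: "integrable lborel (\<lambda>t. ?K * ?w (t - x))" by (intro integrable_mult_right w(1))
      have Ti: "integrable lborel (?T p)"
        by (rule Bochner_Integration.integrable_bound[OF i Tm AE_I2]) (use le in \<open>auto intro: order_trans[OF _ abs_ge_self]\<close>)
      have "(LINT t|lborel. norm (?T p t)) \<le> (LINT t|lborel. ?K * ?w (t - x))"
        by (rule Bochner_Integration.integral_mono[OF integrable_norm[OF Ti] i le])
      also have "\<dots> = ?K * (LINT t|lborel. ?w t)" unfolding integral_mult_right_zero w(2) ..
      also have "\<dots> \<le> ?K * (cv * E Cv (length bs))" by (intro mult_left_mono \<gamma>_L1 K0)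
      also have "\<dots> = B * (m x * (E C (length as) * E Cv (length bs)))" by (simp add: B_def mult_ac)
      also have "\<dots> \<le> B * (m x * E D N)"
        unfolding D_def using B m_pos[of x] by (intro mult_left_mono E_split C l) auto
      finally show ?thesis using Ti by blast
    qed
    show I: "integrable lborel (iter_deriv (replicate N i) (prod_window f x))"
      unfolding e by (rule integral_sum_list(1)) (use T in blast)
    have "(LINT t|lborel. norm (iter_deriv (replicate N i) (prod_window f x) t)) \<le> (LINT t|lborel. (\<Sum>p\<leftarrow>splits (replicate N i). norm (?T p t)))"
    proof (rule Bochner_Integration.integral_mono[OF integrable_norm[OF I]])
      show "integrable lborel (\<lambda>t. \<Sum>p\<leftarrow>splits (replicate N i). norm (?T p t))"
        by (rule integral_sum_list(1)) (use T in blast)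
      show "norm (iter_deriv (replicate N i) (prod_window f x) t) \<le> (\<Sum>p\<leftarrow>splits (replicate N i). norm (?T p t))" for t
        unfolding e by (rule norm_sum_list_le) simp
    qed
    also have "\<dots> = (\<Sum>p\<leftarrow>splits (replicate N i). LINT t|lborel. norm (?T p t))"
      by (rule integral_sum_list(2)) (use T in blast)
    also have "\<dots> \<le> real (length (splits (replicate N i))) * (B * (m x * E D N))"
      by (rule sum_list_le_length) (use T in blast)
    finally show "(LINT t|lborel. norm (iter_deriv (replicate N i) (prod_window f x) t)) \<le> 2 ^ N * (B * (m x * E D N))"
      by (simp add: length_splits)
  qed
  have st: "stft \<gamma> f x \<xi> = fourier (prod_window f x) \<xi>" for x \<xi>
    unfolding stft_eq_fourier prod_window_def ..
  show "stft_exists \<gamma> f"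
    unfolding stft_exists_iff using pure(1)[of 0] by (simp add: prod_window_def[abs_def])
  have F: "fourier (iter_deriv (replicate N i) (prod_window f x)) \<xi> = deriv_symbol (replicate N i) \<xi> * stft \<gamma> f x \<xi>" for N i x \<xi>
  proof (induction N)
    case (Suc N)
    note p = psmooth_prod_window[OF f, of x]
    have "fourier (iter_deriv (i # replicate N i) (prod_window f x)) \<xi> = 2 * pi * \<i> * of_real (\<xi> $ i) * fourier (iter_deriv (replicate N i) (prod_window f x)) \<xi>"
      using pure(1)[of "Suc N" i x] pure(1)[of N i x]
      by (intro fourier_partial psmooth_has_partial psmooth_continuous p) auto
    thus ?case by (simp only: Suc replicate_Suc deriv_symbol_simps mult.assoc)
  qed (simp add: st)
  let ?d = "real CARD('n)"
  have d: "?d \<ge> 1" by (simp add: Suc_le_eq)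
  hence d2: "2 * ?d \<ge> 1" by linarith
  show "\<exists>D>0. \<exists>B>0. \<forall>x \<xi> N. norm \<xi> ^ N * norm (stft \<gamma> f x \<xi>) \<le> B * (m x * E D N)"
  proof (intro exI conjI allI)
    \<comment> \<open>In the first constant, 2 counts the Leibniz terms per derivative and d
      compares |\<xi>| with a coordinate. The d in the second comes from summing over the
      coordinates.\<close>
    show "2 * ?d * D > 0" "?d * B > 0" using d D B by auto
    fix x \<xi> N
    have "norm \<xi> ^ N * norm (stft \<gamma> f x \<xi>) \<le> ?d ^ N * (\<Sum>i\<in>UNIV. norm (deriv_symbol (replicate N i) \<xi>) * norm (stft \<gamma> f x \<xi>))"
      by (rule norm_power_le_sum_deriv_symbol) simp
    also have "\<dots> \<le> ?d ^ N * (\<Sum>i\<in>(UNIV::'n set). 2 ^ N * (B * (m x * E D N)))"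
    proof (intro mult_left_mono sum_mono)
      fix i
      show "norm (deriv_symbol (replicate N i) \<xi>) * norm (stft \<gamma> f x \<xi>) \<le> 2 ^ N * (B * (m x * E D N))"
        unfolding norm_mult[symmetric] F[symmetric] by (rule order_trans[OF norm_fourier_le pure(2)])
    qed simp
    also have "\<dots> = ?d * B * m x * ((2 * ?d) ^ N * E D N)" by (simp add: power_mult_distrib mult_ac)
    also have "\<dots> \<le> ?d * B * m x * E (2 * ?d * D) N"
      using B m_pos[of x] D by (intro mult_left_mono gevrey_power[OF d2 \<sigma>]) auto
    finally show "norm \<xi> ^ N * norm (stft \<gamma> f x \<xi>) \<le> ?d * B * (m x * E (2 * ?d * D) N)"
      by (simp add: mult.assoc)
  qed
qed

text \<open>By Fourier inversion a derivative of the windowed function is bounded by a moment of its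
  transform. The bound is uniform in t but carries the weight at x.\<close>

lemma prod_window_deriv_bound:
  assumes f: "psmooth f" and ex: "stft_exists \<gamma> f" and C: "C > 0" and c: "c > 0"
    and b: "\<And>x \<xi> N. norm \<xi> ^ N * norm (stft \<gamma> f x \<xi>) \<le> c * (m x * E C N)"
  obtains D B where "D > 0" "B > 0" "\<And>x is t. norm (iter_deriv is (prod_window f x) t) \<le> B * (m x * E D (length is))"
proof -
  let ?d = "CARD('n)"
  \<comment> \<open>The moment estimate asks for 2d additional powers of |\<xi>|; shift stability
    brings the index back to N.\<close>
  obtain C' c' where C': "C' > 0" "c' > 0" "\<And>N. E C (N + 2 * ?d) \<le> c' * E C' N"
    using gevrey_shift[OF \<tau> \<sigma> C] by blast
  define W where "W = (LINT \<omega>|lborel. tensor_weight (\<omega> :: real^'n))"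
  have W0: "W \<ge> 0" unfolding W_def by (intro Bochner_Integration.integral_nonneg less_imp_le[OF tensor_weight_pos])
  define M where "M = max C C'"
  have M: "M > 0" using C by (simp add: M_def)
  define B where "B = 2 ^ ?d * (c * (1 + c')) * (W + 1)"
  have B: "B > 0" using c C' W0 by (simp add: B_def)
  have "norm (iter_deriv is (prod_window f x) t) \<le> B * (m x * E (2 * pi * M) (length is))" for x "is" t
  proof -
    let ?P = "prod_window f x" and ?N = "length is"
    have P: "integrable lborel ?P" using ex by (simp add: stft_exists_iff prod_window_def[abs_def])
    have st: "stft \<gamma> f x \<xi> = fourier ?P \<xi>" for \<xi> unfolding stft_eq_fourier prod_window_def ..
    have V: "rapid (fourier ?P)"
      unfolding rapid_def
    proof (intro conjI allI)
      show "fourier ?P \<in> borel_measurable borel" by (intro borel_measurable_continuous_onI continuous_fourier P)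
      show "\<exists>B. \<forall>\<omega>. norm \<omega> ^ N * norm (fourier ?P \<omega>) \<le> B" for N
        using b[of _ N x] unfolding st by blast
    qed
    have "AE t in lborel. ?P t = ifourier (fourier ?P) t" by (rule fourier_inversion[OF P rapid_integrable[OF V]])
    moreover have "continuous_on UNIV ?P"
      using psmooth_continuous[OF psmooth_prod_window[OF f, of x], of UNIV "[]"] by simp
    \<comment> \<open>Equality almost everywhere would not allow differentiation; continuity of both
      sides makes it hold everywhere.\<close>
    ultimately have Pe: "?P = ifourier (fourier ?P)"
      by (intro AE_eq_continuous continuous_ifourier rapid_integrable V)
    have "norm (iter_deriv is ?P t) \<le> (2 * pi) ^ ?N * (LINT \<omega>|lborel. norm \<omega> ^ ?N * norm (fourier ?P \<omega>))"
      using norm_iter_deriv_ifourier_le[OF V, of "is" t] Pe by simp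
    also have "\<dots> \<le> (2 * pi) ^ ?N * (2 ^ ?d * (c * (m x * E C ?N) + c * (m x * E C (?N + 2 * ?d))) * W)"
      unfolding W_def using V b[of _ _ x] by (intro mult_left_mono moment_bound(2)) (auto simp: rapid_def st)
    also have "\<dots> \<le> (2 * pi) ^ ?N * (2 ^ ?d * (c * (m x * E M ?N) + c * (m x * (c' * E M ?N))) * (W + 1))"
    proof (intro mult_left_mono mult_mono add_mono)
      show "E C ?N \<le> E M ?N" using C by (intro gevrey_mono) (auto simp: M_def)
      have "E C' ?N \<le> E M ?N" using C' by (intro gevrey_mono) (auto simp: M_def)
      hence "c' * E C' ?N \<le> c' * E M ?N" using C' by simp
      thus "E C (?N + 2 * ?d) \<le> c' * E M ?N" by (rule order_trans[OF C'(3)])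
    qed (use c C' C M W0 less_imp_le[OF m_pos[of x]] less_imp_le[OF gevrey_pos[OF M, of \<tau> \<sigma> ?N]] in \<open>auto intro!: add_nonneg_nonneg mult_nonneg_nonneg\<close>)
    also have "\<dots> = B * (m x * ((2 * pi) ^ ?N * E M ?N))" by (simp add: B_def algebra_simps)
    also have "\<dots> \<le> B * (m x * E (2 * pi * M) ?N)"
      using B less_imp_le[OF m_pos[of x]] pi_gt3 \<sigma> M by (intro mult_left_mono gevrey_power) auto
    finally show ?thesis .
  qed
  thus thesis using that[of "2 * pi * M" B] M B by simp
qed

text \<open>The derivative of \<open>f\<close> is recovered by integrating the derivative of \<open>f(t) |\<gamma>(t - x)|\<^sup>2\<close> in \<open>t\<close> over \<open>x\<close>: the terms in which
  a derivative hits \<open>|\<gamma>|\<^sup>2\<close> have mean zero.\<close>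

lemma growth_of_stft_decay:
  assumes f: "psmooth f" and ex: "stft_exists \<gamma> f" and C: "C > 0" and c: "c > 0"
    and b: "\<And>x \<xi> N. norm \<xi> ^ N * norm (stft \<gamma> f x \<xi>) \<le> c * (m x * E C N)"
  shows "\<exists>D>0. \<exists>B>0. \<forall>x is. norm (iter_deriv is f x) \<le> B * (m x * E D (length is))"
proof -
  obtain C1 c1 where C1: "C1 > 0" "c1 > 0"
    and P: "\<And>x is t. norm (iter_deriv is (prod_window f x) t) \<le> c1 * (m x * E C1 (length is))"
    using prod_window_deriv_bound[OF assms] by blast
  \<comment> \<open>The function |\<gamma>|^2, written as a product of smooth functions so that the
    Leibniz rule applies to it.\<close>
  define w where "w z = cnj (\<gamma> z) * \<gamma> z" for z
  have w: "psmooth w" unfolding w_def[abs_def] by (intro psmooth_mult psmooth_cnj \<gamma>)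
  have wI: "integrable lborel (iter_deriv is w)" for "is"
  proof -
    \<comment> \<open>One factor is bounded, the other is integrable.\<close>
    have t: "integrable lborel (\<lambda>z. cnj (iter_deriv as \<gamma> z) * iter_deriv bs \<gamma> z)" for as bs
    proof -
      obtain B where B: "\<And>x. norm (iter_deriv as \<gamma> x) \<le> B" using \<gamma>_bounded[of as] by blast
      show ?thesis
      proof (rule Bochner_Integration.integrable_bound[OF integrable_mult_right[OF \<gamma>_norm_integrable[of bs], of B] _ AE_I2])
        show "(\<lambda>z. cnj (iter_deriv as \<gamma> z) * iter_deriv bs \<gamma> z) \<in> borel_measurable lborel"
          by (simp, intro borel_measurable_continuous_onI continuous_intros psmooth_continuous \<gamma>)
        fix z
        show "norm (cnj (iter_deriv as \<gamma> z) * iter_deriv bs \<gamma> z) \<le> norm (B * norm (iter_deriv bs \<gamma> z))"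
          using mult_right_mono[OF B[of z], of "norm (iter_deriv bs \<gamma> z)"] by (simp add: norm_mult)
      qed
    qed
    have "iter_deriv is w = (\<lambda>z. \<Sum>p\<leftarrow>splits is. cnj (iter_deriv (fst p) \<gamma> z) * iter_deriv (snd p) \<gamma> z)"
      unfolding w_def[abs_def] iter_deriv_mult[OF psmooth_cnj[OF \<gamma>] \<gamma>] iter_deriv_cnj[OF \<gamma>]
      by (simp add: case_prod_unfold)
    thus ?thesis using integral_sum_list(1)[of "splits is" lborel "\<lambda>p z. cnj (iter_deriv (fst p) \<gamma> z) * iter_deriv (snd p) \<gamma> z", OF t]
      by simp
  qed
  define c0 where "c0 = (LINT z|lborel. w z)"
  \<comment> \<open>Here \<open>c0\<close> is the squared L^2 norm of \<gamma>. It cannot vanish,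
    because \<gamma> is continuous and not identically zero.\<close>
  have c0: "c0 \<noteq> 0"
  proof
    assume "c0 = 0"
    have wn: "w z = of_real ((norm (\<gamma> z))\<^sup>2)" for z
      by (simp add: w_def mult.commute flip: complex_norm_square)
    have i: "integrable lborel (\<lambda>z. (norm (\<gamma> z))\<^sup>2)"
      using wI[of "[]"] by (simp add: wn[abs_def] complex_of_real_integrable_eq del: of_real_power)
    have "(LINT z|lborel. (norm (\<gamma> z))\<^sup>2) = 0"
      using \<open>c0 = 0\<close> unfolding c0_def wn by (simp del: of_real_power)
    hence "AE z in lborel. (norm (\<gamma> z))\<^sup>2 = 0"
      by (subst (asm) integral_nonneg_eq_0_iff_AE[OF i]) auto
    hence "AE z in lborel. \<gamma> z = 0" by simp
    hence "\<gamma> = (\<lambda>z. 0)"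
      using psmooth_continuous[OF \<gamma>, of UNIV "[]"] by (intro AE_eq_continuous) auto
    thus False using \<gamma>_nonzero by simp
  qed
  have w0: "(LINT z|lborel. iter_deriv bs w z) = (if bs = [] then c0 else 0)" for bs
  proof (cases bs)
    case (Cons i bs')
    show ?thesis unfolding Cons
      using integral_partial_eq_0[OF psmooth_has_partial[OF w, of i bs'] psmooth_continuous[OF w] wI wI] by simp
  qed (simp add: c0_def)
  define D where "D = max 1 (max C1 Cv)"
  define B where "B = c1 * Cm * cv"
  have D: "D \<ge> 1" by (simp add: D_def)
  have B: "B > 0" using C1 Cm cv by (simp add: B_def)
  have key: "norm (iter_deriv is f t) * norm c0 \<le> 2 ^ length is * (B * (m t * E D (length is)))" for "is" t
  proof -
    \<comment> \<open>This function is expanded in two ways: as f times a shift of \<open>w\<close>,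
      which evaluates its integral over x, and as the windowed function times a shift of \<gamma>,
      which bounds it.\<close>
    define \<Phi> where "\<Phi> x = iter_deriv is (\<lambda>t. f t * w (t - x)) t" for x
    let ?T = "\<lambda>p x. iter_deriv (fst p) f t * iter_deriv (snd p) w (t - x)"
    have \<Phi>1: "\<Phi> = (\<lambda>x. \<Sum>p\<leftarrow>splits is. ?T p x)"
      unfolding \<Phi>_def iter_deriv_mult[OF f psmooth_shift[OF w]] iter_deriv_shift[OF w] by (simp add: case_prod_unfold)
    have Ti: "integrable lborel (?T p)" for p
      by (intro integrable_mult_right lborel_reflect(1) wI)
    have \<Phi>i: "integrable lborel \<Phi>" unfolding \<Phi>1 by (rule integral_sum_list(1)[OF Ti])
    have "(LINT x|lborel. \<Phi> x) = (\<Sum>p\<leftarrow>splits is. LINT x|lborel. ?T p x)"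
      unfolding \<Phi>1 by (rule integral_sum_list(2)[OF Ti])
    also have "\<dots> = (\<Sum>p\<leftarrow>splits is. if snd p = [] then iter_deriv (fst p) f t * c0 else 0)"
      unfolding integral_mult_right_zero lborel_reflect(2)[OF wI] w0 by (intro arg_cong[where f=sum_list] map_cong) auto
    also have "\<dots> = iter_deriv is f t * c0"
      using sum_splits_right_Nil[of "\<lambda>as. iter_deriv as f t * c0" "is"] by (simp add: case_prod_unfold)
    finally have I: "(LINT x|lborel. \<Phi> x) = iter_deriv is f t * c0" .
    let ?w = "\<lambda>bs z. norm (iter_deriv bs \<gamma> z) * v z"
    let ?Q = "\<lambda>p x. c1 * E C1 (length (fst p)) * (Cm * m t) * ?w (snd p) (t - x)"
    have Qi: "integrable lborel (?Q p)" for p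
      by (intro integrable_mult_right lborel_reflect(1) \<gamma>_integrable)
    have \<Phi>le: "norm (\<Phi> x) \<le> (\<Sum>p\<leftarrow>splits is. ?Q p x)" for x
    proof -
      have "\<Phi> x = iter_deriv is (\<lambda>t. prod_window f x t * \<gamma> (t - x)) t"
        unfolding \<Phi>_def prod_window_def w_def by (simp add: mult.assoc)
      also have "\<dots> = (\<Sum>p\<leftarrow>splits is. iter_deriv (fst p) (prod_window f x) t * iter_deriv (snd p) \<gamma> (t - x))"
        unfolding iter_deriv_mult[OF psmooth_prod_window[OF f] psmooth_shift[OF \<gamma>]] iter_deriv_shift[OF \<gamma>]
        by (simp add: case_prod_unfold)
      finally have e: "\<Phi> x = (\<Sum>p\<leftarrow>splits is. iter_deriv (fst p) (prod_window f x) t * iter_deriv (snd p) \<gamma> (t - x))" .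
      show ?thesis unfolding e
      proof (rule norm_sum_list_le)
        fix p :: "'n list \<times> 'n list"
        let ?a = "length (fst p :: 'n list)"
        have "norm (iter_deriv (fst p) (prod_window f x) t) \<le> c1 * (m x * E C1 ?a)" by (rule P)
        \<comment> \<open>Here the weight moves back from x to t; the second copy of the window pays
          for v(t - x) when x is integrated out.\<close>
        also have "\<dots> \<le> c1 * ((Cm * v (t - x) * m t) * E C1 ?a)"
          using C1 gevrey_pos[OF C1(1), of \<tau> \<sigma> ?a] by (intro mult_left_mono mult_right_mono m_le) auto
        finally have "norm (iter_deriv (fst p) (prod_window f x) t) \<le> c1 * ((Cm * v (t - x) * m t) * E C1 ?a)" .
        from mult_right_mono[OF this, of "norm (iter_deriv (snd p) \<gamma> (t - x))"]
        show "norm (iter_deriv (fst p) (prod_window f x) t * iter_deriv (snd p) \<gamma> (t - x)) \<le> ?Q p x"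
          by (simp add: norm_mult mult_ac)
      qed
    qed
    have "norm (iter_deriv is f t) * norm c0 = norm (LINT x|lborel. \<Phi> x)" unfolding I norm_mult ..
    also have "\<dots> \<le> (LINT x|lborel. norm (\<Phi> x))" by (rule integral_norm_bound)
    also have "\<dots> \<le> (LINT x|lborel. (\<Sum>p\<leftarrow>splits is. ?Q p x))"
      by (rule Bochner_Integration.integral_mono[OF integrable_norm[OF \<Phi>i] integral_sum_list(1)[OF Qi] \<Phi>le])
    also have "\<dots> = (\<Sum>p\<leftarrow>splits is. LINT x|lborel. ?Q p x)" by (rule integral_sum_list(2)[OF Qi])
    also have "\<dots> \<le> real (length (splits is)) * (B * (m t * E D (length is)))"
    proof (rule sum_list_le_length)
      fix p assume p: "p \<in> set (splits is)"
      have l: "length (fst p) + length (snd p) = length is"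
        using splits_length_add[of "fst p" "snd p" "is"] p by simp
      have "(LINT x|lborel. ?Q p x) = c1 * E C1 (length (fst p)) * (Cm * m t) * (LINT z|lborel. ?w (snd p) z)"
        unfolding integral_mult_right_zero lborel_reflect(2)[OF \<gamma>_integrable] ..
      also have "\<dots> \<le> c1 * E C1 (length (fst p)) * (Cm * m t) * (cv * E Cv (length (snd p)))"
        using C1 Cm m_pos[of t] gevrey_pos[OF C1(1), of \<tau> \<sigma> "length (fst p)"] by (intro mult_left_mono \<gamma>_L1) auto
      also have "\<dots> = B * (m t * (E C1 (length (fst p)) * E Cv (length (snd p))))"
        by (simp add: B_def mult_ac)
      also have "\<dots> \<le> B * (m t * E D (length is))"
        unfolding D_def using B m_pos[of t] by (intro mult_left_mono E_split C1 l) auto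
      finally show "(LINT x|lborel. ?Q p x) \<le> B * (m t * E D (length is))" .
    qed
    finally show ?thesis by (simp add: length_splits)
  qed
  show ?thesis
  proof (intro exI conjI allI)
    \<comment> \<open>The factor 2 absorbs the 2^N Leibniz terms, and division by |c0| undoes the
      normalization of the reconstruction.\<close>
    show "2 * D > 0" "B / norm c0 > 0" using D B c0 by auto
    fix x "is"
    have "norm (iter_deriv is f x) \<le> 2 ^ length is * (B * (m x * E D (length is))) / norm c0"
      using key[of "is" x] c0 by (simp add: field_simps)
    also have "\<dots> = B / norm c0 * m x * (2 ^ length is * E D (length is))" by simp
    also have "\<dots> \<le> B / norm c0 * m x * E (2 * D) (length is)"
      using B m_pos[of x] D \<sigma> by (intro mult_left_mono gevrey_power) auto
    finally show "norm (iter_deriv is f x) \<le> B / norm c0 * (m x * E (2 * D) (length is))" by (simp add: mult.assoc)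
  qed
qed

end

theorem theorem3p1:
  fixes \<tau> \<sigma> :: real
    and v m :: "real ^ 'n::finite \<Rightarrow> real"
    and u :: "(real ^ 'n \<Rightarrow> complex) \<Rightarrow> complex"
    and g f :: "real ^ 'n \<Rightarrow> complex"
  assumes "\<tau> > 0" and "\<sigma> \<ge> 1"
    and "submultiplicative_weight v"
    and "moderate_weight v m"
    and "u \<in> M11 v" and "\<exists>\<phi>\<in>S1. u \<phi> \<noteq> 0"
    and "represents g u"
    and "\<exists>C\<^sub>g>0. \<exists>c>0. \<forall>\<alpha>. \<exists>G. represents G (dual_deriv \<alpha> u) \<and>
           L1_norm v G \<le> ennreal (c * (C\<^sub>g powr (real (mi_length \<alpha>) powr \<sigma>) * M_seq \<tau> \<sigma> (mi_length \<alpha>)))"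
    and "smooth f"
  shows "((\<exists>C\<^sub>f>0. \<exists>c>0. \<forall>x \<alpha>.
             norm (mi_deriv \<alpha> f x)
               \<le> c * (m x * C\<^sub>f powr (real (mi_length \<alpha>) powr \<sigma>) * M_seq \<tau> \<sigma> (mi_length \<alpha>)))
          \<longleftrightarrow>
          (stft_exists g f \<and>
           (\<exists>C\<^sub>f\<^sub>g>0. \<exists>c>0. \<forall>x \<xi> (\<alpha> :: nat ^ 'n).
             norm \<xi> ^ mi_length \<alpha> * norm (stft g f x \<xi>)
               \<le> c * (m x * C\<^sub>f\<^sub>g powr (real (mi_length \<alpha>) powr \<sigma>) * M_seq \<tau> \<sigma> (mi_length \<alpha>)))))
       \<and>
         ((stft_exists g f \<and>
           (\<exists>C\<^sub>f\<^sub>g>0. \<exists>c>0. \<forall>x \<xi> (\<alpha> :: nat ^ 'n).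
             norm \<xi> ^ mi_length \<alpha> * norm (stft g f x \<xi>)
               \<le> c * (m x * C\<^sub>f\<^sub>g powr (real (mi_length \<alpha>) powr \<sigma>) * M_seq \<tau> \<sigma> (mi_length \<alpha>))))
          \<longleftrightarrow>
          (stft_exists g f \<and>
           (\<exists>C>0. \<exists>c>0. \<forall>x \<xi>.
             norm (stft g f x \<xi>) \<le> c * (m x * exp (- assoc_fun \<tau> \<sigma> C (norm \<xi>))))))"
proof -
  obtain \<gamma> Cv cv Cm where W: "stft_window \<tau> \<sigma> Cv cv Cm v m \<gamma>" and ae: "AE t in lborel. g t = \<gamma> t"
    by (rule smooth_window[OF assms(1,2,3,4,6,7,8)])
  interpret stft_window \<tau> \<sigma> Cv cv Cm v m \<gamma> by (rule W)
  have f: "psmooth f" by (rule smooth_psmooth[OF assms(9)])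
  have [measurable]: "f \<in> borel_measurable borel"
    using psmooth_continuous[OF f, of UNIV "[]"] by (intro borel_measurable_continuous_onI) simp
  have [measurable]: "\<gamma> \<in> borel_measurable borel"
    using psmooth_continuous[OF \<gamma>, of UNIV "[]"] by (intro borel_measurable_continuous_onI) simp
  have [measurable]: "g \<in> borel_measurable borel"
    using assms(7) by (simp add: represents_def)
  have cnj_measurable [measurable (raw)]: "(\<lambda>t. cnj (F t)) \<in> borel_measurable M"
    if "F \<in> borel_measurable M" for F :: "real ^ 'n \<Rightarrow> complex" and M
    using that by (rule measurable_compose) (intro borel_measurable_continuous_onI continuous_intros)
  \<comment> \<open>For each x the exceptional null set is merely translated, so existence and
    values of the transform do not change when \<open>g\<close> is replaced by \<gamma>.\<close>
  have shift: "AE t in lborel. g (t - x) = \<gamma> (t - x)" for x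
    by (rule AE_lborel_shift[OF ae]) measurable
  hence prod_ae: "AE t in lborel. f t * cnj (g (t - x)) = f t * cnj (\<gamma> (t - x))" for x
    using shift[of x] by eventually_elim simp
  have ex: "stft_exists g f = stft_exists \<gamma> f"
    unfolding stft_exists_iff by (intro all_cong1 integrable_cong_AE prod_ae) measurable
  have st: "stft g f x \<xi> = stft \<gamma> f x \<xi>" for x \<xi>
    unfolding stft_def stft_integrand_def
  proof (rule integral_cong_AE)
    have [measurable]: "(\<lambda>t. cis (- 2 * pi * (t \<bullet> \<xi>))) \<in> borel_measurable borel"
      by (intro borel_measurable_continuous_onI continuous_intros)
    show "(\<lambda>t. cis (- 2 * pi * (t \<bullet> \<xi>)) * f t * cnj (g (t - x))) \<in> borel_measurable lborel"
      "(\<lambda>t. cis (- 2 * pi * (t \<bullet> \<xi>)) * f t * cnj (\<gamma> (t - x))) \<in> borel_measurable lborel"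
      by measurable
    show "AE t in lborel. cis (- 2 * pi * (t \<bullet> \<xi>)) * f t * cnj (g (t - x)) = cis (- 2 * pi * (t \<bullet> \<xi>)) * f t * cnj (\<gamma> (t - x))"
      using shift[of x] by eventually_elim simp
  qed
  have e: "m x * C powr (real N powr \<sigma>) * M_seq \<tau> \<sigma> N = m x * E C N" for x C N
    by (simp add: gevrey_def mult.assoc)
  \<comment> \<open>Every N is the length of some multi-index, for instance one concentrated on a
    single coordinate; condition (ii) sees \<alpha> only through its length.\<close>
  have all_N: "(\<forall>\<alpha> :: nat ^ 'n. Q (mi_length \<alpha>)) \<longleftrightarrow> (\<forall>N. Q N)" for Q
    by (metis length_replicate mi_length_list_mi)
  have ii_eq: "(\<exists>C>0. \<exists>c>0. \<forall>x \<xi> (\<alpha> :: nat ^ 'n). norm \<xi> ^ mi_length \<alpha> * norm (stft \<gamma> f x \<xi>) \<le> c * (m x * E C (mi_length \<alpha>)))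
    \<longleftrightarrow> (\<exists>C>0. \<exists>c>0. \<forall>x \<xi> N. norm \<xi> ^ N * norm (stft \<gamma> f x \<xi>) \<le> c * (m x * E C N))"
    by (rule ex_cong1, rule conj_cong[OF refl], rule ex_cong1, rule conj_cong[OF refl],
        rule all_cong1, rule all_cong1, rule all_N)
  let ?i = "\<exists>C>0. \<exists>c>0. \<forall>x \<alpha>. norm (mi_deriv \<alpha> f x) \<le> c * (m x * E C (mi_length \<alpha>))"
  let ?ii = "stft_exists \<gamma> f \<and> (\<exists>C>0. \<exists>c>0. \<forall>x \<xi> N. norm \<xi> ^ N * norm (stft \<gamma> f x \<xi>) \<le> c * (m x * E C N))"
  let ?iii = "stft_exists \<gamma> f \<and> (\<exists>C>0. \<exists>c>0. \<forall>x \<xi>. norm (stft \<gamma> f x \<xi>) \<le> c * (m x * exp (- assoc_fun \<tau> \<sigma> C (norm \<xi>))))"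
  have 1: "?ii" if h: "?i"
  proof -
    obtain C c where C: "C > 0" "c > 0" "\<And>x \<alpha>. norm (mi_deriv \<alpha> f x) \<le> c * (m x * E C (mi_length \<alpha>))"
      using h by blast
    show ?ii using stft_decay_of_growth[OF f C] by (rule conjI)
  qed
  have 2: "?i" if h: "?ii"
  proof -
    obtain C c where C: "C > 0" "c > 0" "\<And>x \<xi> N. norm \<xi> ^ N * norm (stft \<gamma> f x \<xi>) \<le> c * (m x * E C N)"
      using h by blast
    obtain D B where D: "D > 0" "B > 0" "\<And>x is. norm (iter_deriv is f x) \<le> B * (m x * E D (length is))"
      using growth_of_stft_decay[OF f conjunct1[OF h] C] by blast
    have "norm (mi_deriv \<alpha> f x) \<le> B * (m x * E D (mi_length \<alpha>))" for x \<alpha>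
      using D(3)[of "mi_list \<alpha>" x] by (simp add: mi_deriv_eq length_mi_list)
    thus ?i using D(1,2) by blast
  qed
  have 3: "?iii" if h: "?ii"
  proof -
    obtain C c where C: "C > 0" "c > 0" "\<And>x \<xi> N. norm \<xi> ^ N * norm (stft \<gamma> f x \<xi>) \<le> c * (m x * E C N)"
      using h by blast
    show ?iii
    proof (intro conjI exI allI)
      show "stft_exists \<gamma> f" by (rule conjunct1[OF h])
      show "1 / C > 0" "c > 0" using C by auto
      fix x \<xi>
      show "norm (stft \<gamma> f x \<xi>) \<le> c * (m x * exp (- assoc_fun \<tau> \<sigma> (1 / C) (norm \<xi>)))"
        unfolding mult.assoc[symmetric] using C(3)
        by (intro le_exp_assoc_fun C(1)) (auto simp: mult.assoc)
    qed
  qed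
  have 4: "?ii" if h: "?iii"
  proof -
    obtain C c where C: "C > 0" "c > 0" "\<And>x \<xi>. norm (stft \<gamma> f x \<xi>) \<le> c * (m x * exp (- assoc_fun \<tau> \<sigma> C (norm \<xi>)))"
      using h by blast
    show ?ii
    proof (intro conjI exI allI)
      show "stft_exists \<gamma> f" by (rule conjunct1[OF h])
      show "1 / C > 0" "c > 0" using C by auto
      fix x \<xi> N
      have "norm \<xi> ^ N * norm (stft \<gamma> f x \<xi>) \<le> c * m x * E (1 / C) N"
        using C m_pos[of x] by (intro exp_assoc_fun_le \<tau> \<sigma> C(1)) (auto simp: mult.assoc)
      thus "norm \<xi> ^ N * norm (stft \<gamma> f x \<xi>) \<le> c * (m x * E (1 / C) N)" by (simp only: mult.assoc)
    qed
  qed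
  have "?i \<longleftrightarrow> ?ii" using 1 2 by (rule iffI)
  moreover have "?ii \<longleftrightarrow> ?iii" using 3 4 by (rule iffI)
  ultimately show ?thesis unfolding e ex st ii_eq by (rule conjI)
qed

end
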